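(* Let $M$ be a closed smooth manifold with a Riemannian metric $g$, let $E\to M$ be a real vector bundle with a bundle metric $h$ and a connection $\nabla^E$ (not assumed to preserve $h$), let $\nabla^{TM}$ be any connection on $TM$ (not necessarily the Levi-Civita connection), and let $\varphi$ be a smooth vertical vector field on the total space of $E$; the data $(g,h,\nabla^E,\varphi)$ may depend smoothly on $t$. Let $X\subset E$ be a subset of the total space such that: (P1) $X$ is closed; (P2) the fiber $X_m=X\cap E_m$ is convex for every $m\in M$; (P3) $X$ is invariant under the parallel transport induced by $\nabla^E$. Suppose that for every $m\in M$ the solutions of the ODE $\frac{df}{dt}=\varphi(f)$ in $E_m$ that start in $X_m$ (at any initial time) remain in $X_m$. Then solutions of the PDE $$\frac{\partial f}{\partial t}=\Delta^Ef+\varphi(f)$$ for time-dependent sections $f$ of $E$ also remain in $X$: if $f$ is a smooth solution on $M\times[0,\epsilon]$ with $f(m,0)\in X_m$ for all $m\in M$, then $f(m,t)\in X_m$ for all $m\in M$ and $t\in[0,\epsilon]$.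
   Context: The Laplacian is $\Delta^Es=\mathrm{tr}_g(\nabla^E\circ\nabla^E(s))$, where $\nabla^E$ is extended to a connection on $\Lambda^1M\otimes E$ (with $\Lambda^1M=T^*M$) using $\nabla^{TM}$. A vertical vector field $\varphi$ on $E$ is identified with a smooth fiber-preserving map $\varphi\colon E\to E$, possibly depending on $t$. When the data depend on $t$, (P3) is required for $\nabla^E$ at every time $t$, while the set $X$ does not depend on $t$. *)

theory Defs
  imports "HOL-Analysis.Analysis"
begin

section \<open>Smooth maps between Euclidean spaces\<close>

text \<open>For open \<open>S\<close> in a finite-dimensional space this is being \<open>k\<close> times continuously differentiable.\<close>

primrec Ck_on :: "nat \<Rightarrow> 'a::euclidean_space set \<Rightarrow> ('a \<Rightarrow> 'b::euclidean_space) \<Rightarrow> bool" where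
  "Ck_on 0 S f \<longleftrightarrow> continuous_on S f"
| "Ck_on (Suc k) S f \<longleftrightarrow>
     (\<forall>x\<in>S. f differentiable (at x)) \<and>
     (\<forall>v. Ck_on k S (\<lambda>x. frechet_derivative f (at x) v))"

text \<open>Smoothness on an arbitrary set, for instance on \<open>{0..\<epsilon>} \<times> S\<close> with \<open>S\<close> open, means local
  extendability to a smooth map on an open set.\<close>

definition smooth_on :: "'a::euclidean_space set \<Rightarrow> ('a \<Rightarrow> 'b::euclidean_space) \<Rightarrow> bool" where
  "smooth_on S f \<longleftrightarrow>
     (\<forall>x\<in>S. \<exists>W g. open W \<and> x \<in> W \<and> (\<forall>k. Ck_on k W g) \<and> (\<forall>y\<in>S \<inter> W. f y = g y))"

section \<open>Manifolds\<close>

text \<open>A chart is given by its domain and its coordinate map; only the values of the latter on the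
  domain are relevant.\<close>

type_synonym ('m, 'a) chart = "'m set \<times> ('m \<Rightarrow> 'a)"

definition smooth_atlas ::
  "('m::{t2_space,second_countable_topology}, 'a::euclidean_space) chart set \<Rightarrow> bool" where
  "smooth_atlas A \<longleftrightarrow>
     (\<Union>(U, c)\<in>A. U) = UNIV \<and>
     (\<forall>(U, c)\<in>A. open U \<and> open (c ` U) \<and> homeomorphism U (c ` U) c (inv_into U c)) \<and>
     (\<forall>(U, c)\<in>A. \<forall>(V, d)\<in>A. smooth_on (c ` (U \<inter> V)) (d \<circ> inv_into U c))"

text \<open>The whole type \<open>'m\<close> is the manifold; closed means compact, charts having values in open
  subsets of a Euclidean space (so there is no boundary).\<close>

definition closed_manifold ::
  "('m::{t2_space,second_countable_topology}, 'a::euclidean_space) chart set \<Rightarrow> bool" where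
  "closed_manifold A \<longleftrightarrow> smooth_atlas A \<and> compact (UNIV :: 'm set)"

text \<open>Joint smoothness of \<open>(p, m) \<mapsto> F p m\<close> on \<open>P \<times> W\<close>, with \<open>P\<close> in a Euclidean parameter space and
  \<open>W\<close> an open subset of the manifold.\<close>

definition smooth_family ::
  "('m, 'a::euclidean_space) chart set \<Rightarrow> 'p::euclidean_space set \<Rightarrow> 'm set \<Rightarrow>
   ('p \<Rightarrow> 'm \<Rightarrow> 'b::euclidean_space) \<Rightarrow> bool" where
  "smooth_family A P W F \<longleftrightarrow>
     (\<forall>(U, c)\<in>A. smooth_on (P \<times> c ` (U \<inter> W)) (\<lambda>(p, x). F p (inv_into U c x)))"

definition smooth_fun ::
  "('m, 'a::euclidean_space) chart set \<Rightarrow> 'm set \<Rightarrow> ('m \<Rightarrow> 'b::euclidean_space) \<Rightarrow> bool" where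
  "smooth_fun A W F \<longleftrightarrow> smooth_family A (UNIV :: real set) W (\<lambda>_. F)"

definition smooth_curve ::
  "('m::topological_space, 'a::euclidean_space) chart set \<Rightarrow> real set \<Rightarrow> (real \<Rightarrow> 'm) \<Rightarrow> bool" where
  "smooth_curve A I \<gamma> \<longleftrightarrow>
     continuous_on I \<gamma> \<and> (\<forall>(U, c)\<in>A. smooth_on {r \<in> I. \<gamma> r \<in> U} (c \<circ> \<gamma>))"

section \<open>Vector bundles\<close>

text \<open>The fibers \<open>E\<^sub>m\<close> are linear subspaces of one real vector space \<open>'v\<close>, which carries no topology
  and serves only as a container (every family of vector spaces embeds in such a space, e.g. in its
  direct sum). The total space is the disjoint union \<open>{(m, v). v \<in> E\<^sub>m}\<close>. A local trivialization
  \<open>(U, \<tau>)\<close> consists of linear isomorphisms \<open>\<tau> m\<close> from \<open>E\<^sub>m\<close> to the Euclidean space \<open>'f\<close>, \<open>m \<in> U\<close>,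
  and the topology and smooth structure of the total space are those determined by the local
  trivializations.\<close>

record ('m, 'v, 'f) vbundle =
  fiber :: "'m \<Rightarrow> 'v set"
  trivs :: "('m set \<times> ('m \<Rightarrow> 'v \<Rightarrow> 'f)) set"

definition total_space :: "('m, 'v, 'f) vbundle \<Rightarrow> ('m \<times> 'v) set" where
  "total_space E = Sigma UNIV (fiber E)"

text \<open>The local section that is constant equal to \<open>w\<close> in the trivialization \<open>\<tau>\<close>.\<close>

definition const_section :: "('m, 'v, 'f) vbundle \<Rightarrow> ('m \<Rightarrow> 'v \<Rightarrow> 'f) \<Rightarrow> 'f \<Rightarrow> 'm \<Rightarrow> 'v" where
  "const_section E \<tau> w m = inv_into (fiber E m) (\<tau> m) w"

definition vector_bundle ::
  "('m::{t2_space,second_countable_topology}, 'a::euclidean_space) chart set \<Rightarrow>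
   ('m, 'v::real_vector, 'f::euclidean_space) vbundle \<Rightarrow> bool" where
  "vector_bundle A E \<longleftrightarrow>
     (\<forall>m. subspace (fiber E m)) \<and>
     (\<Union>(U, \<tau>)\<in>trivs E. U) = UNIV \<and>
     (\<forall>(U, \<tau>)\<in>trivs E. open U \<and>
        (\<forall>m\<in>U. bij_betw (\<tau> m) (fiber E m) UNIV \<and>
           (\<forall>v\<in>fiber E m. \<forall>w\<in>fiber E m. \<tau> m (v + w) = \<tau> m v + \<tau> m w) \<and>
           (\<forall>a. \<forall>v\<in>fiber E m. \<tau> m (a *\<^sub>R v) = a *\<^sub>R \<tau> m v))) \<and>
     (\<forall>(U, \<tau>)\<in>trivs E. \<forall>(V, \<sigma>)\<in>trivs E. \<forall>w.
        smooth_fun A (U \<inter> V) (\<lambda>m. \<sigma> m (const_section E \<tau> w m)))"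

definition open_in_total_space ::
  "('m::topological_space, 'v, 'f::topological_space) vbundle \<Rightarrow> ('m \<times> 'v) set \<Rightarrow> bool" where
  "open_in_total_space E W \<longleftrightarrow> W \<subseteq> total_space E \<and>
     (\<forall>(U, \<tau>)\<in>trivs E. open {(m, w). m \<in> U \<and> (m, const_section E \<tau> w m) \<in> W})"

definition total_topology ::
  "('m::topological_space, 'v, 'f::topological_space) vbundle \<Rightarrow> ('m \<times> 'v) topology" where
  "total_topology E = topology (open_in_total_space E)"

lemma istopology_open_in_total_space: "istopology (open_in_total_space E)"
proof -
  have "open_in_total_space E (S \<inter> T)"
    if S: "open_in_total_space E S" and T: "open_in_total_space E T" for S T
  proof -
    have "{(m, w). m \<in> U \<and> (m, const_section E \<tau> w m) \<in> S \<inter> T} =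
        {(m, w). m \<in> U \<and> (m, const_section E \<tau> w m) \<in> S} \<inter>
        {(m, w). m \<in> U \<and> (m, const_section E \<tau> w m) \<in> T}" for U \<tau>
      by auto
    with S T show ?thesis
      unfolding open_in_total_space_def by (auto intro!: open_Int)
  qed
  moreover have "open_in_total_space E (\<Union>\<K>)"
    if K: "\<forall>S\<in>\<K>. open_in_total_space E S" for \<K>
  proof -
    have "{(m, w). m \<in> U \<and> (m, const_section E \<tau> w m) \<in> \<Union>\<K>} =
        (\<Union>S\<in>\<K>. {(m, w). m \<in> U \<and> (m, const_section E \<tau> w m) \<in> S})" for U \<tau>
      by auto
    with K show ?thesis
      unfolding open_in_total_space_def by (fastforce intro!: open_UN)
  qed
  ultimately show ?thesis
    unfolding istopology_def by blast
qed

text \<open>Smooth families of sections over \<open>W\<close>, with parameter in \<open>P\<close>.\<close>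

definition smooth_section_family ::
  "('m, 'a::euclidean_space) chart set \<Rightarrow> ('m, 'v, 'f::euclidean_space) vbundle \<Rightarrow>
   'p::euclidean_space set \<Rightarrow> 'm set \<Rightarrow> ('p \<Rightarrow> 'm \<Rightarrow> 'v) \<Rightarrow> bool" where
  "smooth_section_family A E P W s \<longleftrightarrow>
     (\<forall>p\<in>P. \<forall>m\<in>W. s p m \<in> fiber E m) \<and>
     (\<forall>(U, \<tau>)\<in>trivs E. smooth_family A P (U \<inter> W) (\<lambda>p m. \<tau> m (s p m)))"

definition smooth_section ::
  "('m, 'a::euclidean_space) chart set \<Rightarrow> ('m, 'v, 'f::euclidean_space) vbundle \<Rightarrow>
   'm set \<Rightarrow> ('m \<Rightarrow> 'v) \<Rightarrow> bool" where
  "smooth_section A E W s \<longleftrightarrow> smooth_section_family A E (UNIV :: real set) W (\<lambda>_. s)"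

text \<open>Derivative of a curve \<open>c\<close> in the single fiber \<open>E\<^sub>m\<close>, read off in the linear coordinates \<open>\<tau> m\<close>.\<close>

definition has_fiber_derivative ::
  "('m, 'v, 'f::euclidean_space) vbundle \<Rightarrow> 'm \<Rightarrow> (real \<Rightarrow> 'v) \<Rightarrow> 'v \<Rightarrow> real filter \<Rightarrow> bool" where
  "has_fiber_derivative E m c v F \<longleftrightarrow>
     (\<forall>(U, \<tau>)\<in>trivs E. m \<in> U \<longrightarrow> ((\<lambda>r. \<tau> m (c r)) has_vector_derivative \<tau> m v) F)"

text \<open>Time-dependent vertical vector fields on the total space, as fiber-preserving maps that are
  smooth jointly in time, base point and fiber coordinate.\<close>

definition vertical_vector_field ::
  "('m, 'a::euclidean_space) chart set \<Rightarrow> ('m, 'v, 'f::euclidean_space) vbundle \<Rightarrow>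
   real set \<Rightarrow> (real \<Rightarrow> 'm \<Rightarrow> 'v \<Rightarrow> 'v) \<Rightarrow> bool" where
  "vertical_vector_field A E T \<phi> \<longleftrightarrow>
     (\<forall>t\<in>T. \<forall>m. \<forall>v\<in>fiber E m. \<phi> t m v \<in> fiber E m) \<and>
     (\<forall>(U, \<tau>)\<in>trivs E. smooth_family A (T \<times> (UNIV :: 'f set)) U
        (\<lambda>(t, w) m. \<tau> m (\<phi> t m (const_section E \<tau> w m))))"

text \<open>Smooth families of bundle metrics.\<close>

definition bundle_metric ::
  "('m::topological_space, 'a::euclidean_space) chart set \<Rightarrow>
   ('m, 'v::real_vector, 'f::euclidean_space) vbundle \<Rightarrow>
   real set \<Rightarrow> (real \<Rightarrow> 'm \<Rightarrow> 'v \<Rightarrow> 'v \<Rightarrow> real) \<Rightarrow> bool" where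
  "bundle_metric A E T h \<longleftrightarrow>
     (\<forall>t\<in>T. \<forall>m. \<forall>u\<in>fiber E m. \<forall>v\<in>fiber E m.
        h t m u v = h t m v u \<and>
        (\<forall>w\<in>fiber E m. h t m (u + v) w = h t m u w + h t m v w) \<and>
        (\<forall>a. h t m (a *\<^sub>R u) v = a * h t m u v) \<and>
        (u \<noteq> 0 \<longrightarrow> h t m u u > 0)) \<and>
     (\<forall>W s s'. open W \<and> smooth_section A E W s \<and> smooth_section A E W s' \<longrightarrow>
        smooth_family A T W (\<lambda>t m. h t m (s m) (s' m)))"

section \<open>Tangent bundle\<close>

text \<open>Each tangent space \<open>T\<^sub>mM\<close> is represented by the model space \<open>'a\<close>, a vector standing for its
  components in a chart around \<open>m\<close> chosen once and for all. The components of the same tangent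
  vector in any other chart are obtained with the derivative of the coordinate change; these
  component maps are the local trivializations. The choice of charts is not continuous in \<open>m\<close>, so
  smoothness of a vector field is smoothness of its components in these trivializations.\<close>

definition chart_at :: "('m, 'a) chart set \<Rightarrow> 'm \<Rightarrow> ('m, 'a) chart" where
  "chart_at A m = (SOME (U, c). (U, c) \<in> A \<and> m \<in> U)"

text \<open>The differential at \<open>m\<close> of a Euclidean-valued map \<open>F\<close> defined near \<open>m\<close>.\<close>

definition differential ::
  "('m, 'a::euclidean_space) chart set \<Rightarrow> ('m \<Rightarrow> 'b::euclidean_space) \<Rightarrow> 'm \<Rightarrow> 'a \<Rightarrow> 'b" where
  "differential A F m v =
     (case chart_at A m of (U, c) \<Rightarrow> frechet_derivative (F \<circ> inv_into U c) (at (c m)) v)"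

definition tangent_bundle ::
  "('m, 'a::euclidean_space) chart set \<Rightarrow> ('m, 'a, 'a) vbundle" where
  "tangent_bundle A = \<lparr>fiber = (\<lambda>_. UNIV), trivs = {(U, differential A c) | U c. (U, c) \<in> A}\<rparr>"

definition velocity ::
  "('m, 'a::euclidean_space) chart set \<Rightarrow> (real \<Rightarrow> 'm) \<Rightarrow> real \<Rightarrow> real set \<Rightarrow> 'a" where
  "velocity A \<gamma> r I = vector_derivative (snd (chart_at A (\<gamma> r)) \<circ> \<gamma>) (at r within I)"

abbreviation riemannian_metric ::
  "('m::topological_space, 'a::euclidean_space) chart set \<Rightarrow>
   real set \<Rightarrow> (real \<Rightarrow> 'm \<Rightarrow> 'a \<Rightarrow> 'a \<Rightarrow> real) \<Rightarrow> bool" where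
  "riemannian_metric A T g \<equiv> bundle_metric A (tangent_bundle A) T g"

section \<open>Connections and parallel transport\<close>

text \<open>Smooth families \<open>N t\<close> of connections, as operators on local sections: \<open>N t m u s\<close> is the
  covariant derivative at \<open>m\<close>, in the direction \<open>u\<close> of the tangent space at \<open>m\<close>, of a section \<open>s\<close>
  that is smooth on some open neighborhood of \<open>m\<close>. Homogeneity in \<open>s\<close> is the product rule for
  constant functions.\<close>

definition connection ::
  "('m::topological_space, 'a::euclidean_space) chart set \<Rightarrow>
   ('m, 'v::real_vector, 'f::euclidean_space) vbundle \<Rightarrow>
   real set \<Rightarrow> (real \<Rightarrow> 'm \<Rightarrow> 'a \<Rightarrow> ('m \<Rightarrow> 'v) \<Rightarrow> 'v) \<Rightarrow> bool" where
  "connection A E T N \<longleftrightarrow>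
     (\<forall>W s. open W \<and> smooth_section A E W s \<longrightarrow>
        (\<forall>t\<in>T. \<forall>m\<in>W.
           linear (\<lambda>u. N t m u s) \<and>
           (\<forall>u. N t m u s \<in> fiber E m) \<and>
           (\<forall>u s'. smooth_section A E W s' \<longrightarrow>
              N t m u (\<lambda>p. s p + s' p) = N t m u s + N t m u s') \<and>
           (\<forall>u F. smooth_fun A W F \<longrightarrow>
              N t m u (\<lambda>p. F p *\<^sub>R s p) = differential A F m u *\<^sub>R s m + F m *\<^sub>R N t m u s) \<and>
           (\<forall>u s'. (\<forall>p\<in>W. s' p = s p) \<longrightarrow> N t m u s' = N t m u s)) \<and>
        (\<forall>X. smooth_section A (tangent_bundle A) W X \<longrightarrow>
           smooth_section_family A E T W (\<lambda>t m. N t m (X m) s)))"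

text \<open>\<open>D\<close> is the covariant derivative at \<open>r\<close> of the section \<open>s\<close> along \<open>\<gamma>\<close>: in a trivialization
  \<open>\<tau>\<close>, with \<open>w r = \<tau> (s r)\<close>, it is \<open>D = w' + A(\<gamma>') w\<close>, where \<open>A(u) w\<close> is the covariant derivative
  of the section with constant components \<open>w\<close>.\<close>

definition has_covariant_derivative_along ::
  "('m, 'a::euclidean_space) chart set \<Rightarrow> ('m, 'v::real_vector, 'f::euclidean_space) vbundle \<Rightarrow>
   ('m \<Rightarrow> 'a \<Rightarrow> ('m \<Rightarrow> 'v) \<Rightarrow> 'v) \<Rightarrow> (real \<Rightarrow> 'm) \<Rightarrow> (real \<Rightarrow> 'v) \<Rightarrow> 'v \<Rightarrow> real \<Rightarrow> real set \<Rightarrow> bool" where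
  "has_covariant_derivative_along A E N \<gamma> s D r I \<longleftrightarrow>
     (\<forall>(U, \<tau>)\<in>trivs E. \<gamma> r \<in> U \<longrightarrow>
        ((\<lambda>q. \<tau> (\<gamma> q) (s q)) has_vector_derivative
           \<tau> (\<gamma> r) (D - N (\<gamma> r) (velocity A \<gamma> r I) (const_section E \<tau> (\<tau> (\<gamma> r) (s r)))))
        (at r within I))"

definition parallel_along ::
  "('m, 'a::euclidean_space) chart set \<Rightarrow> ('m, 'v::real_vector, 'f::euclidean_space) vbundle \<Rightarrow>
   ('m \<Rightarrow> 'a \<Rightarrow> ('m \<Rightarrow> 'v) \<Rightarrow> 'v) \<Rightarrow> (real \<Rightarrow> 'm) \<Rightarrow> (real \<Rightarrow> 'v) \<Rightarrow> real set \<Rightarrow> bool" where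
  "parallel_along A E N \<gamma> s I \<longleftrightarrow>
     (\<forall>r\<in>I. s r \<in> fiber E (\<gamma> r) \<and> has_covariant_derivative_along A E N \<gamma> s 0 r I)"

definition parallel_transport_invariant ::
  "('m::topological_space, 'a::euclidean_space) chart set \<Rightarrow>
   ('m, 'v::real_vector, 'f::euclidean_space) vbundle \<Rightarrow>
   ('m \<Rightarrow> 'a \<Rightarrow> ('m \<Rightarrow> 'v) \<Rightarrow> 'v) \<Rightarrow> ('m \<times> 'v) set \<Rightarrow> bool" where
  "parallel_transport_invariant A E N X \<longleftrightarrow>
     (\<forall>a b \<gamma> s. a < b \<and> smooth_curve A {a..b} \<gamma> \<and> parallel_along A E N \<gamma> s {a..b} \<and>
        (\<gamma> a, s a) \<in> X \<longrightarrow> (\<gamma> b, s b) \<in> X)"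

section \<open>The Laplacian\<close>

text \<open>The vector field near \<open>m\<close> whose components in the chosen chart around \<open>m\<close> are constant equal
  to \<open>v\<close>; its value at \<open>m\<close> is \<open>v\<close>.\<close>

definition extend_vector ::
  "('m, 'a::euclidean_space) chart set \<Rightarrow> 'm \<Rightarrow> 'a \<Rightarrow> 'm \<Rightarrow> 'a" where
  "extend_vector A m v =
     const_section (tangent_bundle A) (differential A (snd (chart_at A m))) v"

text \<open>The connection on \<open>E\<close>-valued 1-forms \<open>\<omega>\<close> induced by \<open>N\<close> on \<open>E\<close> and \<open>NT\<close> on the tangent
  bundle: \<open>(\<nabla>\<^sub>u \<omega>)(v) = \<nabla>\<^sub>u (\<omega>(V)) - \<omega>(\<nabla>\<^sub>u V)\<close> for any vector field \<open>V\<close> extending \<open>v\<close>. By the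
  product rule the result does not depend on the extension.\<close>

definition form_connection ::
  "('m, 'a::euclidean_space) chart set \<Rightarrow> ('m \<Rightarrow> 'a \<Rightarrow> ('m \<Rightarrow> 'a) \<Rightarrow> 'a) \<Rightarrow>
   ('m \<Rightarrow> 'a \<Rightarrow> ('m \<Rightarrow> 'v::real_vector) \<Rightarrow> 'v) \<Rightarrow> ('m \<Rightarrow> 'a \<Rightarrow> 'v) \<Rightarrow> 'm \<Rightarrow> 'a \<Rightarrow> 'a \<Rightarrow> 'v" where
  "form_connection A NT N \<omega> m u v =
     (let V = extend_vector A m v in N m u (\<lambda>p. \<omega> p (V p)) - \<omega> m (NT m u V))"

text \<open>Trace of a bilinear form with respect to an inner product \<open>g\<close> on \<open>'a\<close>, computed in a
  \<open>g\<close>-orthonormal basis (indexed by the standard basis of \<open>'a\<close>).\<close>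

definition metric_trace ::
  "('a::euclidean_space \<Rightarrow> 'a \<Rightarrow> real) \<Rightarrow> ('a \<Rightarrow> 'a \<Rightarrow> 'v::real_vector) \<Rightarrow> 'v" where
  "metric_trace g B =
     (let e = (SOME e :: 'a \<Rightarrow> 'a. \<forall>i\<in>Basis. \<forall>j\<in>Basis. g (e i) (e j) = (if i = j then 1 else 0))
      in \<Sum>i\<in>Basis. B (e i) (e i))"

definition laplacian ::
  "('m, 'a::euclidean_space) chart set \<Rightarrow> ('m \<Rightarrow> 'a \<Rightarrow> 'a \<Rightarrow> real) \<Rightarrow>
   ('m \<Rightarrow> 'a \<Rightarrow> ('m \<Rightarrow> 'a) \<Rightarrow> 'a) \<Rightarrow> ('m \<Rightarrow> 'a \<Rightarrow> ('m \<Rightarrow> 'v::real_vector) \<Rightarrow> 'v) \<Rightarrow>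
   ('m \<Rightarrow> 'v) \<Rightarrow> 'm \<Rightarrow> 'v" where
  "laplacian A g NT N s m =
     metric_trace (g m) (form_connection A NT N (\<lambda>p u. N p u s) m)"

end

theory Submission
  imports Defs
begin

text \<open>Cover the manifold by finitely many coordinate balls \<open>\<bar>x - x\<^sub>j\<bar> < R\<close> over which \<open>E\<close> is
  trivialized. Over each of them let \<open>d\<close> be the distance of \<open>f\<close> to \<open>X\<close> in the Euclidean norm of the
  trivialization, and let \<open>\<rho> = R\<^sup>2 - \<bar>x - x\<^sub>j\<bar>\<^sup>2\<close>, which vanishes on the boundary. If \<open>f\<close> leaves \<open>X\<close>, then
  \<open>exp (- C t) \<rho> d\<close> has a positive maximum over all balls and times. Since other balls compete,
  \<open>\<rho>\<close> is bounded below there. Let \<open>w\<close> be the point of \<open>X\<close> closest to \<open>f\<close> and \<open>\<nu>\<close> the unit vector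
  from \<open>w\<close> to \<open>f\<close>. The covector \<open>\<nu>\<close>, moved along a coordinate line by the dual parallel transport,
  supports all fibers of \<open>X\<close> on that line with the same constant \<open>\<nu> \<bullet> w\<close>, because \<open>X\<close> is invariant
  under parallel transport. Hence the maximality in space gives \<open>\<nu> \<bullet> \<Delta>f \<le> C\<^sub>1 d\<close>, although the
  connection does not preserve the norm. The ODE condition gives \<open>\<nu> \<bullet> \<phi>(f) \<le> C\<^sub>2 d\<close>, and the
  maximality in time gives \<open>\<nu> \<bullet> \<partial>\<^sub>tf \<ge> C d\<close>, which is impossible for large \<open>C\<close>.\<close>

section \<open>Calculus of smooth maps\<close>

text \<open>As the connection need not preserve a norm, a unit normal of X moved in parallel changes
  its length to first order, and the maximum tests leave errors without a sign. Each is a multiple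
  of d: the first-order test, run along both \<open>e\<close> and \<open>- e\<close>, becomes an
  equality and bounds the component \<open>\<nu> \<bullet> \<nabla>f\<close> by d, which controls
  the cross terms of the second-order test and the first-order part of the Laplacian. The weight
  \<rho> is needed because distances in different trivializations agree only up to a factor and do
  not glue; a maximum of d alone could sit on a bounding sphere, where lines cannot be followed both
  ways. The price is errors of size d / \<rho>. At the maximum, taken in ball j, the point also lies
  in the inner half of some ball i, where \<rho> is large; d in ball j is at most a constant times d
  in ball i, so maximality bounds \<rho> in ball j from below. All constants are fixed before the
  maximum is chosen, since C enters the maximized function. The fibers of X are not assumed to vary
  continuously; parallel transport makes d upper semicontinuous, which suffices for a
  maximum.\<close>

lemma linear_Basis_sum:
  fixes L :: "'x::euclidean_space \<Rightarrow> 'y::real_vector"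
  assumes "linear L"
  shows "L w = (\<Sum>b\<in>Basis. (w \<bullet> b) *\<^sub>R L b)"
  by (subst euclidean_representation[symmetric, of w]) (simp add: linear_sum[OF assms] linear_scale[OF assms])

lemma Ck_on_cong:
  "open S \<Longrightarrow> (\<And>x. x \<in> S \<Longrightarrow> f x = g x) \<Longrightarrow> Ck_on k S f \<Longrightarrow> Ck_on k S g"
proof (induction k arbitrary: f g)
  case 0
  then show ?case by (metis Ck_on.simps(1) continuous_on_cong)
next
  case (Suc k)
  have g: "g differentiable (at x)" if "x \<in> S" for x
    using Suc.prems that unfolding differentiable_def
    by (metis Ck_on.simps(2) differentiable_def has_derivative_transform_within_open)
  have "Ck_on k S (\<lambda>x. frechet_derivative g (at x) v)" for v
  proof (rule Suc.IH[OF \<open>open S\<close>])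
    show "frechet_derivative f (at x) v = frechet_derivative g (at x) v" if "x \<in> S" for x
      using Suc.prems that frechet_derivative_transform_within_open[of f x S g] by simp
  qed (use Suc.prems in simp)
  with g show ?case by simp
qed

lemma Ck_on_subset: "T \<subseteq> S \<Longrightarrow> Ck_on k S f \<Longrightarrow> Ck_on k T f"
  by (induction k arbitrary: f) (auto intro: continuous_on_subset)

lemma Ck_on_Suc_D: "Ck_on (Suc k) S f \<Longrightarrow> Ck_on k S f"
proof (induction k arbitrary: f)
  case 0
  then show ?case
    by (auto intro!: continuous_at_imp_continuous_on differentiable_imp_continuous_within)
next
  case (Suc k)
  then show ?case by auto
qed

lemma Ck_on_imp_continuous_on: "Ck_on k S f \<Longrightarrow> continuous_on S f"
  by (induction k) (auto dest: Ck_on_Suc_D simp del: Ck_on.simps(2))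

lemma Ck_on_const: "Ck_on k S (\<lambda>_. a)"
  by (induction k arbitrary: a) (auto simp: frechet_derivative_const)

lemma frechet_derivative_worksI:
  "f differentiable F \<Longrightarrow> (f has_derivative frechet_derivative f F) F"
  by (simp add: frechet_derivative_works)

lemma Ck_on_add:
  "open S \<Longrightarrow> Ck_on k S f \<Longrightarrow> Ck_on k S g \<Longrightarrow> Ck_on k S (\<lambda>x. f x + g x)"
proof (induction k arbitrary: f g)
  case 0
  then show ?case by (auto intro: continuous_on_add)
next
  case (Suc k)
  have "Ck_on k S (\<lambda>x. frechet_derivative (\<lambda>x. f x + g x) (at x) v)" for v
  proof (rule Ck_on_cong[OF \<open>open S\<close>])
    show "Ck_on k S (\<lambda>x. frechet_derivative f (at x) v + frechet_derivative g (at x) v)"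
      using Suc.prems by (intro Suc.IH) auto
    show "frechet_derivative f (at x) v + frechet_derivative g (at x) v =
        frechet_derivative (\<lambda>x. f x + g x) (at x) v" if "x \<in> S" for x
      using Suc.prems that frechet_derivative_at[OF has_derivative_add[OF
            frechet_derivative_worksI[of f "at x"] frechet_derivative_worksI[of g "at x"]]]
      by (simp add: fun_eq_iff)
  qed
  with Suc.prems show ?case by auto
qed

lemma Ck_on_sum:
  "open S \<Longrightarrow> (\<And>i. i \<in> I \<Longrightarrow> Ck_on k S (f i)) \<Longrightarrow> Ck_on k S (\<lambda>x. \<Sum>i\<in>I. f i x)"
  by (induction I rule: infinite_finite_induct) (auto simp: Ck_on_const intro: Ck_on_add)

lemma Ck_on_linear:
  assumes "linear L"
  shows "Ck_on k S L"
proof -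
  have L: "(L has_derivative L) (at x)" for x
    using assms by (simp add: bounded_linear_imp_has_derivative linear_conv_bounded_linear)
  have "frechet_derivative L (at x) = L" for x
    using frechet_derivative_at[OF L] by simp
  then show ?thesis
    using L by (cases k) (auto simp: Ck_on_const differentiable_def
        intro!: continuous_at_imp_continuous_on intro: has_derivative_continuous)
qed

lemma Ck_on_linear_comp:
  "linear L \<Longrightarrow> open S \<Longrightarrow> Ck_on k S f \<Longrightarrow> Ck_on k S (\<lambda>x. L (f x))"
proof (induction k arbitrary: f)
  case 0
  then show ?case
    by (auto intro!: linear_continuous_on_compose[unfolded o_def] simp: linear_conv_bounded_linear
        bounded_linear.continuous_on)
next
  case (Suc k)
  have d: "((\<lambda>x. L (f x)) has_derivative (\<lambda>v. L (frechet_derivative f (at x) v))) (at x)"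
    if "x \<in> S" for x
    using Suc.prems that by (intro bounded_linear.has_derivative[of L])
      (auto simp: frechet_derivative_works[symmetric] linear_conv_bounded_linear)
  have "Ck_on k S (\<lambda>x. frechet_derivative (\<lambda>x. L (f x)) (at x) v)" for v
  proof (rule Ck_on_cong[OF \<open>open S\<close>])
    show "Ck_on k S (\<lambda>x. L (frechet_derivative f (at x) v))"
      using Suc.prems by (intro Suc.IH) auto
    show "L (frechet_derivative f (at x) v) = frechet_derivative (\<lambda>x. L (f x)) (at x) v"
      if "x \<in> S" for x
      using frechet_derivative_at[OF d[OF that]] by metis
  qed
  with d show ?case by (auto simp: differentiable_def)
qed

lemma Ck_on_scaleR:
  "open S \<Longrightarrow> Ck_on k S f \<Longrightarrow> Ck_on k S g \<Longrightarrow> Ck_on k S (\<lambda>x. f x *\<^sub>R g x)"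
proof (induction k arbitrary: f g)
  case 0
  then show ?case by (auto intro: continuous_on_scaleR)
next
  case (Suc k)
  have d: "((\<lambda>x. f x *\<^sub>R g x) has_derivative
      (\<lambda>v. f x *\<^sub>R frechet_derivative g (at x) v + frechet_derivative f (at x) v *\<^sub>R g x)) (at x)"
    if "x \<in> S" for x
    using Suc.prems that by (intro has_derivative_scaleR) (auto simp: frechet_derivative_works[symmetric])
  have "Ck_on k S (\<lambda>x. frechet_derivative (\<lambda>x. f x *\<^sub>R g x) (at x) v)" for v
  proof (rule Ck_on_cong[OF \<open>open S\<close>])
    show "Ck_on k S (\<lambda>x. f x *\<^sub>R frechet_derivative g (at x) v + frechet_derivative f (at x) v *\<^sub>R g x)"
      using Suc.prems Ck_on_Suc_D[OF Suc.prems(2)] Ck_on_Suc_D[OF Suc.prems(3)]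
      by (intro Ck_on_add Suc.IH) auto
    show "f x *\<^sub>R frechet_derivative g (at x) v + frechet_derivative f (at x) v *\<^sub>R g x =
        frechet_derivative (\<lambda>x. f x *\<^sub>R g x) (at x) v" if "x \<in> S" for x
      using frechet_derivative_at[OF d[OF that]] by metis
  qed
  with d show ?case by (auto simp: differentiable_def)
qed

text \<open>The chain rule evaluates the derivative of \<open>g\<close> in a direction that moves
  with \<open>x\<close>, while \<open>Ck_on\<close> differentiates in fixed directions only.
  Expanding the moving direction in the standard basis leaves sums of products to which the
  induction hypothesis applies.\<close>

lemma Ck_on_compose:
  "open S \<Longrightarrow> h ` S \<subseteq> T \<Longrightarrow> Ck_on k S h \<Longrightarrow> Ck_on k T g \<Longrightarrow> Ck_on k S (g \<circ> h)"
proof (induction k arbitrary: g)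
  case 0
  then show ?case
    using continuous_on_compose[of S h g] continuous_on_subset[of T g "h ` S"] by (auto simp: o_def)
next
  case (Suc k)
  have h: "(h has_derivative frechet_derivative h (at x)) (at x)" if "x \<in> S" for x
    using Suc.prems that by (auto simp: frechet_derivative_works[symmetric])
  have g: "(g has_derivative frechet_derivative g (at y)) (at y)" if "y \<in> T" for y
    using Suc.prems that by (auto simp: frechet_derivative_works[symmetric])
  have d: "(g \<circ> h has_derivative frechet_derivative g (at (h x)) \<circ> frechet_derivative h (at x)) (at x)"
    if "x \<in> S" for x
    using Suc.prems that by (intro diff_chain_at h g) auto
  have "Ck_on k S (\<lambda>x. frechet_derivative (g \<circ> h) (at x) v)" for v
  proof (rule Ck_on_cong[OF \<open>open S\<close>])
    have dh: "Ck_on k S (\<lambda>x. frechet_derivative h (at x) v)"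
      using Suc.prems by simp
    have 1: "Ck_on k S (\<lambda>x. frechet_derivative h (at x) v \<bullet> b)" for b
      using bounded_linear.linear[OF bounded_linear_inner_left] \<open>open S\<close> dh by (rule Ck_on_linear_comp)
    show "Ck_on k S (\<lambda>x. \<Sum>b\<in>Basis. (frechet_derivative h (at x) v \<bullet> b) *\<^sub>R
        ((\<lambda>y. frechet_derivative g (at y) b) \<circ> h) x)"
      using Suc.prems Ck_on_Suc_D[OF Suc.prems(3)] by (intro Ck_on_sum Ck_on_scaleR 1 Suc.IH) auto
    show "(\<Sum>b\<in>Basis. (frechet_derivative h (at x) v \<bullet> b) *\<^sub>R
        ((\<lambda>y. frechet_derivative g (at y) b) \<circ> h) x) = frechet_derivative (g \<circ> h) (at x) v"
      if "x \<in> S" for x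
    proof -
      have "linear (frechet_derivative g (at (h x)))"
        using Suc.prems that by (auto intro!: linear_frechet_derivative)
      then show ?thesis
        unfolding frechet_derivative_at[OF d[OF that], symmetric] o_apply
        by (rule linear_Basis_sum[symmetric])
    qed
  qed
  with d show ?case unfolding Ck_on.simps differentiable_def by blast
qed

section \<open>Smoothness on arbitrary sets through local extensions\<close>

lemma smooth_onE:
  assumes "smooth_on S f" "x \<in> S"
  obtains W g where "open W" "x \<in> W" "\<And>k. Ck_on k W g" "\<And>y. y \<in> S \<Longrightarrow> y \<in> W \<Longrightarrow> f y = g y"
  using assms unfolding smooth_on_def by (metis IntI)

lemma smooth_on_subset:
  assumes "smooth_on S f" "T \<subseteq> S"
  shows "smooth_on T f"
  unfolding smooth_on_def
proof
  fix x assume "x \<in> T"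
  then have "x \<in> S"
    using assms(2) by blast
  with assms(1) obtain W g where "open W" "x \<in> W" "\<And>k. Ck_on k W g"
      "\<And>y. y \<in> S \<Longrightarrow> y \<in> W \<Longrightarrow> f y = g y"
    by (rule smooth_onE) blast
  with assms(2) show "\<exists>W g. open W \<and> x \<in> W \<and> (\<forall>k. Ck_on k W g) \<and> (\<forall>y\<in>T \<inter> W. f y = g y)"
    by (intro exI[of _ W] exI[of _ g]) auto
qed

lemma smooth_on_cong: "smooth_on S f \<Longrightarrow> (\<And>x. x \<in> S \<Longrightarrow> f x = g x) \<Longrightarrow> smooth_on S g"
  unfolding smooth_on_def by (metis Int_iff)

lemma smooth_on_imp_continuous_on:
  assumes "smooth_on S f"
  shows "continuous_on S f"
  unfolding continuous_on_eq_continuous_within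
proof
  fix x assume x: "x \<in> S"
  with assms obtain W g where W: "open W" "x \<in> W" "\<And>k. Ck_on k W g"
      "\<And>y. y \<in> S \<Longrightarrow> y \<in> W \<Longrightarrow> f y = g y"
    by (rule smooth_onE) blast
  have "isCont g x"
    using W Ck_on_imp_continuous_on continuous_on_eq_continuous_at by blast
  then have "continuous (at x within S) g"
    by (rule continuous_at_imp_continuous_at_within)
  moreover have "\<forall>\<^sub>F y in at x within S. g y = f y"
    unfolding eventually_at_topological using W by metis
  moreover have "g x = f x"
    using W(2,4) x by simp
  ultimately show "continuous (at x within S) f"
    unfolding continuous_within by (simp add: tendsto_cong)
qed

lemma smooth_on_const: "smooth_on S (\<lambda>_. a)"
  unfolding smooth_on_def using Ck_on_const open_UNIV by blast

lemma smooth_on_linear: "linear L \<Longrightarrow> smooth_on S L"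
  unfolding smooth_on_def using Ck_on_linear open_UNIV by blast

lemma smooth_on_binary:
  fixes S :: "'x::euclidean_space set"
  assumes "smooth_on S f" "smooth_on S g"
    and Ck: "\<And>k (W :: 'x set) f g. open W \<Longrightarrow> Ck_on k W f \<Longrightarrow> Ck_on k W g \<Longrightarrow> Ck_on k W (\<lambda>x. F (f x) (g x))"
  shows "smooth_on S (\<lambda>x. F (f x) (g x))"
  unfolding smooth_on_def
proof
  fix x assume x: "x \<in> S"
  from assms(1) x obtain V f' where V: "open V" "x \<in> V" "\<And>k. Ck_on k V f'"
      "\<And>y. y \<in> S \<Longrightarrow> y \<in> V \<Longrightarrow> f y = f' y"
    by (rule smooth_onE) blast
  from assms(2) x obtain W g' where W: "open W" "x \<in> W" "\<And>k. Ck_on k W g'"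
      "\<And>y. y \<in> S \<Longrightarrow> y \<in> W \<Longrightarrow> g y = g' y"
    by (rule smooth_onE) blast
  have "Ck_on k (V \<inter> W) (\<lambda>x. F (f' x) (g' x))" for k
    using V W by (intro Ck Ck_on_subset[OF inf_le1 V(3)] Ck_on_subset[OF inf_le2 W(3)]) auto
  with V W show "\<exists>W h. open W \<and> x \<in> W \<and> (\<forall>k. Ck_on k W h) \<and> (\<forall>y\<in>S \<inter> W. F (f y) (g y) = h y)"
    by (intro exI[of _ "V \<inter> W"] exI[of _ "\<lambda>x. F (f' x) (g' x)"]) auto
qed

lemma smooth_on_add: "smooth_on S f \<Longrightarrow> smooth_on S g \<Longrightarrow> smooth_on S (\<lambda>x. f x + g x)"
  by (rule smooth_on_binary[OF _ _ Ck_on_add])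

lemma smooth_on_scaleR: "smooth_on S f \<Longrightarrow> smooth_on S g \<Longrightarrow> smooth_on S (\<lambda>x. f x *\<^sub>R g x)"
  by (rule smooth_on_binary[OF _ _ Ck_on_scaleR])

lemma smooth_on_sum:
  "(\<And>i. i \<in> I \<Longrightarrow> smooth_on S (f i)) \<Longrightarrow> smooth_on S (\<lambda>x. \<Sum>i\<in>I. f i x)"
  by (induction I rule: infinite_finite_induct) (auto simp: smooth_on_const intro: smooth_on_add)

lemma smooth_on_compose:
  assumes "smooth_on T g" "smooth_on S h" "h ` S \<subseteq> T"
  shows "smooth_on S (g \<circ> h)"
  unfolding smooth_on_def
proof
  fix x assume x: "x \<in> S"
  from assms(2) x obtain V h' where V: "open V" "x \<in> V" "\<And>k. Ck_on k V h'"
      "\<And>y. y \<in> S \<Longrightarrow> y \<in> V \<Longrightarrow> h y = h' y"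
    by (rule smooth_onE) blast
  have "h x \<in> T"
    using assms(3) x by blast
  with assms(1) obtain W g' where W: "open W" "h x \<in> W" "\<And>k. Ck_on k W g'"
      "\<And>y. y \<in> T \<Longrightarrow> y \<in> W \<Longrightarrow> g y = g' y"
    by (rule smooth_onE) blast
  let ?O = "V \<inter> h' -` W"
  have O: "open ?O"
    using V W Ck_on_imp_continuous_on by (metis continuous_open_preimage)
  moreover have "Ck_on k ?O (g' \<circ> h')" for k
    using O V(3) W(3) by (intro Ck_on_compose[where T=W]) (auto intro: Ck_on_subset)
  ultimately show "\<exists>W f. open W \<and> x \<in> W \<and> (\<forall>k. Ck_on k W f) \<and> (\<forall>y\<in>S \<inter> W. (g \<circ> h) y = f y)"
    using V W x assms(3) by (intro exI[of _ ?O] exI[of _ "g' \<circ> h'"]) (force simp: image_subset_iff)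
qed

lemma smooth_on_linear_comp: "linear L \<Longrightarrow> smooth_on S f \<Longrightarrow> smooth_on S (\<lambda>x. L (f x))"
  using smooth_on_compose[OF smooth_on_linear, of L S f] by (auto simp: o_def)

lemma smooth_on_inner_left: "smooth_on S f \<Longrightarrow> smooth_on S (\<lambda>x. f x \<bullet> b)"
  by (rule smooth_on_linear_comp) (simp_all add: bounded_linear.linear bounded_linear_inner_left)

lemma smooth_on_Pair:
  assumes "smooth_on S f" "smooth_on S g"
  shows "smooth_on S (\<lambda>x. (f x, g x))"
proof -
  have "linear (\<lambda>u. (u, 0))" "linear (\<lambda>v. (0, v))"
    by (auto intro!: linearI)
  from smooth_on_add[OF smooth_on_linear_comp[OF this(1) assms(1)] smooth_on_linear_comp[OF this(2) assms(2)]]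
  show ?thesis by simp
qed

lemma smooth_on_differentiable:
  assumes "smooth_on S f" "open S" "x \<in> S"
  shows "f differentiable (at x)"
proof -
  from assms(1,3) obtain V f' where V: "open V" "x \<in> V" "\<And>k. Ck_on k V f'"
      "\<And>y. y \<in> S \<Longrightarrow> y \<in> V \<Longrightarrow> f y = f' y"
    by (rule smooth_onE) blast
  have "f' differentiable (at x)"
    using V(2) V(3)[of 1] by simp
  then obtain D where "(f' has_derivative D) (at x)"
    by (auto simp: differentiable_def)
  then have "(f has_derivative D) (at x)"
    by (rule has_derivative_transform_within_open[where s="V \<inter> S"]) (use V assms(2,3) in auto)
  then show ?thesis
    by (auto simp: differentiable_def)
qed

lemma smooth_on_slice:
  assumes "smooth_on (P \<times> S) F" "p \<in> P"
  shows "smooth_on S (\<lambda>x. F (p, x))"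
proof -
  have "smooth_on S (\<lambda>x. (p, x))"
    by (intro smooth_on_Pair smooth_on_const smooth_on_linear linear_id[unfolded id_def])
  from smooth_on_compose[OF assms(1) this] assms(2) show ?thesis by (auto simp: o_def)
qed

text \<open>\<open>P\<close> may be a closed time interval, so \<open>F\<close> need not have a
  two-sided derivative in all its variables. Near each point \<open>F\<close> agrees with a smooth
  extension \<open>G\<close>, and the derivative in the slice variable alone is that of
  \<open>G\<close> in the direction \<open>(0, v)\<close>.\<close>

lemma smooth_on_slice_derivative:
  assumes "smooth_on (P \<times> S) F" "open S"
  shows "smooth_on (P \<times> S) (\<lambda>(p, x). frechet_derivative (\<lambda>y. F (p, y)) (at x) v)"
  unfolding smooth_on_def
proof
  fix q assume q: "q \<in> P \<times> S"
  with assms(1) obtain W G where W: "open W" "q \<in> W" "\<And>k. Ck_on k W G"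
      "\<And>y. y \<in> P \<times> S \<Longrightarrow> y \<in> W \<Longrightarrow> F y = G y"
    by (rule smooth_onE) blast
  have "frechet_derivative (\<lambda>y. F (p, y)) (at x) v = frechet_derivative G (at (p, x)) (0, v)"
    if "p \<in> P" "x \<in> S" "(p, x) \<in> W" for p x
  proof -
    have "(G has_derivative frechet_derivative G (at (p, x))) (at (p, x))"
      using W(3)[of 1] that by (simp add: frechet_derivative_works[symmetric])
    moreover have "((\<lambda>y. (p, y)) has_derivative (\<lambda>v. (0, v))) (at x)"
      by (intro has_derivative_Pair has_derivative_const has_derivative_ident)
    ultimately have "((\<lambda>y. G (p, y)) has_derivative (\<lambda>v. frechet_derivative G (at (p, x)) (0, v))) (at x)"
      by (rule has_derivative_compose[rotated])
    moreover have "open (S \<inter> {y. (p, y) \<in> W})"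
      using open_vimage[OF W(1), of "\<lambda>y. (p, y)"] assms(2)
      by (auto simp: vimage_def continuous_on_Pair)
    moreover have "x \<in> S \<inter> {y. (p, y) \<in> W}"
      using that by simp
    moreover have "G (p, y) = F (p, y)" if "y \<in> S \<inter> {y. (p, y) \<in> W}" for y
      using W(4)[of "(p, y)"] that \<open>p \<in> P\<close> by simp
    ultimately have "((\<lambda>y. F (p, y)) has_derivative (\<lambda>v. frechet_derivative G (at (p, x)) (0, v))) (at x)"
      by (rule has_derivative_transform_within_open)
    from fun_cong[OF frechet_derivative_at[OF this], of v] show ?thesis by simp
  qed
  moreover have "Ck_on k W (\<lambda>z. frechet_derivative G (at z) (0, v))" for k
    using W(3)[of "Suc k"] by simp
  ultimately show "\<exists>W g. open W \<and> q \<in> W \<and> (\<forall>k. Ck_on k W g) \<and>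
      (\<forall>y\<in>P \<times> S \<inter> W. (case y of (p, x) \<Rightarrow> frechet_derivative (\<lambda>y. F (p, y)) (at x) v) = g y)"
    using W(1,2) by (intro exI[of _ W] exI[of _ "\<lambda>z. frechet_derivative G (at z) (0, v)"]) auto
qed

lemma smooth_on_derivative:
  assumes "smooth_on S f" "open S"
  shows "smooth_on S (\<lambda>x. frechet_derivative f (at x) v)"
proof -
  \<comment> \<open>A dummy real parameter makes this a special case of differentiation in
    slices.\<close>
  have "smooth_on ((UNIV :: real set) \<times> S) (f \<circ> snd)"
    by (rule smooth_on_compose[OF assms(1)]) (auto intro: smooth_on_linear linear_snd)
  from smooth_on_slice[OF smooth_on_slice_derivative[OF this assms(2)], of 0]
  show ?thesis by simp
qed

section \<open>Ordinary differential equations and the maximum principle along a line\<close>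

text \<open>The Picard operator is made to act on all bounded continuous functions on the line, a
  complete space as a type: \<open>cl\<close> clamps the time to \<open>{0..T}\<close>, and the
  nonexpansive projection \<open>p\<close> pushes values into the ball where \<open>F\<close> is
  controlled. It contracts with factor \<open>T * L\<close>.\<close>

lemma picard_lindelof:
  fixes F :: "real \<Rightarrow> 'f::euclidean_space \<Rightarrow> 'f"
  assumes T: "0 < T" and R: "0 \<le> R"
    and cont: "continuous_on ({0..T} \<times> cball y0 R) (\<lambda>(t, y). F t y)"
    and bound: "\<And>t y. t \<in> {0..T} \<Longrightarrow> y \<in> cball y0 R \<Longrightarrow> norm (F t y) \<le> B"
    and TB: "T * B \<le> R"
    and lip: "\<And>t y z. t \<in> {0..T} \<Longrightarrow> y \<in> cball y0 R \<Longrightarrow> z \<in> cball y0 R \<Longrightarrow>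
      norm (F t y - F t z) \<le> L * norm (y - z)"
    and L: "0 \<le> L" "T * L < 1"
  obtains u where "u 0 = y0"
    "\<And>t. t \<in> {0..T} \<Longrightarrow> (u has_vector_derivative F t (u t)) (at t within {0..T})"
    "\<And>t. t \<in> {0..T} \<Longrightarrow> u t \<in> cball y0 R"
proof -
  define p where "p = closest_point (cball y0 R)"
  have p_in: "p y \<in> cball y0 R" for y
    unfolding p_def using R by (intro closest_point_in_set) auto
  have p_lip: "dist (p x) (p y) \<le> dist x y" for x y
    unfolding p_def using R by (intro closest_point_lipschitz) auto
  have p_cont: "continuous_on S p" for S
    unfolding p_def using R by (intro continuous_on_closest_point) auto
  have p_id: "p y = y" if "y \<in> cball y0 R" for y
    unfolding p_def using that by (rule closest_point_self)
  define cl where "cl t = max 0 (min T t)" for t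
  have cl: "cl t \<in> {0..T}" for t
    using T by (auto simp: cl_def)
  have cl_cont: "continuous_on S cl" for S
    unfolding cl_def by (intro continuous_intros)
  have Fcont: "continuous_on {0..T} (\<lambda>s. F s (p (u s)))" if "continuous_on {0..T} u" for u
  proof -
    have "continuous_on {0..T} (\<lambda>s. (s, p (u s)))"
      by (intro continuous_intros continuous_on_compose2[OF p_cont[of UNIV] that]) auto
    moreover have "(\<lambda>s. (s, p (u s))) ` {0..T} \<subseteq> {0..T} \<times> cball y0 R"
      using p_in by blast
    ultimately show ?thesis
      using continuous_on_compose2[OF cont] by fastforce
  qed
  define G where "G u t = y0 + integral {0..cl t} (\<lambda>s. F s (p (u s)))" for u t
  have G_cont: "continuous_on {0..T} (\<lambda>t. integral {0..t} (\<lambda>s. F s (p (u s))))"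
    if "continuous_on {0..T} u" for u
    by (intro indefinite_integral_continuous_1 integrable_continuous_real Fcont that)
  have G_bcont: "G u \<in> bcontfun" if "continuous_on {0..T} u" for u
  proof -
    have "continuous_on UNIV (G u)"
      unfolding G_def
      by (intro continuous_intros continuous_on_compose2[OF G_cont[OF that] cl_cont]) (use cl in auto)
    moreover have "range (G u) \<subseteq> (\<lambda>x. y0 + x) ` (\<lambda>t. integral {0..t} (\<lambda>s. F s (p (u s)))) ` {0..T}"
      using cl by (auto simp: G_def)
    moreover have "bounded ((\<lambda>x. y0 + x) ` (\<lambda>t. integral {0..t} (\<lambda>s. F s (p (u s)))) ` {0..T})"
      by (intro bounded_translation compact_imp_bounded compact_continuous_image G_cont that) auto
    ultimately show ?thesis
      by (auto simp: bcontfun_def intro: bounded_subset)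
  qed
  define \<Phi> where "\<Phi> u = Bcontfun (G (apply_bcontfun u))" for u :: "real \<Rightarrow>\<^sub>C 'f"
  have bc: "continuous_on S (apply_bcontfun u)" for S and u :: "real \<Rightarrow>\<^sub>C 'f"
    using continuous_on_apply_bcontfun continuous_on_subset by blast
  have \<Phi>: "apply_bcontfun (\<Phi> u) = G (apply_bcontfun u)" for u
    unfolding \<Phi>_def by (rule Bcontfun_inverse[OF G_bcont[OF bc]])
  have "\<exists>!u. \<Phi> u = u"
  proof (rule banach_fix_type)
    show "0 \<le> T * L" "T * L < 1"
      using T L by auto
    show "\<forall>u v. dist (\<Phi> u) (\<Phi> v) \<le> T * L * dist u v"
    proof (intro allI dist_bound)
      fix u v :: "real \<Rightarrow>\<^sub>C 'f" and t
      have i: "(\<lambda>s. F s (p (w s))) integrable_on {0..cl t}" if "continuous_on {0..T} w" for w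
        using Fcont[OF that] cl[of t]
        by (intro integrable_continuous_real) (auto intro: continuous_on_subset)
      have "dist (\<Phi> u t) (\<Phi> v t) = norm (integral {0..cl t} (\<lambda>s. F s (p (u s)) - F s (p (v s))))"
        unfolding \<Phi> G_def dist_norm by (subst integral_diff) (auto intro: i bc)
      also have "\<dots> \<le> L * dist u v * (cl t - 0)"
      proof (rule integral_bound)
        show "0 \<le> cl t" using cl[of t] by auto
        have "continuous_on {0..T} (\<lambda>s. F s (p (u s)) - F s (p (v s)))"
          by (intro continuous_intros Fcont bc)
        then show "continuous_on {0..cl t} (\<lambda>s. F s (p (u s)) - F s (p (v s)))"
          by (rule continuous_on_subset) (use cl[of t] in auto)
        fix s assume s: "s \<in> {0..cl t}"
        have "norm (F s (p (u s)) - F s (p (v s))) \<le> L * dist (p (u s)) (p (v s))"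
          unfolding dist_norm using s cl[of t] p_in by (intro lip) auto
        also have "\<dots> \<le> L * dist u v"
          using p_lip[of "u s" "v s"] dist_bounded[of u s v] L(1) by (intro mult_left_mono) auto
        finally show "norm (F s (p (u s)) - F s (p (v s))) \<le> L * dist u v" .
      qed
      also have "\<dots> \<le> L * dist u v * T"
        using L cl[of t] by (intro mult_left_mono) auto
      finally show "dist (\<Phi> u t) (\<Phi> v t) \<le> T * L * dist u v"
        by (simp add: algebra_simps)
    qed
  qed
  then obtain b where b: "\<Phi> b = b" by auto
  define u where "u = apply_bcontfun b"
  have u: "u t = y0 + integral {0..cl t} (\<lambda>s. F s (p (u s)))" for t
    unfolding u_def by (subst b[symmetric]) (simp add: \<Phi> G_def)
  \<comment> \<open>By \<open>T * B \<le> R\<close> the fixed point stays in the ball, so the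
    projection acts on it as the identity and the modified equation is the original one.\<close>
  have u_ball: "u t \<in> cball y0 R" if "t \<in> {0..T}" for t
  proof -
    have "0 \<le> B"
      using bound[of 0 y0] T R by (auto intro: order_trans[OF norm_ge_zero])
    have "norm (integral {0..cl t} (\<lambda>s. F s (p (u s)))) \<le> B * (cl t - 0)"
    proof (rule integral_bound)
      show "0 \<le> cl t" using cl[of t] by auto
      show "continuous_on {0..cl t} (\<lambda>s. F s (p (u s)))"
        using continuous_on_subset[OF Fcont[of u]] bc cl[of t] by (auto simp: u_def)
    qed (use cl[of t] p_in in \<open>auto intro: bound\<close>)
    also have "\<dots> \<le> B * T"
      using \<open>0 \<le> B\<close> cl[of t] by (intro mult_left_mono) auto
    finally show ?thesis
      using TB u[of t] by (simp add: dist_norm norm_minus_commute algebra_simps)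
  qed
  show ?thesis
  proof
    show "u 0 = y0"
      using u[of 0] T by (simp add: cl_def)
    show "(u has_vector_derivative F t (u t)) (at t within {0..T})" if t: "t \<in> {0..T}" for t
    proof -
      have "((\<lambda>t. integral {0..t} (\<lambda>s. F s (p (u s)))) has_vector_derivative F t (p (u t)))
          (at t within {0..T})"
        using t by (intro integral_has_vector_derivative Fcont) (auto simp: u_def bc)
      then have "((\<lambda>t. y0 + integral {0..t} (\<lambda>s. F s (p (u s)))) has_vector_derivative F t (u t))
          (at t within {0..T})"
        using p_id[OF u_ball[OF t]] by (auto intro!: derivative_eq_intros)
      then show ?thesis
      proof (rule has_vector_derivative_transform[OF t, rotated])
        show "u t' = y0 + integral {0..t'} (\<lambda>s. F s (p (u s)))" if "t' \<in> {0..T}" for t'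
          using u[of t'] that by (simp add: cl_def)
      qed
    qed
  qed (rule u_ball)
qed

text \<open>The general existence result on the ball of radius \<open>2 * T * L * norm y0\<close>.
  The resulting bound on \<open>u t - y0\<close> says that transport over a short distance displaces
  a point little, which later gives semicontinuity of the distance to X.\<close>

lemma linear_ode:
  fixes \<alpha> :: "real \<Rightarrow> 'f::euclidean_space \<Rightarrow> 'f"
  assumes T: "0 < T"
    and lin: "\<And>s. s \<in> {0..T} \<Longrightarrow> linear (\<alpha> s)"
    and cont: "\<And>w. w \<in> Basis \<Longrightarrow> continuous_on {0..T} (\<lambda>s. \<alpha> s w)"
    and bound: "\<And>s w. s \<in> {0..T} \<Longrightarrow> norm (\<alpha> s w) \<le> L * norm w"
    and L: "0 \<le> L" "T * L \<le> 1 / 2"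
  obtains u where "u 0 = y0"
    "\<And>t. t \<in> {0..T} \<Longrightarrow> (u has_vector_derivative \<alpha> t (u t)) (at t within {0..T})"
    "\<And>t. t \<in> {0..T} \<Longrightarrow> norm (u t - y0) \<le> 2 * T * L * norm y0"
proof -
  let ?R = "2 * T * L * norm y0"
  have eq: "\<alpha> s w = (\<Sum>b\<in>Basis. (w \<bullet> b) *\<^sub>R \<alpha> s b)" if "s \<in> {0..T}" for s w
    by (rule linear_Basis_sum[OF lin[OF that]])
  have c: "continuous_on ({0..T} \<times> cball y0 ?R) (\<lambda>z. \<Sum>b\<in>Basis. (snd z \<bullet> b) *\<^sub>R \<alpha> (fst z) b)"
    by (intro continuous_intros continuous_on_compose2[OF cont continuous_on_fst]) auto
  have 1: "continuous_on ({0..T} \<times> cball y0 ?R) (\<lambda>(t, y). \<alpha> t y)"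
    by (rule continuous_on_cong[THEN iffD1, OF refl _ c]) (use eq in fastforce)
  have 2: "norm (\<alpha> t y) \<le> L * (norm y0 + ?R)" if "t \<in> {0..T}" "y \<in> cball y0 ?R" for t y
  proof -
    have "norm y \<le> norm y0 + ?R"
      using that norm_triangle_ineq4[of y0 "y0 - y"] by (simp add: dist_norm)
    then show ?thesis
      using bound[OF that(1), of y] mult_left_mono[of "norm y" "norm y0 + ?R" L] L by linarith
  qed
  have 3: "norm (\<alpha> t y - \<alpha> t z) \<le> L * norm (y - z)" if "t \<in> {0..T}" for t y z
    using bound[OF that, of "y - z"] lin[OF that] by (simp add: linear_diff)
  \<comment> \<open>On the ball the right-hand side is at most \<open>L * (norm y0 + ?R)\<close>;
    the assumption \<open>T * L \<le> 1 / 2\<close> is what keeps a solution with this speed inside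
    radius \<open>?R\<close>.\<close>
  have "T * (L * (norm y0 + ?R)) = T * L * norm y0 * (1 + 2 * (T * L))"
    by (simp add: algebra_simps)
  also have "\<dots> \<le> T * L * norm y0 * 2"
    using L T by (intro mult_left_mono) auto
  finally have 4: "T * (L * (norm y0 + ?R)) \<le> ?R"
    by simp
  have 5: "0 \<le> ?R" "T * L < 1"
    using L T by auto
  show ?thesis
  proof (rule picard_lindelof[OF T 5(1) 1 2 4 3 L(1) 5(2)])
    fix u assume u: "u 0 = y0"
      "\<And>t. t \<in> {0..T} \<Longrightarrow> (u has_vector_derivative \<alpha> t (u t)) (at t within {0..T})"
      "\<And>t. t \<in> {0..T} \<Longrightarrow> u t \<in> cball y0 ?R"
    show ?thesis
    proof (rule that[of u])
      show "norm (u t - y0) \<le> ?R" if "t \<in> {0..T}" for t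
        using u(3)[OF that] by (simp add: dist_norm norm_minus_commute)
    qed (rule u)+
  qed
qed

section \<open>Maximum tests at the end of an interval and along a line\<close>

lemma one_sided_max_first:
  fixes B :: "real \<Rightarrow> real"
  assumes "0 < s" "(B has_real_derivative b) (at 0 within {0..s})"
    and "B 0 = 0" "\<And>x. x \<in> {0..s} \<Longrightarrow> B x \<le> 0"
  shows "b \<le> 0"
proof (rule ccontr)
  assume "\<not> b \<le> 0"
  then obtain d where d: "0 < d" "\<And>h. 0 < h \<Longrightarrow> 0 + h \<in> {0..s} \<Longrightarrow> h < d \<Longrightarrow> B 0 < B (0 + h)"
    using has_real_derivative_pos_inc_right[OF assms(2)] by auto
  define h where "h = min (d / 2) s"
  have "0 < h" "h \<le> s" "h < d"
    using d(1) assms(1) by (auto simp: h_def)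
  then have "B 0 < B h" "B h \<le> 0"
    using d(2)[of h] assms(4)[of h] by auto
  then show False
    using assms(3) by simp
qed

text \<open>If \<open>c\<close> were positive, \<open>b\<close> would be positive just to the right
  of 0, and the mean value theorem would make \<open>B\<close> positive there. A maximum at an end
  point does not force \<open>b 0 = 0\<close>, so this is a hypothesis; it will come from testing
  two opposite lines.\<close>

lemma one_sided_max_second:
  fixes B :: "real \<Rightarrow> real"
  assumes "0 < s" "\<And>x. x \<in> {0..s} \<Longrightarrow> (B has_real_derivative b x) (at x within {0..s})"
    and "b 0 = 0" "(b has_real_derivative c) (at 0 within {0..s})"
    and "B 0 = 0" "\<And>x. x \<in> {0..s} \<Longrightarrow> B x \<le> 0"
  shows "c \<le> 0"
proof (rule ccontr)
  assume "\<not> c \<le> 0"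
  then obtain d where d: "0 < d" "\<And>h. 0 < h \<Longrightarrow> 0 + h \<in> {0..s} \<Longrightarrow> h < d \<Longrightarrow> b 0 < b (0 + h)"
    using has_real_derivative_pos_inc_right[OF assms(4)] by auto
  define x where "x = min (d / 2) s"
  have x: "0 < x" "x \<le> s" "x < d"
    using d(1) assms(1) by (auto simp: x_def)
  have "(B has_derivative (*) (b y)) (at y within {0..x})" if "0 \<le> y" "y \<le> x" for y
    using assms(2)[of y] x that
    by (auto simp: has_field_derivative_def intro: has_derivative_subset)
  from mvt_simple[OF x(1) this] obtain y where "y \<in> {0<..<x}" "B x - B 0 = b y * (x - 0)"
    by auto
  moreover from this have "0 < b y"
    using d(2)[of y] x assms(3) by auto
  ultimately have "0 < B x"
    using x assms(5) by simp
  then show False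
    using assms(6)[of x] x by simp
qed

text \<open>Cauchy-Schwarz applied to the squared norm of \<open>adjoint f w\<close>, which equals
  \<open>f (adjoint f w) \<bullet> w\<close>. It lets the dual transport be solved with the constant
  of the transport itself.\<close>

lemma norm_adjoint_le:
  fixes f :: "'f::euclidean_space \<Rightarrow> 'f"
  assumes "linear f" "\<And>w. norm (f w) \<le> L * norm w"
  shows "norm (adjoint f w) \<le> L * norm w"
proof (cases "adjoint f w = 0")
  case True
  then show ?thesis
    using order_trans[OF norm_ge_zero assms(2)[of w]] by simp
next
  case False
  have "norm (adjoint f w) * norm (adjoint f w) = f (adjoint f w) \<bullet> w"
    using adjoint_works[OF assms(1), of "adjoint f w" w]
    by (simp add: dot_square_norm power2_eq_square[symmetric])
  also have "\<dots> \<le> norm (adjoint f w) * (L * norm w)"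
    using norm_cauchy_schwarz[of "f (adjoint f w)" w] mult_right_mono[OF assms(2)[of "adjoint f w"], of "norm w"]
    by (simp add: algebra_simps)
  finally show ?thesis
    using False by simp
qed

text \<open>The functional \<open>\<nu>\<close> supporting \<open>Y 0\<close> at \<open>w\<close> is carried along by the dual parallel transport.
  It then supports every \<open>Y s\<close> with the same constant \<open>\<nu> \<bullet> w\<close>, so
  \<open>(\<nu> s \<bullet> F s - \<nu> \<bullet> w) r s \<le> r 0 d \<bar>\<nu> s\<bar> \<le> r 0 d (1 + \<bar>\<nu> s\<bar>\<^sup>2) / 2\<close> with equality at \<open>0\<close>.\<close>

lemma spatial_max_along_line:
  fixes \<alpha> :: "real \<Rightarrow> 'f::euclidean_space \<Rightarrow> 'f" and F M :: "real \<Rightarrow> 'f" and r r1 :: "real \<Rightarrow> real" and L L1 d r2 :: real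
  assumes T: "0 < T"
    and lin: "\<And>s. s \<in> {0..T} \<Longrightarrow> linear (\<alpha> s)"
    and cont: "\<And>w. w \<in> Basis \<Longrightarrow> continuous_on {0..T} (\<lambda>s. \<alpha> s w)"
    and bound: "\<And>s w. s \<in> {0..T} \<Longrightarrow> norm (\<alpha> s w) \<le> L * norm w" and L: "0 \<le> L"
    and deriv: "\<And>w. w \<in> Basis \<Longrightarrow> ((\<lambda>s. \<alpha> s w) has_vector_derivative \<alpha>1 w) (at 0 within {0..T})"
    and deriv_bound: "\<And>w. w \<in> Basis \<Longrightarrow> norm (\<alpha>1 w) \<le> L1"
    and F: "\<And>s. s \<in> {0..T} \<Longrightarrow> (F has_vector_derivative M s - \<alpha> s (F s)) (at s within {0..T})"
    and M: "(M has_vector_derivative \<mu>) (at 0 within {0..T})"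
    and r: "\<And>s. s \<in> {0..T} \<Longrightarrow> 0 \<le> r s"
      "\<And>s. s \<in> {0..T} \<Longrightarrow> (r has_real_derivative r1 s) (at s within {0..T})"
      "(r1 has_real_derivative r2) (at 0 within {0..T})"
    and Y: "\<And>s. s \<in> {0..T} \<Longrightarrow> closed (Y s)" "\<And>s. s \<in> {0..T} \<Longrightarrow> Y s \<noteq> {}"
    and transport: "\<And>s z. s \<in> {0<..T} \<Longrightarrow> z 0 \<in> Y s \<Longrightarrow>
      (\<And>q. q \<in> {0..s} \<Longrightarrow> (z has_vector_derivative \<alpha> (s - q) (z q)) (at q within {0..s})) \<Longrightarrow>
      z s \<in> Y 0"
    and max: "\<And>s. s \<in> {0..T} \<Longrightarrow> r s * infdist (F s) (Y s) \<le> r 0 * d" and d: "0 \<le> d"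
    and \<nu>: "norm \<nu> = 1" "F 0 = w + d *\<^sub>R \<nu>" "\<And>y. y \<in> Y 0 \<Longrightarrow> \<nu> \<bullet> y \<le> \<nu> \<bullet> w"
  shows "(\<nu> \<bullet> M 0) * r 0 + d * r1 0 \<le> r 0 * d * (\<nu> \<bullet> \<alpha> 0 \<nu>)"
    and "(\<nu> \<bullet> M 0) * r 0 + d * r1 0 = r 0 * d * (\<nu> \<bullet> \<alpha> 0 \<nu>) \<Longrightarrow>
      (\<nu> \<bullet> \<mu> + \<nu> \<bullet> \<alpha> 0 (M 0)) * r 0 + 2 * (\<nu> \<bullet> M 0) * r1 0 + d * r2
        \<le> r 0 * d * (2 * L\<^sup>2 + DIM('f) * L1)"
proof -
  \<comment> \<open>The interval is shortened so that \<open>S * L \<le> 1 / 2\<close>. Then linear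
    equations with constant \<open>L\<close> are solvable on \<open>{0..S}\<close> and on each
    shorter interval.\<close>
  define S where "S = min T (1 / (2 * L + 1))"
  have S: "0 < S" "S \<le> T" "{0..S} \<subseteq> {0..T}"
    using T L by (auto simp: S_def)
  have SL: "S * L \<le> 1 / 2"
  proof -
    have "S * L \<le> 1 / (2 * L + 1) * L"
      using L by (intro mult_right_mono) (auto simp: S_def)
    also have "\<dots> \<le> 1 / 2"
      using L by (simp add: field_simps)
    finally show ?thesis .
  qed
  have deriv_at: "(F has_vector_derivative D) (at s within {0..S})"
    if "s \<in> {0..S}" "(F has_vector_derivative D) (at s within {0..T})"
    for F :: "real \<Rightarrow> 'f" and D s
    using that S(3) by (blast intro: has_vector_derivative_within_subset)
  \<comment> \<open>Parallel sections satisfy \<open>z' = - \<alpha> z\<close>; the dual equation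
    \<open>N' = adjoint \<alpha> N\<close> is the one that keeps \<open>N \<bullet> z\<close>
    constant.\<close>
  obtain N where N: "N 0 = \<nu>"
    "\<And>t. t \<in> {0..S} \<Longrightarrow> (N has_vector_derivative adjoint (\<alpha> t) (N t)) (at t within {0..S})"
  proof (rule linear_ode[of S "\<lambda>s. adjoint (\<alpha> s)" L \<nu>])
    show "continuous_on {0..S} (\<lambda>s. adjoint (\<alpha> s) w)" for w
    proof -
      have "adjoint (\<alpha> s) w = (\<Sum>b\<in>Basis. (\<alpha> s b \<bullet> w) *\<^sub>R b)" if "s \<in> {0..S}" for s
        using lin[of s] that S adjoint_works[of "\<alpha> s"]
        by (subst (1) euclidean_representation[symmetric]) (auto simp: inner_commute)
      moreover have "continuous_on {0..S} (\<lambda>s. \<Sum>b\<in>Basis. (\<alpha> s b \<bullet> w) *\<^sub>R b)"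
        using S(3) by (intro continuous_intros continuous_on_subset[OF cont]) auto
      ultimately show ?thesis
        by (subst continuous_on_cong[OF refl]) auto
    qed
  qed (use S SL L lin in \<open>auto intro!: adjoint_linear norm_adjoint_le bound\<close>)
  \<comment> \<open>A point \<open>y\<close> of \<open>Y s\<close> is carried back along the
    reversed line to a point \<open>z s\<close> of \<open>Y 0\<close>. The pairing with the dual
    transport is constant on the way, so \<open>N s \<bullet> y = \<nu> \<bullet> z s\<close>, and
    \<open>\<nu>\<close> supports \<open>Y 0\<close> at \<open>w\<close>.\<close>
  have supp: "N s \<bullet> y \<le> \<nu> \<bullet> w" if s: "s \<in> {0..S}" and y: "y \<in> Y s" for s y
  proof (cases "s = 0")
    case True
    with y N \<nu> show ?thesis by simp
  next
    case False
    with s S have s': "0 < s" "s \<le> S" "s \<in> {0<..T}" by auto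
    obtain z where z: "z 0 = y"
      "\<And>q. q \<in> {0..s} \<Longrightarrow> (z has_vector_derivative \<alpha> (s - q) (z q)) (at q within {0..s})"
    proof (rule linear_ode[of s "\<lambda>q. \<alpha> (s - q)" L y])
      show "continuous_on {0..s} (\<lambda>q. \<alpha> (s - q) b)" if "b \<in> Basis" for b
        using s' S(2) by (intro continuous_on_compose2[OF cont[OF that]] continuous_intros) auto
      have "s * L \<le> S * L"
        using s' L by (intro mult_right_mono) auto
      then show "s * L \<le> 1 / 2"
        using SL by simp
    qed (use s' S(2) L in \<open>auto intro!: lin bound\<close>)
    have zY: "z s \<in> Y 0"
      using transport[OF s'(3)] z y by simp
    define N' where "N' = N \<circ> (\<lambda>q. s - q)"
    have N': "(N' has_vector_derivative - adjoint (\<alpha> (s - q)) (N' q)) (at q within {0..s})"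
      if q: "q \<in> {0..s}" for q
    proof -
      have "((\<lambda>q. s - q) has_vector_derivative - 1) (at q within {0..s})"
        by (auto intro!: derivative_eq_intros)
      moreover have "(N has_vector_derivative adjoint (\<alpha> (s - q)) (N (s - q)))
          (at (s - q) within (\<lambda>q. s - q) ` {0..s})"
        using N(2)[of "s - q"] q s' by (auto intro: has_vector_derivative_within_subset)
      ultimately show ?thesis
        using vector_diff_chain_within unfolding N'_def by fastforce
    qed
    have "\<exists>c. \<forall>q\<in>{0..s}. N' q \<bullet> z q = c"
    proof (rule has_vector_derivative_zero_constant)
      fix q assume q: "q \<in> {0..s}"
      have "linear (\<alpha> (s - q))"
        using q s' S lin by auto
      then show "((\<lambda>q. N' q \<bullet> z q) has_vector_derivative 0) (at q within {0..s})"
        using bounded_bilinear.has_vector_derivative[OF bounded_bilinear_inner N'[OF q] z(2)[OF q]]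
          adjoint_works[of "\<alpha> (s - q)" "z q" "N' q"]
        by (simp add: inner_commute)
    qed auto
    then have "N' 0 \<bullet> z 0 = N' s \<bullet> z s"
      using s' by fastforce
    then show ?thesis
      using z(1) N(1) \<nu>(3)[OF zY] by (simp add: N'_def)
  qed
  define c where "c = \<nu> \<bullet> w"
  have u0: "\<nu> \<bullet> F 0 - c = d"
    using \<nu>(1,2) by (simp add: c_def inner_add_right dot_square_norm)
  define B where "B s = (N s \<bullet> F s - c) * r s - r 0 * d * ((1 + N s \<bullet> N s) / 2)" for s
  \<comment> \<open>This is the derivative of \<open>B\<close>. In the derivative of
    \<open>N s \<bullet> F s\<close> the term \<open>- \<alpha> s (F s)\<close> is cancelled by the
    dual equation, so only the covariant derivative \<open>M s\<close> remains.\<close>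
  define b where "b s = (N s \<bullet> M s) * r s + (N s \<bullet> F s - c) * r1 s - r 0 * d * (N s \<bullet> \<alpha> s (N s))" for s
  have B0: "B 0 = 0"
    using u0 \<nu>(1) by (simp add: B_def N dot_square_norm)
  have Bneg: "B s \<le> 0" if s: "s \<in> {0..S}" for s
  proof -
    have sT: "s \<in> {0..T}" using s S by auto
    obtain y where y: "y \<in> Y s" "infdist (F s) (Y s) = dist (F s) y"
      using infdist_attains_inf[OF Y[OF sT]] by blast
    have "N s \<bullet> F s - c \<le> N s \<bullet> (F s - y)"
      using supp[OF s y(1)] by (simp add: c_def inner_diff_right)
    also have "\<dots> \<le> norm (N s) * infdist (F s) (Y s)"
      unfolding y dist_norm by (rule norm_cauchy_schwarz)
    finally have "(N s \<bullet> F s - c) * r s \<le> norm (N s) * (r s * infdist (F s) (Y s))"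
      using mult_right_mono[OF _ r(1)[OF sT]] by (fastforce simp: algebra_simps)
    also have "\<dots> \<le> norm (N s) * (r 0 * d)"
      using max[OF sT] by (intro mult_left_mono) auto
    also have "\<dots> \<le> (1 + N s \<bullet> N s) / 2 * (r 0 * d)"
    proof (rule mult_right_mono)
      show "norm (N s) \<le> (1 + N s \<bullet> N s) / 2"
        using zero_le_power2[of "norm (N s) - 1"] by (simp add: dot_square_norm power2_diff)
      show "0 \<le> r 0 * d"
        using r(1)[of 0] d T by simp
    qed
    finally show ?thesis
      unfolding B_def by (metis diff_le_0_iff_le mult.commute)
  qed
  have dNF: "((\<lambda>s. N s \<bullet> F s) has_real_derivative N s \<bullet> M s) (at s within {0..S})"
    if s: "s \<in> {0..S}" for s
  proof -
    have "linear (\<alpha> s)"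
      using s S lin by auto
    with bounded_bilinear.has_vector_derivative[OF bounded_bilinear_inner N(2)[OF s] deriv_at[OF s F]]
      s S adjoint_works[of "\<alpha> s" "F s" "N s"] show ?thesis
      by (auto simp: has_real_derivative_iff_has_vector_derivative inner_diff_right inner_commute)
  qed
  have dNN: "((\<lambda>s. N s \<bullet> N s) has_real_derivative 2 * (N s \<bullet> \<alpha> s (N s))) (at s within {0..S})"
    if s: "s \<in> {0..S}" for s
  proof -
    have "linear (\<alpha> s)"
      using s S lin by auto
    with bounded_bilinear.has_vector_derivative[OF bounded_bilinear_inner N(2)[OF s] N(2)[OF s]]
      adjoint_works[of "\<alpha> s" "N s" "N s"] show ?thesis
      by (auto simp: has_real_derivative_iff_has_vector_derivative inner_commute)
  qed
  have rS: "(r has_real_derivative r1 s) (at s within {0..S})" if "s \<in> {0..S}" for s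
    using r(2)[of s] S that by (auto intro: DERIV_subset)
  have dB: "(B has_real_derivative b s) (at s within {0..S})" if s: "s \<in> {0..S}" for s
    unfolding B_def b_def
    by (auto intro!: derivative_eq_intros dNF[OF s] dNN[OF s] rS[OF s] simp: algebra_simps)
  have 0: "0 \<in> {0..S}" using S by simp
  show "(\<nu> \<bullet> M 0) * r 0 + d * r1 0 \<le> r 0 * d * (\<nu> \<bullet> \<alpha> 0 \<nu>)"
    using one_sided_max_first[OF S(1) dB[OF 0] B0 Bneg] u0 by (simp add: b_def N)
  define A1 where "A1 = (\<Sum>e\<in>Basis. (\<nu> \<bullet> e) *\<^sub>R \<alpha>1 e)"
  let ?a = "adjoint (\<alpha> 0) \<nu>"
  have lin0: "linear (\<alpha> 0)"
    using lin T by simp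
  have d\<alpha>: "((\<lambda>s. \<alpha> s (N s)) has_vector_derivative A1 + \<alpha> 0 ?a) (at 0 within {0..S})"
  proof -
    have eq: "\<alpha> s v = (\<Sum>e\<in>Basis. (v \<bullet> e) *\<^sub>R \<alpha> s e)" if "s \<in> {0..S}" for s v
      using lin S that by (intro linear_Basis_sum) auto
    have "((\<lambda>s. \<Sum>e\<in>Basis. (N s \<bullet> e) *\<^sub>R \<alpha> s e) has_vector_derivative
        (\<Sum>e\<in>Basis. (N 0 \<bullet> e) *\<^sub>R \<alpha>1 e + (?a \<bullet> e) *\<^sub>R \<alpha> 0 e)) (at 0 within {0..S})"
    proof (rule has_vector_derivative_sum)
      fix e :: 'f assume e: "e \<in> Basis"
      have "((\<lambda>s. N s \<bullet> e) has_vector_derivative ?a \<bullet> e) (at 0 within {0..S})"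
        using bounded_linear.has_vector_derivative[OF bounded_linear_inner_left N(2)[OF 0]] N(1) by simp
      then show "((\<lambda>s. (N s \<bullet> e) *\<^sub>R \<alpha> s e) has_vector_derivative
          (N 0 \<bullet> e) *\<^sub>R \<alpha>1 e + (?a \<bullet> e) *\<^sub>R \<alpha> 0 e) (at 0 within {0..S})"
        by (intro has_vector_derivative_scaleR deriv_at[OF 0 deriv[OF e]])
          (simp add: has_real_derivative_iff_has_vector_derivative)
    qed
    then have "((\<lambda>s. \<Sum>e\<in>Basis. (N s \<bullet> e) *\<^sub>R \<alpha> s e) has_vector_derivative A1 + \<alpha> 0 ?a) (at 0 within {0..S})"
      unfolding sum.distrib A1_def N(1) eq[OF 0, of ?a, symmetric] .
    then show ?thesis
      by (rule has_vector_derivative_transform[OF 0, rotated]) (rule eq)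
  qed
  have dM: "(M has_vector_derivative \<mu>) (at 0 within {0..S})"
    by (rule deriv_at[OF 0 M])
  have db: "(b has_real_derivative
      (?a \<bullet> M 0 + \<nu> \<bullet> \<mu>) * r 0 + (\<nu> \<bullet> M 0) * r1 0 + ((\<nu> \<bullet> M 0) * r1 0 + d * r2)
        - r 0 * d * (?a \<bullet> \<alpha> 0 \<nu> + \<nu> \<bullet> (A1 + \<alpha> 0 ?a))) (at 0 within {0..S})"
  proof -
    have 1: "((\<lambda>s. N s \<bullet> M s) has_real_derivative ?a \<bullet> M 0 + \<nu> \<bullet> \<mu>) (at 0 within {0..S})"
      using bounded_bilinear.has_vector_derivative[OF bounded_bilinear_inner N(2)[OF 0] dM] N(1)
      by (simp add: has_real_derivative_iff_has_vector_derivative add.commute)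
    have 2: "((\<lambda>s. N s \<bullet> \<alpha> s (N s)) has_real_derivative ?a \<bullet> \<alpha> 0 \<nu> + \<nu> \<bullet> (A1 + \<alpha> 0 ?a)) (at 0 within {0..S})"
      using bounded_bilinear.has_vector_derivative[OF bounded_bilinear_inner N(2)[OF 0] d\<alpha>] N(1)
      by (simp add: has_real_derivative_iff_has_vector_derivative add.commute)
    have 3: "(r1 has_real_derivative r2) (at 0 within {0..S})"
      using r(3) S(3) by (rule DERIV_subset)
    show ?thesis
      unfolding b_def
      by (rule derivative_eq_intros 1 2 3 dNF[OF 0] rS[OF 0] refl)+ (use u0 N(1) in \<open>simp add: algebra_simps\<close>)
  qed
  \<comment> \<open>Equality in the first-order test means exactly \<open>b 0 = 0\<close>, so that
    the second-order test becomes available.\<close>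
  assume eq: "(\<nu> \<bullet> M 0) * r 0 + d * r1 0 = r 0 * d * (\<nu> \<bullet> \<alpha> 0 \<nu>)"
  then have b0: "b 0 = 0"
    using u0 by (simp add: b_def N)
  have le0: "(?a \<bullet> M 0 + \<nu> \<bullet> \<mu>) * r 0 + (\<nu> \<bullet> M 0) * r1 0 + ((\<nu> \<bullet> M 0) * r1 0 + d * r2)
        - r 0 * d * (?a \<bullet> \<alpha> 0 \<nu> + \<nu> \<bullet> (A1 + \<alpha> 0 ?a)) \<le> 0"
    by (rule one_sided_max_second[OF S(1) dB b0 db B0 Bneg])
  have b\<alpha>: "norm (\<alpha> 0 v) \<le> L * norm v" for v
    using bound T by simp
  have na: "norm ?a \<le> L"
    using norm_adjoint_le[OF lin0 b\<alpha>, of \<nu>] \<nu>(1) by simp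
  have "?a \<bullet> \<alpha> 0 \<nu> \<le> L * L"
    using norm_cauchy_schwarz[of ?a "\<alpha> 0 \<nu>"] mult_mono[OF na, of "norm (\<alpha> 0 \<nu>)" L] b\<alpha>[of \<nu>] \<nu>(1) L by simp
  moreover have "\<nu> \<bullet> \<alpha> 0 ?a \<le> L * L"
    using norm_cauchy_schwarz[of \<nu> "\<alpha> 0 ?a"] mult_left_mono[OF na L] b\<alpha>[of ?a] \<nu>(1) by simp
  moreover have "\<nu> \<bullet> A1 \<le> DIM('f) * L1"
  proof -
    have "norm A1 \<le> (\<Sum>e\<in>(Basis :: 'f set). L1)"
      unfolding A1_def
    proof (rule sum_norm_le)
      fix e :: 'f assume e: "e \<in> Basis"
      have "\<bar>\<nu> \<bullet> e\<bar> * norm (\<alpha>1 e) \<le> 1 * L1"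
        using Basis_le_norm[OF e, of \<nu>] \<nu>(1) deriv_bound[OF e] by (intro mult_mono) auto
      then show "norm ((\<nu> \<bullet> e) *\<^sub>R \<alpha>1 e) \<le> L1" by simp
    qed
    then show ?thesis
      using norm_cauchy_schwarz[of \<nu> A1] \<nu>(1) by simp
  qed
  ultimately have "?a \<bullet> \<alpha> 0 \<nu> + \<nu> \<bullet> (A1 + \<alpha> 0 ?a) \<le> 2 * L\<^sup>2 + DIM('f) * L1"
    by (simp add: inner_add_right power2_eq_square)
  then have "r 0 * d * (?a \<bullet> \<alpha> 0 \<nu> + \<nu> \<bullet> (A1 + \<alpha> 0 ?a)) \<le> r 0 * d * (2 * L\<^sup>2 + DIM('f) * L1)"
    using r(1)[of 0] d T by (intro mult_left_mono) auto
  moreover have "?a \<bullet> M 0 = \<nu> \<bullet> \<alpha> 0 (M 0)"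
    using adjoint_works[OF lin0, of "M 0" \<nu>] by (simp add: inner_commute)
  ultimately show "(\<nu> \<bullet> \<mu> + \<nu> \<bullet> \<alpha> 0 (M 0)) * r 0 + 2 * (\<nu> \<bullet> M 0) * r1 0 + d * r2
        \<le> r 0 * d * (2 * L\<^sup>2 + DIM('f) * L1)"
    using le0 by (simp add: algebra_simps)
qed

section \<open>Charts and the tangent bundle\<close>

locale atlas =
  fixes A :: "('m::{t2_space,second_countable_topology}, 'a::euclidean_space) chart set"
  assumes smooth_atlas: "smooth_atlas A"
begin

lemma chart:
  assumes "(U, c) \<in> A"
  shows "open U" "open (c ` U)" "continuous_on U c" "continuous_on (c ` U) (inv_into U c)"
    "\<And>m. m \<in> U \<Longrightarrow> inv_into U c (c m) = m"
proof -
  have h: "homeomorphism U (c ` U) c (inv_into U c)" and "open U" "open (c ` U)"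
    using smooth_atlas assms by (auto simp: smooth_atlas_def)
  then show "open U" "open (c ` U)" "continuous_on U c" "continuous_on (c ` U) (inv_into U c)"
    "\<And>m. m \<in> U \<Longrightarrow> inv_into U c (c m) = m"
    by (auto simp: homeomorphism_def)
qed

lemma chart_inv:
  assumes "x \<in> c ` U"
  shows "inv_into U c x \<in> U" "c (inv_into U c x) = x"
  using assms by (auto intro: inv_into_into f_inv_into_f)

lemma chart_image_eq:
  assumes "(U, c) \<in> A"
  shows "c ` (U \<inter> W) = {x \<in> c ` U. inv_into U c x \<in> W}"
  using chart(5)[OF assms] chart_inv[of _ c U] by (auto simp: image_iff)

lemma open_chart_image:
  assumes "(U, c) \<in> A" "open W"
  shows "open (c ` (U \<inter> W))"
proof -
  have "c ` (U \<inter> W) = c ` U \<inter> inv_into U c -` W"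
    using chart_image_eq[OF assms(1)] by auto
  then show ?thesis
    using chart[OF assms(1)] assms(2) by (simp add: continuous_open_preimage)
qed

lemma chart_at: "(fst (chart_at A m), snd (chart_at A m)) \<in> A" "m \<in> fst (chart_at A m)"
proof -
  have "(\<Union>(U, c)\<in>A. U) = UNIV"
    using smooth_atlas by (simp add: smooth_atlas_def)
  then have "m \<in> (\<Union>(U, c)\<in>A. U)"
    by (metis UNIV_I)
  then obtain U c where "(U, c) \<in> A" "m \<in> U"
    by auto
  then have "case chart_at A m of (U, c) \<Rightarrow> (U, c) \<in> A \<and> m \<in> U"
    unfolding chart_at_def using someI[of "\<lambda>(U, c). (U, c) \<in> A \<and> m \<in> U" "(U, c)"] by simp
  then show "(fst (chart_at A m), snd (chart_at A m)) \<in> A" "m \<in> fst (chart_at A m)"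
    by (auto simp: case_prod_unfold)
qed

lemma smooth_family_chart:
  "smooth_family A P W F \<Longrightarrow> (U, c) \<in> A \<Longrightarrow>
    smooth_on (P \<times> c ` (U \<inter> W)) (\<lambda>(p, x). F p (inv_into U c x))"
  by (auto simp: smooth_family_def)

text \<open>The definition of \<open>smooth_fun\<close> carries a dummy real parameter. Slicing
  removes it, and composition with \<open>snd\<close> restores it.\<close>

lemma smooth_fun_iff:
  "smooth_fun A W F \<longleftrightarrow> (\<forall>(U, c)\<in>A. smooth_on (c ` (U \<inter> W)) (F \<circ> inv_into U c))"
proof (intro iffI)
  assume "smooth_fun A W F"
  then show "\<forall>(U, c)\<in>A. smooth_on (c ` (U \<inter> W)) (F \<circ> inv_into U c)"
    using smooth_on_slice[of "UNIV :: real set"]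
    by (fastforce simp: smooth_fun_def smooth_family_def o_def)
next
  assume R: "\<forall>(U, c)\<in>A. smooth_on (c ` (U \<inter> W)) (F \<circ> inv_into U c)"
  have "smooth_on ((UNIV :: real set) \<times> c ` (U \<inter> W)) (\<lambda>(p, x). F (inv_into U c x))"
    if "(U, c) \<in> A" for U c
  proof -
    have "smooth_on ((UNIV :: real set) \<times> c ` (U \<inter> W)) ((F \<circ> inv_into U c) \<circ> snd)"
    proof (rule smooth_on_compose)
      show "smooth_on (c ` (U \<inter> W)) (F \<circ> inv_into U c)"
        using R that by auto
    qed (auto intro: smooth_on_linear linear_snd)
    then show ?thesis
      by (simp add: o_def case_prod_unfold)
  qed
  then show "smooth_fun A W F"
    by (auto simp: smooth_fun_def smooth_family_def)
qed

lemma smooth_fun_chart: "smooth_fun A W F \<Longrightarrow> (U, c) \<in> A \<Longrightarrow> smooth_on (c ` (U \<inter> W)) (F \<circ> inv_into U c)"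
  by (auto simp: smooth_fun_iff)

lemma smooth_fun_subset: "smooth_fun A W F \<Longrightarrow> W' \<subseteq> W \<Longrightarrow> smooth_fun A W' F"
  unfolding smooth_fun_iff by (fastforce intro: smooth_on_subset)

lemma smooth_fun_cong:
  assumes "smooth_fun A W F" "\<And>m. m \<in> W \<Longrightarrow> F m = G m"
  shows "smooth_fun A W G"
  unfolding smooth_fun_iff
proof safe
  fix U c assume "(U, c) \<in> A"
  with smooth_fun_chart[OF assms(1) this] assms(2)
  show "smooth_on (c ` (U \<inter> W)) (G \<circ> inv_into U c)"
    by (elim smooth_on_cong) (auto simp: chart)
qed

lemma smooth_fun_const: "smooth_fun A W (\<lambda>_. a)"
  by (simp add: smooth_fun_iff o_def smooth_on_const)

lemma smooth_fun_add:
  "smooth_fun A W F \<Longrightarrow> smooth_fun A W G \<Longrightarrow> smooth_fun A W (\<lambda>m. F m + G m)"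
  unfolding smooth_fun_iff o_def by (fast intro: smooth_on_add)

lemma smooth_fun_scaleR:
  "smooth_fun A W F \<Longrightarrow> smooth_fun A W G \<Longrightarrow> smooth_fun A W (\<lambda>m. F m *\<^sub>R G m)"
  unfolding smooth_fun_iff o_def by (fast intro: smooth_on_scaleR)

lemma smooth_fun_inner_left: "smooth_fun A W F \<Longrightarrow> smooth_fun A W (\<lambda>m. F m \<bullet> b)"
  unfolding smooth_fun_iff o_def by (fast intro: smooth_on_inner_left)

lemma smooth_fun_coordinate: "(V, d) \<in> A \<Longrightarrow> smooth_fun A V d"
  using smooth_atlas unfolding smooth_fun_iff smooth_atlas_def by blast

lemma smooth_fun_differentiable:
  assumes "smooth_fun A W F" "open W" "(U, c) \<in> A" "m \<in> U" "m \<in> W"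
  shows "(F \<circ> inv_into U c) differentiable (at (c m))"
  using assms by (intro smooth_on_differentiable[OF smooth_fun_chart open_chart_image]) auto

lemma smooth_fun_continuous:
  assumes "smooth_fun A W F" "open W"
  shows "continuous_on W F"
  unfolding continuous_on_eq_continuous_at[OF assms(2)]
proof
  fix m assume m: "m \<in> W"
  let ?U = "fst (chart_at A m)" and ?c = "snd (chart_at A m)"
  have U: "open ?U" "continuous_on ?U ?c" "m \<in> ?U"
    using chart[OF chart_at(1)] chart_at(2) by auto
  have "continuous_on (?U \<inter> W) ((F \<circ> inv_into ?U ?c) \<circ> ?c)"
    by (rule continuous_on_compose[OF continuous_on_subset[OF U(2)]
          smooth_on_imp_continuous_on[OF smooth_fun_chart[OF assms(1) chart_at(1)]]]) auto
  then have "continuous_on (?U \<inter> W) F"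
    by (rule continuous_on_cong[THEN iffD1, OF refl, rotated]) (simp add: chart[OF chart_at(1)])
  then show "isCont F m"
    using U assms(2) m by (simp add: continuous_on_eq_continuous_at open_Int)
qed

lemma differential_chart_at:
  "differential A F m = frechet_derivative (F \<circ> inv_into (fst (chart_at A m)) (snd (chart_at A m)))
    (at (snd (chart_at A m) m))"
  by (simp add: differential_def case_prod_unfold fun_eq_iff)

text \<open>The chain rule through the coordinate change; the composite agrees with
  \<open>F \<circ> inv_into V d\<close> only on the image of the overlap, an open set around the
  point. It frees \<open>differential\<close> from the chart chosen in its definition.\<close>

lemma frechet_derivative_change_chart:
  assumes F: "smooth_fun A W F" "open W" and U: "(U, c) \<in> A" "m \<in> U" and V: "(V, d) \<in> A" "m \<in> V"
    and m: "m \<in> W"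
  shows "frechet_derivative (F \<circ> inv_into V d) (at (d m)) =
    frechet_derivative (F \<circ> inv_into U c) (at (c m)) \<circ> frechet_derivative (c \<circ> inv_into V d) (at (d m))"
proof -
  have "frechet_derivative ((F \<circ> inv_into U c) \<circ> (c \<circ> inv_into V d)) (at (d m)) =
      frechet_derivative (F \<circ> inv_into V d) (at (d m))"
  proof (rule frechet_derivative_transform_within_open)
    have c: "(c \<circ> inv_into V d) differentiable at (d m)"
      using smooth_fun_differentiable[OF smooth_fun_coordinate[OF U(1)]] chart(1)[OF U(1)] U V by auto
    moreover have "(F \<circ> inv_into U c) differentiable at ((c \<circ> inv_into V d) (d m))"
      using smooth_fun_differentiable[OF F U m] chart(5)[OF V(1)] V by simp
    ultimately show "(F \<circ> inv_into U c \<circ> (c \<circ> inv_into V d)) differentiable at (d m)"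
      by (rule differentiable_chain_at)
    show "open (d ` (V \<inter> U))"
      using open_chart_image[OF V(1)] chart(1)[OF U(1)] by simp
    show "d m \<in> d ` (V \<inter> U)"
      using U V by auto
    show "(F \<circ> inv_into U c \<circ> (c \<circ> inv_into V d)) x = (F \<circ> inv_into V d) x" if "x \<in> d ` (V \<inter> U)" for x
      using that chart(5)[OF V(1)] chart(5)[OF U(1)] by auto
  qed
  moreover have "(c \<circ> inv_into V d) differentiable at (d m)"
    using smooth_fun_differentiable[OF smooth_fun_coordinate[OF U(1)]] chart(1)[OF U(1)] U V by auto
  moreover have "(F \<circ> inv_into U c) differentiable at ((c \<circ> inv_into V d) (d m))"
    using smooth_fun_differentiable[OF F U m] chart(5)[OF V(1)] V by simp
  ultimately show ?thesis
    using frechet_derivative_compose[of "c \<circ> inv_into V d" "d m" "F \<circ> inv_into U c"]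
      chart(5)[OF V(1)] V by simp
qed

lemma differential_eq:
  assumes "smooth_fun A W F" "open W" "(U, c) \<in> A" "m \<in> U" "m \<in> W"
  shows "differential A F m v = frechet_derivative (F \<circ> inv_into U c) (at (c m)) (differential A c m v)"
  unfolding differential_chart_at
  using frechet_derivative_change_chart[OF assms(1-4) chart_at assms(5)] by simp

lemma frechet_derivative_chart_id:
  assumes "(U, c) \<in> A" "m \<in> U"
  shows "frechet_derivative (c \<circ> inv_into U c) (at (c m)) = (\<lambda>v. v)"
proof -
  have "frechet_derivative (\<lambda>x. x) (at (c m)) = frechet_derivative (c \<circ> inv_into U c) (at (c m))"
    by (rule frechet_derivative_transform_within_open[where X="c ` U"])
      (use assms chart[OF assms(1)] in auto)
  then show ?thesis
    by (simp add: frechet_derivative_ident)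
qed

text \<open>Change of chart applied to the coordinate map \<open>c\<close> itself, whose derivative
  in its own chart is the identity.\<close>

lemma transition_inverse:
  assumes "(U, c) \<in> A" "(V, d) \<in> A" "m \<in> U" "m \<in> V"
  shows "frechet_derivative (c \<circ> inv_into V d) (at (d m)) (frechet_derivative (d \<circ> inv_into U c) (at (c m)) v) = v"
  using frechet_derivative_change_chart[OF smooth_fun_coordinate[OF assms(1)] _ assms(2,4) assms(1,3,3)]
    frechet_derivative_chart_id[OF assms(1,3)] chart(1)[OF assms(1)]
  by (metis comp_apply)

lemma linear_differential:
  assumes "smooth_fun A W F" "open W" "m \<in> W"
  shows "linear (differential A F m)"
  unfolding differential_chart_at
  using smooth_fun_differentiable[OF assms(1,2) chart_at assms(3)] by (rule linear_frechet_derivative)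

lemma differential_inner:
  assumes "smooth_fun A W F" "open W" "m \<in> W"
  shows "differential A (\<lambda>p. F p \<bullet> b) m u = differential A F m u \<bullet> b"
proof -
  let ?G = "F \<circ> inv_into (fst (chart_at A m)) (snd (chart_at A m))"
  have "(?G has_derivative frechet_derivative ?G (at (snd (chart_at A m) m))) (at (snd (chart_at A m) m))"
    using smooth_fun_differentiable[OF assms(1,2) chart_at assms(3)] frechet_derivative_works by blast
  from frechet_derivative_at[OF has_derivative_inner_left[OF this, of b]]
  show ?thesis
    unfolding differential_chart_at o_def by metis
qed

lemma differential_const: "differential A (\<lambda>_. a) m u = 0"
  by (simp add: differential_chart_at o_def frechet_derivative_const)

lemma differential_coordinate:
  assumes "(U, c) \<in> A" "m \<in> U"
  shows "linear (differential A c m)" "bij (differential A c m)"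
    "differential A c m (frechet_derivative (snd (chart_at A m) \<circ> inv_into U c) (at (c m)) e) = e"
proof -
  show "linear (differential A c m)"
    using linear_differential[OF smooth_fun_coordinate] chart(1) assms by blast
  show 1: "differential A c m (frechet_derivative (snd (chart_at A m) \<circ> inv_into U c) (at (c m)) e) = e" for e
    unfolding differential_chart_at
    using transition_inverse[OF assms(1) chart_at(1) assms(2) chart_at(2)] .
  show "bij (differential A c m)"
    unfolding differential_chart_at
    using transition_inverse[OF assms(1) chart_at(1) assms(2) chart_at(2)]
      transition_inverse[OF chart_at(1) assms(1) chart_at(2) assms(2)]
    by (intro o_bij[of "frechet_derivative (snd (chart_at A m) \<circ> inv_into U c) (at (c m))"])
      (simp_all add: fun_eq_iff)
qed

text \<open>The coordinate vector field of the chart \<open>c\<close> in the direction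
  \<open>e\<close>. Its values are components in the charts chosen pointwise, hence need not be
  continuous in \<open>m\<close> although the field is smooth.\<close>

abbreviation frame :: "('m \<Rightarrow> 'a) \<Rightarrow> 'a \<Rightarrow> 'm \<Rightarrow> 'a" where
  "frame c \<equiv> const_section (tangent_bundle A) (differential A c)"

lemma fiber_tangent_bundle [simp]: "fiber (tangent_bundle A) m = UNIV"
  by (simp add: tangent_bundle_def)

lemma trivs_tangent_bundle: "(U, \<tau>) \<in> trivs (tangent_bundle A) \<longleftrightarrow> (\<exists>c. (U, c) \<in> A \<and> \<tau> = differential A c)"
  by (auto simp: tangent_bundle_def)

lemma differential_frame:
  "(U, c) \<in> A \<Longrightarrow> m \<in> U \<Longrightarrow> differential A c m (frame c e m) = e"
  using differential_coordinate(2) by (simp add: const_section_def bij_is_surj surj_f_inv_f)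

lemma frame_differential:
  "(U, c) \<in> A \<Longrightarrow> m \<in> U \<Longrightarrow> frame c (differential A c m v) m = v"
  using differential_coordinate(2) by (simp add: const_section_def bij_is_inj inv_f_f)

lemma frame_eq:
  "(U, c) \<in> A \<Longrightarrow> m \<in> U \<Longrightarrow>
    frame c e m = frechet_derivative (snd (chart_at A m) \<circ> inv_into U c) (at (c m)) e"
  using differential_coordinate(3)[of U c m e] frame_differential[of U c m] by metis

text \<open>The transition maps are the derivatives of the coordinate changes. With this, everything
  shown for connections on a bundle applies to \<open>NT\<close> as well.\<close>

lemma vector_bundle_tangent_bundle: "vector_bundle A (tangent_bundle A)"
proof -
  have 1: "smooth_fun A (U \<inter> V) (\<lambda>m. differential A d m (frame c w m))"
    if U: "(U, c) \<in> A" and V: "(V, d) \<in> A" for U c V d w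
  proof -
    have UV: "open (U \<inter> V)"
      using chart(1)[OF U] chart(1)[OF V] by auto
    have eq: "differential A d m (frame c w m) = frechet_derivative (d \<circ> inv_into U c) (at (c m)) w"
      if "m \<in> U \<inter> V" for m
      using that differential_eq[OF smooth_fun_coordinate[OF V] chart(1)[OF V] U]
        differential_frame[OF U] by auto
    have D: "smooth_on (c ` (U \<inter> V)) (\<lambda>x. frechet_derivative (d \<circ> inv_into U c) (at x) w)"
      using smooth_fun_chart[OF smooth_fun_coordinate[OF V] U] open_chart_image[OF U chart(1)[OF V]]
      by (rule smooth_on_derivative)
    have "smooth_fun A (U \<inter> V) (\<lambda>m. frechet_derivative (d \<circ> inv_into U c) (at (c m)) w)"
      unfolding smooth_fun_iff
    proof safe
      fix K k assume K: "(K, k) \<in> A"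
      have "smooth_on (k ` (K \<inter> (U \<inter> V))) (c \<circ> inv_into K k)"
        by (rule smooth_on_subset[OF smooth_fun_chart[OF smooth_fun_coordinate[OF U] K]]) auto
      from smooth_on_compose[OF D this]
      have "smooth_on (k ` (K \<inter> (U \<inter> V)))
          ((\<lambda>x. frechet_derivative (d \<circ> inv_into U c) (at x) w) \<circ> (c \<circ> inv_into K k))"
        using chart(5)[OF K] by fastforce
      then show "smooth_on (k ` (K \<inter> (U \<inter> V)))
          ((\<lambda>m. frechet_derivative (d \<circ> inv_into U c) (at (c m)) w) \<circ> inv_into K k)"
        by (simp add: o_def)
    qed
    then show ?thesis
      by (rule smooth_fun_cong) (simp add: eq)
  qed
  have 2: "(\<Union>(U, \<tau>)\<in>trivs (tangent_bundle A). U) = UNIV"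
  proof (intro equalityI subset_UNIV subsetI)
    fix m :: 'm
    have "(fst (chart_at A m), differential A (snd (chart_at A m))) \<in> trivs (tangent_bundle A)"
      using chart_at(1) trivs_tangent_bundle by blast
    then show "m \<in> (\<Union>(U, \<tau>)\<in>trivs (tangent_bundle A). U)"
      using chart_at(2)[of m] by blast
  qed
  show ?thesis
    unfolding vector_bundle_def
  proof (intro conjI)
    show "\<forall>(U, \<tau>)\<in>trivs (tangent_bundle A). open U \<and>
        (\<forall>m\<in>U. bij_betw (\<tau> m) (fiber (tangent_bundle A) m) UNIV \<and>
           (\<forall>v\<in>fiber (tangent_bundle A) m. \<forall>w\<in>fiber (tangent_bundle A) m. \<tau> m (v + w) = \<tau> m v + \<tau> m w) \<and>
           (\<forall>a. \<forall>v\<in>fiber (tangent_bundle A) m. \<tau> m (a *\<^sub>R v) = a *\<^sub>R \<tau> m v))"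
      using chart(1) differential_coordinate(1,2)
      by (auto simp: trivs_tangent_bundle linear_add linear_scale)
    show "\<forall>(U, \<tau>)\<in>trivs (tangent_bundle A). \<forall>(V, \<sigma>)\<in>trivs (tangent_bundle A). \<forall>w.
        smooth_fun A (U \<inter> V) (\<lambda>m. \<sigma> m (const_section (tangent_bundle A) \<tau> w m))"
      using 1 by (auto simp: trivs_tangent_bundle)
  qed (use 2 in auto)
qed

end

section \<open>Bundles and connections in trivializations\<close>

locale vec_bundle = atlas A
  for A :: "('m::{t2_space,second_countable_topology}, 'a::euclidean_space) chart set" +
  fixes E :: "('m, 'v::real_vector, 'f::euclidean_space) vbundle"
  assumes vector_bundle: "vector_bundle A E"
begin

lemma subspace_fiber: "subspace (fiber E m)"
  using vector_bundle by (simp add: vector_bundle_def)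

lemma triv:
  assumes "(V, \<tau>) \<in> trivs E"
  shows "open V"
    "\<And>m. m \<in> V \<Longrightarrow> bij_betw (\<tau> m) (fiber E m) UNIV"
    "\<And>m v w. m \<in> V \<Longrightarrow> v \<in> fiber E m \<Longrightarrow> w \<in> fiber E m \<Longrightarrow> \<tau> m (v + w) = \<tau> m v + \<tau> m w"
    "\<And>m v a. m \<in> V \<Longrightarrow> v \<in> fiber E m \<Longrightarrow> \<tau> m (a *\<^sub>R v) = a *\<^sub>R \<tau> m v"
  using vector_bundle assms by (auto simp: vector_bundle_def)

lemma triv_const_section:
  assumes "(V, \<tau>) \<in> trivs E" "m \<in> V"
  shows "const_section E \<tau> w m \<in> fiber E m" "\<tau> m (const_section E \<tau> w m) = w"
    "v \<in> fiber E m \<Longrightarrow> const_section E \<tau> (\<tau> m v) m = v"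
  using triv(2)[OF assms] unfolding const_section_def
  by (auto simp: bij_betw_def inv_into_into f_inv_into_f)

lemma triv_inject:
  assumes "(V, \<tau>) \<in> trivs E" "m \<in> V" "v \<in> fiber E m" "w \<in> fiber E m" "\<tau> m v = \<tau> m w"
  shows "v = w"
  using triv_const_section(3)[OF assms(1,2)] assms by metis

lemma triv_zero: "(V, \<tau>) \<in> trivs E \<Longrightarrow> m \<in> V \<Longrightarrow> \<tau> m 0 = 0"
  using triv(4)[of V \<tau> m 0 0] subspace_fiber[of m] by (simp add: subspace_0)

lemma triv_sum:
  assumes "(V, \<tau>) \<in> trivs E" "m \<in> V" "\<And>i. i \<in> I \<Longrightarrow> v i \<in> fiber E m"
  shows "\<tau> m (\<Sum>i\<in>I. v i) = (\<Sum>i\<in>I. \<tau> m (v i))"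
  using assms(3)
  by (induction I rule: infinite_finite_induct)
    (simp_all add: triv_zero[OF assms(1,2)] triv(3)[OF assms(1,2)] subspace_sum[OF subspace_fiber])

lemma triv_uminus:
  "(V, \<tau>) \<in> trivs E \<Longrightarrow> m \<in> V \<Longrightarrow> v \<in> fiber E m \<Longrightarrow> \<tau> m (- v) = - \<tau> m v"
  using triv(4)[of V \<tau> m v "-1"] by simp

lemma triv_diff:
  "(V, \<tau>) \<in> trivs E \<Longrightarrow> m \<in> V \<Longrightarrow> v \<in> fiber E m \<Longrightarrow> w \<in> fiber E m \<Longrightarrow> \<tau> m (v - w) = \<tau> m v - \<tau> m w"
  using triv(3)[of V \<tau> m v "- w"] triv_uminus[of V \<tau> m w] subspace_neg[OF subspace_fiber, of w m] by simp

lemma const_section_sum: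
  assumes "(V, \<tau>) \<in> trivs E" "m \<in> V"
  shows "const_section E \<tau> w m = (\<Sum>b\<in>Basis. (w \<bullet> b) *\<^sub>R const_section E \<tau> b m)"
proof (rule triv_inject[OF assms])
  have s: "(w \<bullet> b) *\<^sub>R const_section E \<tau> b m \<in> fiber E m" for b
    using triv_const_section(1)[OF assms] by (rule subspace_scale[OF subspace_fiber])
  then show "(\<Sum>b\<in>Basis. (w \<bullet> b) *\<^sub>R const_section E \<tau> b m) \<in> fiber E m"
    by (intro subspace_sum[OF subspace_fiber])
  show "\<tau> m (const_section E \<tau> w m) = \<tau> m (\<Sum>b\<in>Basis. (w \<bullet> b) *\<^sub>R const_section E \<tau> b m)"
    by (simp add: triv_sum[OF assms s] triv(4)[OF assms] triv_const_section[OF assms] euclidean_representation)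
qed (rule triv_const_section[OF assms])

lemma smooth_section_iff:
  "smooth_section A E W s \<longleftrightarrow>
    (\<forall>m\<in>W. s m \<in> fiber E m) \<and> (\<forall>(V, \<tau>)\<in>trivs E. smooth_fun A (V \<inter> W) (\<lambda>m. \<tau> m (s m)))"
  by (auto simp: smooth_section_def smooth_section_family_def smooth_fun_def)

lemma smooth_section_subset: "smooth_section A E W s \<Longrightarrow> W' \<subseteq> W \<Longrightarrow> smooth_section A E W' s"
  unfolding smooth_section_iff by (fastforce intro: smooth_fun_subset)

lemma smooth_section_add:
  assumes "smooth_section A E W s" "smooth_section A E W s'"
  shows "smooth_section A E W (\<lambda>m. s m + s' m)"
  unfolding smooth_section_iff
proof safe
  fix m assume "m \<in> W" then show "s m + s' m \<in> fiber E m"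
    using assms by (auto simp: smooth_section_iff intro!: subspace_add[OF subspace_fiber])
next
  fix V \<tau> assume V: "(V, \<tau>) \<in> trivs E"
  with assms have "smooth_fun A (V \<inter> W) (\<lambda>m. \<tau> m (s m))" "smooth_fun A (V \<inter> W) (\<lambda>m. \<tau> m (s' m))"
    by (auto simp: smooth_section_iff)
  from smooth_fun_add[OF this] show "smooth_fun A (V \<inter> W) (\<lambda>m. \<tau> m (s m + s' m))"
    by (rule smooth_fun_cong) (use assms in \<open>auto simp: triv(3)[OF V] smooth_section_iff\<close>)
qed

lemma smooth_section_scaleR:
  assumes "smooth_fun A W F" "smooth_section A E W s"
  shows "smooth_section A E W (\<lambda>m. F m *\<^sub>R s m)"
  unfolding smooth_section_iff
proof safe
  fix m assume "m \<in> W" then show "F m *\<^sub>R s m \<in> fiber E m"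
    using assms by (auto simp: smooth_section_iff intro!: subspace_scale[OF subspace_fiber])
next
  fix V \<tau> assume V: "(V, \<tau>) \<in> trivs E"
  with assms have "smooth_fun A (V \<inter> W) (\<lambda>m. \<tau> m (s m))"
    by (auto simp: smooth_section_iff)
  from smooth_fun_scaleR[OF smooth_fun_subset[OF assms(1)] this]
  show "smooth_fun A (V \<inter> W) (\<lambda>m. \<tau> m (F m *\<^sub>R s m))"
  proof (rule smooth_fun_cong)
    show "F m *\<^sub>R \<tau> m (s m) = \<tau> m (F m *\<^sub>R s m)" if "m \<in> V \<inter> W" for m
      using that assms(2) triv(4)[OF V, of m "s m"] by (simp add: smooth_section_iff)
  qed simp
qed

lemma smooth_section_const_section:
  assumes "(V, \<tau>) \<in> trivs E"
  shows "smooth_section A E V (const_section E \<tau> w)"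
  unfolding smooth_section_iff
proof safe
  fix W \<sigma> assume "(W, \<sigma>) \<in> trivs E"
  moreover have "\<forall>(U, \<tau>)\<in>trivs E. \<forall>(V, \<sigma>)\<in>trivs E. \<forall>w.
      smooth_fun A (U \<inter> V) (\<lambda>m. \<sigma> m (const_section E \<tau> w m))"
    using vector_bundle by (simp add: vector_bundle_def)
  ultimately have "smooth_fun A (V \<inter> W) (\<lambda>m. \<sigma> m (const_section E \<tau> w m))"
    using assms by blast
  then show "smooth_fun A (W \<inter> V) (\<lambda>m. \<sigma> m (const_section E \<tau> w m))"
    by (simp add: Int_commute)
qed (rule triv_const_section[OF assms])

end

sublocale atlas \<subseteq> tangent: vec_bundle A "tangent_bundle A"
  by unfold_locales (rule vector_bundle_tangent_bundle)

lemma (in atlas) tangent_triv: "(U, c) \<in> A \<Longrightarrow> (U, differential A c) \<in> trivs (tangent_bundle A)"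
  using trivs_tangent_bundle by blast

section \<open>Connections in a local frame\<close>

locale connected_bundle = vec_bundle A E
  for A :: "('m::{t2_space,second_countable_topology}, 'a::euclidean_space) chart set"
    and E :: "('m, 'v::real_vector, 'f::euclidean_space) vbundle" +
  fixes T :: "real set" and N :: "real \<Rightarrow> 'm \<Rightarrow> 'a \<Rightarrow> ('m \<Rightarrow> 'v) \<Rightarrow> 'v"
  assumes connection: "connection A E T N"
begin

lemma connectionD:
  assumes "open W" "smooth_section A E W s" "t \<in> T" "m \<in> W"
  shows "linear (\<lambda>u. N t m u s)" "N t m u s \<in> fiber E m"
    "smooth_section A E W s' \<Longrightarrow> N t m u (\<lambda>p. s p + s' p) = N t m u s + N t m u s'"
    "smooth_fun A W F \<Longrightarrow> N t m u (\<lambda>p. F p *\<^sub>R s p) = differential A F m u *\<^sub>R s m + F m *\<^sub>R N t m u s"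
    "(\<And>p. p \<in> W \<Longrightarrow> s' p = s p) \<Longrightarrow> N t m u s' = N t m u s"
proof -
  note * = connection[unfolded connection_def, THEN spec, THEN spec, THEN mp, OF conjI, OF assms(1,2),
      THEN conjunct1, THEN bspec, OF assms(3), THEN bspec, OF assms(4)]
  show "linear (\<lambda>u. N t m u s)"
    by (rule *[THEN conjunct1])
  show "N t m u s \<in> fiber E m"
    by (rule *[THEN conjunct2, THEN conjunct1, THEN spec])
  show "N t m u (\<lambda>p. s p + s' p) = N t m u s + N t m u s'" if "smooth_section A E W s'"
    by (rule *[THEN conjunct2, THEN conjunct2, THEN conjunct1, THEN spec, THEN spec, THEN mp, OF that])
  show "N t m u (\<lambda>p. F p *\<^sub>R s p) = differential A F m u *\<^sub>R s m + F m *\<^sub>R N t m u s"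
    if "smooth_fun A W F"
    by (rule *[THEN conjunct2, THEN conjunct2, THEN conjunct2, THEN conjunct1, THEN spec, THEN spec,
          THEN mp, OF that])
  show "N t m u s' = N t m u s" if "\<And>p. p \<in> W \<Longrightarrow> s' p = s p"
    by (rule *[THEN conjunct2, THEN conjunct2, THEN conjunct2, THEN conjunct2, THEN spec, THEN spec,
          THEN mp]) (use that in blast)
qed

lemma connection_smooth:
  assumes "open W" "smooth_section A E W s" "smooth_section A (tangent_bundle A) W X"
  shows "smooth_section_family A E T W (\<lambda>t m. N t m (X m) s)"
  using connection[unfolded connection_def, THEN spec, THEN spec, THEN mp, OF conjI, OF assms(1,2),
      THEN conjunct2] assms(3) by simp

text \<open>Additivity and the product rule, by induction over the terms. Smoothness of the partial
  sums is carried along because additivity may only be applied to smooth sections.\<close>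

lemma connection_sum:
  assumes "open W" "finite I" "\<And>i. i \<in> I \<Longrightarrow> smooth_section A E W (s i)"
    "\<And>i. i \<in> I \<Longrightarrow> smooth_fun A W (F i)" "W \<noteq> {}" "t \<in> T" "m \<in> W"
  shows "smooth_section A E W (\<lambda>p. \<Sum>i\<in>I. F i p *\<^sub>R s i p) \<and> N t m u (\<lambda>p. \<Sum>i\<in>I. F i p *\<^sub>R s i p) =
    (\<Sum>i\<in>I. differential A (F i) m u *\<^sub>R s i m + F i m *\<^sub>R N t m u (s i))"
  using assms(2-4)
proof (induction I rule: finite_induct)
  case empty
  have z: "smooth_section A E W (\<lambda>_. 0)"
    unfolding smooth_section_iff
  proof safe
    fix V \<tau> assume "(V, \<tau>) \<in> trivs E"
    then show "smooth_fun A (V \<inter> W) (\<lambda>m. \<tau> m 0)"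
      by (intro smooth_fun_cong[OF smooth_fun_const[of _ 0]]) (simp add: triv_zero)
  qed (rule subspace_0[OF subspace_fiber])
  \<comment> \<open>The zero section is 0 times itself, so the product rule makes its covariant
    derivative vanish.\<close>
  with connectionD(4)[OF assms(1) z assms(6,7) smooth_fun_const[of W 0], of u] show ?case
    by (simp add: differential_const)
next
  case (insert i I)
  have s: "smooth_section A E W (\<lambda>p. F i p *\<^sub>R s i p)" "smooth_section A E W (\<lambda>p. \<Sum>i\<in>I. F i p *\<^sub>R s i p)"
    using insert by (auto intro: smooth_section_scaleR)
  have "N t m u (\<lambda>p. F i p *\<^sub>R s i p + (\<Sum>i\<in>I. F i p *\<^sub>R s i p)) =
      N t m u (\<lambda>p. F i p *\<^sub>R s i p) + N t m u (\<lambda>p. \<Sum>i\<in>I. F i p *\<^sub>R s i p)"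
    by (rule connectionD(3)[OF assms(1) s(1) assms(6,7) s(2)])
  also have "N t m u (\<lambda>p. F i p *\<^sub>R s i p) = differential A (F i) m u *\<^sub>R s i m + F i m *\<^sub>R N t m u (s i)"
    using insert.prems by (intro connectionD(4)[OF assms(1) _ assms(6,7)]) auto
  finally show ?case
    using insert smooth_section_add[OF s] by simp
qed

lemma connection_const_section_sum:
  assumes V: "(V, \<tau>) \<in> trivs E" and t: "t \<in> T" and m: "m \<in> V"
  shows "N t m u (const_section E \<tau> w) = (\<Sum>b\<in>Basis. (w \<bullet> b) *\<^sub>R N t m u (const_section E \<tau> b))"
proof -
  note V' = triv(1)[OF V] and c = smooth_section_const_section[OF V]
  have "N t m u (const_section E \<tau> w) = N t m u (\<lambda>p. \<Sum>b\<in>Basis. (w \<bullet> b) *\<^sub>R const_section E \<tau> b p)"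
    by (rule connectionD(5)[OF V' c t m, symmetric]) (rule const_section_sum[OF V, symmetric])
  also have "\<dots> = (\<Sum>b\<in>Basis. differential A (\<lambda>_. w \<bullet> b) m u *\<^sub>R const_section E \<tau> b m +
      (w \<bullet> b) *\<^sub>R N t m u (const_section E \<tau> b))"
    using m by (intro connection_sum[OF V' finite_Basis, THEN conjunct2]) (auto intro: c smooth_fun_const t)
  finally show ?thesis
    by (simp add: differential_const)
qed

text \<open>The section is expanded in the local frame of sections constant in
  \<open>\<tau>\<close>, and the product rule is applied: a connection is the derivative of the
  components plus the connection form. Applied to a section constant in another trivialization, this
  is the transformation law of connection forms.\<close>

lemma connection_triv:
  assumes V: "(V, \<tau>) \<in> trivs E" and W: "open W" "smooth_section A E W s"
    and t: "t \<in> T" and m: "m \<in> V" "m \<in> W"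
  shows "\<tau> m (N t m u s) =
    differential A (\<lambda>p. \<tau> p (s p)) m u + \<tau> m (N t m u (const_section E \<tau> (\<tau> m (s m))))"
proof -
  let ?W = "V \<inter> W" and ?c = "const_section E \<tau>"
  have W': "open ?W" "?W \<noteq> {}" "m \<in> ?W"
    using W triv(1)[OF V] m by auto
  have c: "smooth_section A E ?W (?c b)" for b
    using smooth_section_const_section[OF V] by (rule smooth_section_subset) auto
  have F: "smooth_fun A ?W (\<lambda>p. \<tau> p (s p))"
    using W(2) V by (auto simp: smooth_section_iff)
  have s: "smooth_section A E ?W s"
    using W(2) by (rule smooth_section_subset) auto
  have s_eq: "(\<Sum>b\<in>Basis. (\<tau> p (s p) \<bullet> b) *\<^sub>R ?c b p) = s p" if "p \<in> ?W" for p
    using const_section_sum[OF V, of p "\<tau> p (s p)"] triv_const_section(3)[OF V, of p "s p"] that W(2)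
    by (auto simp: smooth_section_iff)
  have fib: "?c b m \<in> fiber E m" "N t m u (?c b) \<in> fiber E m" for b
    using triv_const_section(1)[OF V m(1)] connectionD(2)[OF W'(1) c t W'(3)] by auto
  have fib': "a *\<^sub>R ?c b m \<in> fiber E m" "a *\<^sub>R N t m u (?c b) \<in> fiber E m" for b a
    using fib by (auto intro: subspace_scale[OF subspace_fiber])
  have "N t m u s = N t m u (\<lambda>p. \<Sum>b\<in>Basis. (\<tau> p (s p) \<bullet> b) *\<^sub>R ?c b p)"
    by (rule connectionD(5)[OF W'(1) s t W'(3) s_eq, symmetric])
  also have "\<dots> = (\<Sum>b\<in>Basis. differential A (\<lambda>p. \<tau> p (s p) \<bullet> b) m u *\<^sub>R ?c b m +
      (\<tau> m (s m) \<bullet> b) *\<^sub>R N t m u (?c b))"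
    by (rule connection_sum[OF W'(1) finite_Basis c smooth_fun_inner_left[OF F] W'(2) t W'(3), THEN conjunct2])
  finally have 1: "N t m u s = \<dots>" .
  note 2 = connection_const_section_sum[OF V t m(1)]
  have "\<tau> m (N t m u s) = (\<Sum>b\<in>Basis. differential A (\<lambda>p. \<tau> p (s p) \<bullet> b) m u *\<^sub>R b) +
      \<tau> m (N t m u (?c (\<tau> m (s m))))"
    unfolding 1 2[of u "\<tau> m (s m)"]
    by (simp add: triv_sum[OF V m(1)] triv(3,4)[OF V m(1)] fib fib' subspace_add[OF subspace_fiber]
        triv_const_section[OF V m(1)] sum.distrib[symmetric])
  then show ?thesis
    by (simp add: differential_inner[OF F W'(1,3)] euclidean_representation)
qed

lemma connection_const_section:
  assumes V: "(V, \<tau>) \<in> trivs E" and t: "t \<in> T" and m: "m \<in> V"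
  shows "linear (\<lambda>w. \<tau> m (N t m u (const_section E \<tau> w)))"
proof -
  let ?c = "const_section E \<tau>"
  have fib: "N t m u (?c b) \<in> fiber E m" for b
    using connectionD(2)[OF triv(1)[OF V] smooth_section_const_section[OF V] t m] .
  have eq: "\<tau> m (N t m u (?c w)) = (\<Sum>b\<in>Basis. (w \<bullet> b) *\<^sub>R \<tau> m (N t m u (?c b)))" for w
    unfolding connection_const_section_sum[OF V t m, of u w] using fib
    by (simp add: triv_sum[OF V m] triv(4)[OF V m] subspace_scale[OF subspace_fiber])
  have "linear (\<lambda>w :: 'f. \<Sum>b\<in>Basis. (w \<bullet> b) *\<^sub>R k b)" for k :: "'f \<Rightarrow> 'f"
    by (auto intro!: linearI simp: inner_add_left scaleR_add_left sum.distrib scaleR_sum_right)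
  from this[of "\<lambda>b. \<tau> m (N t m u (?c b))"] show ?thesis
    by (rule back_subst[of linear]) (rule ext, rule eq[symmetric])
qed

end

lemma (in vec_bundle) smooth_section_family_slice:
  assumes "smooth_section_family A E P W s" "p \<in> P"
  shows "smooth_section A E W (s p)"
  unfolding smooth_section_iff
proof safe
  fix V \<tau> assume V: "(V, \<tau>) \<in> trivs E"
  show "smooth_fun A (V \<inter> W) (\<lambda>m. \<tau> m (s p m))"
    unfolding smooth_fun_iff
  proof safe
    fix U c assume "(U, c) \<in> A"
    with assms(1) V have "smooth_on (P \<times> c ` (U \<inter> (V \<inter> W)))
        (\<lambda>(p, x). \<tau> (inv_into U c x) (s p (inv_into U c x)))"
      by (auto simp: smooth_section_family_def smooth_family_def)
    from smooth_on_slice[OF this assms(2)]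
    show "smooth_on (c ` (U \<inter> (V \<inter> W))) ((\<lambda>m. \<tau> m (s p m)) \<circ> inv_into U c)"
      by (simp add: o_def)
  qed
qed (use assms in \<open>auto simp: smooth_section_family_def\<close>)

section \<open>Coordinate expressions in one chart and one trivialization\<close>

locale trivialized = connected_bundle A E T N
  for A :: "('m::{t2_space,second_countable_topology}, 'a::euclidean_space) chart set"
    and E :: "('m, 'v::real_vector, 'f::euclidean_space) vbundle"
    and T :: "real set" and N :: "real \<Rightarrow> 'm \<Rightarrow> 'a \<Rightarrow> ('m \<Rightarrow> 'v) \<Rightarrow> 'v" +
  fixes U :: "'m set" and c :: "'m \<Rightarrow> 'a" and V :: "'m set" and \<tau> :: "'m \<Rightarrow> 'v \<Rightarrow> 'f"
  assumes U: "(U, c) \<in> A" and V: "(V, \<tau>) \<in> trivs E"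
begin

abbreviation ci :: "'a \<Rightarrow> 'm" where "ci \<equiv> inv_into U c"

definition dom :: "'a set" where "dom = c ` (U \<inter> V)"

text \<open>The connection form: \<open>coef t x e\<close> is the matrix A(e) in the coordinate
  expression \<partial>_e + A(e) of the covariant derivative, which is \<open>covd\<close>. For the
  tangent bundle the coefficients are the Christoffel symbols.\<close>

definition coef :: "real \<Rightarrow> 'a \<Rightarrow> 'a \<Rightarrow> 'f \<Rightarrow> 'f" where
  "coef t x e w = \<tau> (ci x) (N t (ci x) (frame c e (ci x)) (const_section E \<tau> w))"

definition rep :: "('m \<Rightarrow> 'v) \<Rightarrow> 'a \<Rightarrow> 'f" where
  "rep s x = \<tau> (ci x) (s (ci x))"

definition covd :: "real \<Rightarrow> ('m \<Rightarrow> 'v) \<Rightarrow> 'a \<Rightarrow> 'a \<Rightarrow> 'f" where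
  "covd t s x e = frechet_derivative (rep s) (at x) e + coef t x e (rep s x)"

lemma open_dom: "open dom"
  unfolding dom_def by (rule open_chart_image[OF U triv(1)[OF V]])

lemma open_UV: "open (U \<inter> V)"
  using chart(1)[OF U] triv(1)[OF V] by (rule open_Int)

lemma dom:
  assumes "x \<in> dom"
  shows "ci x \<in> U" "ci x \<in> V" "c (ci x) = x"
  using assms chart(5)[OF U] by (auto simp: dom_def)

lemma dom_image: "m \<in> U \<Longrightarrow> m \<in> V \<Longrightarrow> c m \<in> dom"
  by (auto simp: dom_def)

lemma smooth_section_frame: "smooth_section A (tangent_bundle A) U (frame c e)"
  by (rule tangent.smooth_section_const_section[OF tangent_triv[OF U]])

lemma linear_frame:
  assumes "m \<in> U"
  shows "linear (\<lambda>e. frame c e m)"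
proof -
  have "(snd (chart_at A m) \<circ> ci) differentiable at (c m)"
    using smooth_fun_differentiable[OF smooth_fun_coordinate[OF chart_at(1)] _ U assms]
      chart(1)[OF chart_at(1)] chart_at(2) by auto
  then show ?thesis
    unfolding frame_eq[OF U assms] by (rule linear_frechet_derivative)
qed

lemma linear_coef:
  assumes "t \<in> T" "x \<in> dom"
  shows "linear (coef t x e)"
  unfolding coef_def using connection_const_section[OF V assms(1)] dom[OF assms(2)] by blast

lemma linear_coef_direction:
  assumes "t \<in> T" "x \<in> dom"
  shows "linear (\<lambda>e. coef t x e w)"
proof -
  let ?s = "const_section E \<tau> w"
  note s = smooth_section_const_section[OF V]
  have "linear (\<lambda>u. N t (ci x) u ?s)"
    by (rule connectionD(1)[OF triv(1)[OF V] s assms(1) dom(2)[OF assms(2)]])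
  note N = linear_add[OF this] linear_scale[OF this]
  have fib: "N t (ci x) u ?s \<in> fiber E (ci x)" for u
    by (rule connectionD(2)[OF triv(1)[OF V] s assms(1) dom(2)[OF assms(2)]])
  note lf = linear_frame[OF dom(1)[OF assms(2)]]
  show ?thesis
    unfolding coef_def
    by (auto intro!: linearI simp: linear_add[OF lf] linear_scale[OF lf] N fib triv(3,4)[OF V dom(2)[OF assms(2)]])
qed

lemma smooth_family_rep:
  assumes "smooth_section_family A E P W s"
  shows "smooth_on (P \<times> c ` (U \<inter> (V \<inter> W))) (\<lambda>(p, x). rep (s p) x)"
  using assms U V unfolding smooth_section_family_def smooth_family_def rep_def by fast

lemma smooth_family_rep_dom:
  assumes "smooth_section_family A E P W s" "U \<inter> V \<subseteq> W"
  shows "smooth_on (P \<times> dom) (\<lambda>(p, x). rep (s p) x)"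
  using smooth_family_rep[OF assms(1)] by (rule smooth_on_subset) (use assms(2) in \<open>auto simp: dom_def\<close>)

lemma smooth_rep:
  assumes "smooth_section A E W s"
  shows "smooth_on (c ` (U \<inter> (V \<inter> W))) (rep s)"
  using smooth_on_slice[OF smooth_family_rep[OF assms[unfolded smooth_section_def]], of 0] by simp

lemma smooth_rep_dom:
  assumes "smooth_section A E W s" "U \<inter> V \<subseteq> W"
  shows "smooth_on dom (rep s)"
  using smooth_rep[OF assms(1)] by (rule smooth_on_subset) (use assms(2) in \<open>auto simp: dom_def\<close>)

lemma smooth_coef: "smooth_on (T \<times> dom) (\<lambda>(t, x). coef t x e w)"
proof -
  have "smooth_section_family A E T (U \<inter> V) (\<lambda>t m. N t m (frame c e m) (const_section E \<tau> w))"
    by (rule connection_smooth[OF open_UV smooth_section_subset[OF smooth_section_const_section[OF V]]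
          tangent.smooth_section_subset[OF smooth_section_frame]]) auto
  from smooth_family_rep_dom[OF this] show ?thesis
    by (simp add: rep_def coef_def)
qed

lemma connection_rep:
  assumes W: "open W" "smooth_section A E W s" and t: "t \<in> T" and m: "m \<in> U" "m \<in> V" "m \<in> W"
  shows "\<tau> m (N t m u s) = covd t s (c m) (differential A c m u)"
proof -
  have "differential A (\<lambda>p. \<tau> p (s p)) m u = frechet_derivative (rep s) (at (c m)) (differential A c m u)"
  proof -
    have "smooth_fun A (V \<inter> W) (\<lambda>p. \<tau> p (s p))"
      using W(2) V unfolding smooth_section_iff by blast
    from differential_eq[OF this open_Int[OF triv(1)[OF V] W(1)] U m(1)] m(2,3)
    show ?thesis
      by (simp add: rep_def[abs_def] o_def)
  qed
  moreover have "coef t (c m) (differential A c m u) (rep s (c m)) =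
      \<tau> m (N t m u (const_section E \<tau> (\<tau> m (s m))))"
    by (simp add: coef_def rep_def chart(5)[OF U m(1)] frame_differential[OF U m(1)])
  ultimately show ?thesis
    using connection_triv[OF V W t m(2,3)] by (simp add: covd_def)
qed

lemma linear_covd:
  assumes "smooth_section A E W s" "open W" "t \<in> T" "x \<in> dom" "ci x \<in> W"
  shows "linear (covd t s x)"
proof -
  have "rep s differentiable at x"
    using dom[OF assms(4)] assms(5) open_chart_image[OF U] assms(2) triv(1)[OF V]
    by (intro smooth_on_differentiable[OF smooth_rep[OF assms(1)]]) (auto simp: image_iff intro!: bexI[of _ "ci x"])
  then have "linear (frechet_derivative (rep s) (at x))"
    by (rule linear_frechet_derivative)
  with linear_coef_direction[OF assms(3,4)] show ?thesis
    unfolding covd_def by (intro linear_compose_add)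
qed

lemma smooth_covd:
  assumes "smooth_section A E UNIV s" "t \<in> T"
  shows "smooth_on dom (\<lambda>x. covd t s x e)"
proof -
  have "smooth_section_family A E T U (\<lambda>t m. N t m (frame c e m) s)"
    by (rule connection_smooth[OF chart(1)[OF U] smooth_section_subset[OF assms(1)] smooth_section_frame]) auto
  from smooth_section_family_slice[OF this assms(2)]
  have "smooth_on dom (rep (\<lambda>m. N t m (frame c e m) s))"
    by (rule smooth_rep_dom) auto
  then show ?thesis
    using connection_rep[OF open_UNIV assms] dom differential_frame[OF U]
    by (elim smooth_on_cong) (simp add: rep_def)
qed

text \<open>The coordinate formula for the second covariant derivative: with D for
  \<open>covd\<close> and \<Gamma> for the coefficients of \<open>NT\<close>, it is \<partial>_e
  (D_e s) + A(e) D_e s - D_w s, where w = \<Gamma>(e, e).\<close>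

lemma form_connection_rep:
  fixes v :: 'a
  assumes NT: "connection A (tangent_bundle A) UNIV (\<lambda>_. NT)"
    and s: "smooth_section A E UNIV s" and t: "t \<in> T" and m: "m \<in> U" "m \<in> V"
  defines "e \<equiv> differential A c m v" and "x \<equiv> c m"
  shows "form_connection A NT (N t) (\<lambda>p u. N t p u s) m v v \<in> fiber E m"
    and "\<tau> m (form_connection A NT (N t) (\<lambda>p u. N t p u s) m v v) =
      frechet_derivative (\<lambda>y. covd t s y e) (at x) e + coef t x e (covd t s x e) -
      covd t s x (trivialized.coef A (tangent_bundle A) (\<lambda>_. NT) U c (differential A c) 0 x e e)"
proof -
  interpret NT: trivialized A "tangent_bundle A" UNIV "\<lambda>_. NT" U c U "differential A c"
    using NT U tangent_triv[OF U] by unfold_locales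
  define K k where "K = fst (chart_at A m)" and "k = snd (chart_at A m)"
  have K: "(K, k) \<in> A" "m \<in> K"
    using chart_at by (auto simp: K_def k_def)
  note K' = chart(1)[OF K(1)]
  \<comment> \<open>The extension of \<open>v\<close> prescribed by \<open>extend_vector\<close>. It
    has constant components in the chart chosen at \<open>m\<close>, but its components
    \<open>G\<close> in the chart \<open>c\<close> vary.\<close>
  define F where "F = frame k v"
  have F_smooth: "smooth_section A (tangent_bundle A) K F"
    unfolding F_def by (rule tangent.smooth_section_const_section[OF tangent_triv[OF K(1)]])
  have "differential A k m v = v"
    unfolding differential_chart_at using frechet_derivative_chart_id[OF K] by (simp add: K_def k_def)
  then have Fm: "F m = v"
    using frame_differential[OF K, of v] by (simp add: F_def)
  define \<sigma> where "\<sigma> p = N t p (F p) s" for p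
  have \<sigma>: "smooth_section A E K \<sigma>"
    using smooth_section_family_slice[OF connection_smooth[OF K' smooth_section_subset[OF s] F_smooth] t]
    by (simp add: \<sigma>_def[abs_def])
  have fc: "form_connection A NT (N t) (\<lambda>p u. N t p u s) m v v = N t m v \<sigma> - N t m (NT m v F) s"
    by (simp add: form_connection_def extend_vector_def \<sigma>_def[abs_def] F_def k_def Let_def)
  have fib: "N t m v \<sigma> \<in> fiber E m" "N t m (NT m v F) s \<in> fiber E m"
    using connectionD(2)[OF K' \<sigma> t K(2)] connectionD(2)[OF open_UNIV s t] by auto
  then show "form_connection A NT (N t) (\<lambda>p u. N t p u s) m v v \<in> fiber E m"
    unfolding fc by (rule subspace_diff[OF subspace_fiber])
  have x: "x \<in> dom" "ci x = m"
    using dom_image[OF m] chart(5)[OF U m(1)] by (auto simp: x_def)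
  define D where "D y = covd t s y" for y
  have linD: "linear (D y)" if "y \<in> dom" for y
    unfolding D_def using linear_covd[OF s open_UNIV t that] by simp
  have D_eq: "D y w = (\<Sum>b\<in>Basis. (w \<bullet> b) *\<^sub>R D y b)" if "y \<in> dom" for y w
    by (rule linear_Basis_sum[OF linD[OF that]])
  have dD: "((\<lambda>y. D y b) has_derivative frechet_derivative (\<lambda>y. D y b) (at x)) (at x)" for b
    using smooth_on_differentiable[OF smooth_covd[OF s t] open_dom x(1)]
    unfolding D_def by (rule frechet_derivative_worksI)
  define G where "G = NT.rep F"
  have oK: "open (c ` (U \<inter> (V \<inter> K)))" "x \<in> c ` (U \<inter> (V \<inter> K))"
    using open_chart_image[OF U] triv(1)[OF V] K' m K(2) by (auto simp: x_def)
  have "G differentiable at x"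
    unfolding G_def using open_chart_image[OF U, of "U \<inter> K"] chart(1)[OF U] K' m(1) K(2)
    by (intro smooth_on_differentiable[OF NT.smooth_rep[OF F_smooth]]) (auto simp: x_def)
  then have dG: "(G has_derivative frechet_derivative G (at x)) (at x)"
    by (rule frechet_derivative_worksI)
  have Gx: "G x = e"
    by (simp add: G_def NT.rep_def x(2) Fm e_def)
  have 1: "rep \<sigma> y = (\<Sum>b\<in>Basis. (G y \<bullet> b) *\<^sub>R D y b)" if "y \<in> c ` (U \<inter> (V \<inter> K))" for y
  proof -
    have y: "y \<in> dom"
      using that by (auto simp: dom_def)
    have "rep \<sigma> y = covd t s y (G y)"
      using connection_rep[OF open_UNIV s t dom(1,2)[OF y]] dom(3)[OF y]
      by (simp add: rep_def \<sigma>_def G_def NT.rep_def)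
    then show ?thesis
      using D_eq[OF y, of "G y"] by (simp add: D_def)
  qed
  have 2: "((\<lambda>y. \<Sum>b\<in>Basis. (H y \<bullet> b) *\<^sub>R D y b) has_derivative
      (\<lambda>h. D x (H' h) + (\<Sum>b\<in>Basis. (H x \<bullet> b) *\<^sub>R frechet_derivative (\<lambda>y. D y b) (at x) h))) (at x)"
    if "(H has_derivative H') (at x)" for H H'
  proof -
    have "((\<lambda>y. \<Sum>b\<in>Basis. (H y \<bullet> b) *\<^sub>R D y b) has_derivative
      (\<lambda>h. \<Sum>b\<in>Basis. (H x \<bullet> b) *\<^sub>R frechet_derivative (\<lambda>y. D y b) (at x) h + (H' h \<bullet> b) *\<^sub>R D x b)) (at x)"
      by (intro has_derivative_sum has_derivative_scaleR has_derivative_inner_left dD that)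
    then show ?thesis
      unfolding sum.distrib D_eq[OF x(1), symmetric] by (simp add: add.commute)
  qed
  have d\<sigma>: "(rep \<sigma> has_derivative (\<lambda>h. D x (frechet_derivative G (at x) h) +
      (\<Sum>b\<in>Basis. (e \<bullet> b) *\<^sub>R frechet_derivative (\<lambda>y. D y b) (at x) h))) (at x)"
    using has_derivative_transform_within_open[OF 2[OF dG] oK 1[symmetric]] unfolding Gx by simp
  have De: "((\<lambda>y. D y e) has_derivative (\<lambda>h. D x 0 +
      (\<Sum>b\<in>Basis. (e \<bullet> b) *\<^sub>R frechet_derivative (\<lambda>y. D y b) (at x) h))) (at x)"
    using has_derivative_transform_within_open[OF 2[OF has_derivative_const] open_dom x(1) D_eq[symmetric]] .
  have "frechet_derivative (rep \<sigma>) (at x) e = D x (frechet_derivative G (at x) e) +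
      frechet_derivative (\<lambda>y. D y e) (at x) e"
    unfolding frechet_derivative_at[OF d\<sigma>, symmetric] frechet_derivative_at[OF De, symmetric]
    using linD[OF x(1)] by (simp add: linear_0)
  moreover have "rep \<sigma> x = D x e"
    using 1[OF oK(2)] Gx D_eq[OF x(1), of e] by simp
  moreover have "\<tau> m (N t m v \<sigma>) = covd t \<sigma> x e"
    using connection_rep[OF K' \<sigma> t m K(2)] by (simp add: x_def e_def)
  ultimately have 3: "\<tau> m (N t m v \<sigma>) = D x (frechet_derivative G (at x) e) +
      frechet_derivative (\<lambda>y. D y e) (at x) e + coef t x e (D x e)"
    by (simp add: covd_def)
  \<comment> \<open>The derivative of the components \<open>G\<close> occurs here and in the
    derivative of \<open>\<sigma>\<close>; the two contributions cancel, which is why the result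
    does not see the extension.\<close>
  have "differential A c m (NT m v F) = frechet_derivative G (at x) e + NT.coef 0 x e e"
    using NT.connection_rep[OF K' F_smooth _ m(1,1) K(2), of 0 v] Gx
    by (simp add: NT.covd_def G_def x_def e_def)
  then have "\<tau> m (N t m (NT m v F) s) = D x (frechet_derivative G (at x) e + NT.coef 0 x e e)"
    using connection_rep[OF open_UNIV s t m] by (simp add: D_def x_def)
  with 3 show "\<tau> m (form_connection A NT (N t) (\<lambda>p u. N t p u s) m v v) =
      frechet_derivative (\<lambda>y. covd t s y e) (at x) e + coef t x e (covd t s x e) -
      covd t s x (NT.coef 0 x e e)"
    unfolding fc triv_diff[OF V m(2) fib] using linear_add[OF linD[OF x(1)]] by (simp add: D_def)
qed

text \<open>A solution of \<open>z' = - A(e) z\<close> over a coordinate segment is a parallel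
  section along a smooth curve, so invariance of X applies to it. The work lies in the definitions:
  the curve has to be smooth in every chart, and the section parallel in every trivialization, not
  only in \<open>\<tau>\<close>.\<close>

lemma transport_along_line:
  assumes inv: "parallel_transport_invariant A E (N t) X" and t: "t \<in> T" and S: "0 < S"
    and line: "\<And>r. r \<in> {0..S} \<Longrightarrow> x + r *\<^sub>R e \<in> dom"
    and z: "\<And>r. r \<in> {0..S} \<Longrightarrow>
      (z has_vector_derivative - coef t (x + r *\<^sub>R e) e (z r)) (at r within {0..S})"
    and X: "(ci x, const_section E \<tau> (z 0) (ci x)) \<in> X"
  shows "(ci (x + S *\<^sub>R e), const_section E \<tau> (z S) (ci (x + S *\<^sub>R e))) \<in> X"
proof -
  define l where "l r = x + r *\<^sub>R e" for r :: real
  define \<gamma> where "\<gamma> r = ci (l r)" for r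
  define s where "s r = const_section E \<tau> (z r) (\<gamma> r)" for r
  have dl: "(l has_vector_derivative e) F" for F
    unfolding l_def has_vector_derivative_def by (auto intro!: derivative_eq_intros)
  have l_smooth: "smooth_on I l" for I
  proof -
    have "linear (\<lambda>r :: real. r *\<^sub>R e)"
      by (simp add: linear_scaleR_left)
    then show ?thesis
      unfolding l_def by (intro smooth_on_add smooth_on_const smooth_on_linear)
  qed
  have \<gamma>: "\<gamma> r \<in> U" "\<gamma> r \<in> V" "c (\<gamma> r) = l r" "l r \<in> dom" if "r \<in> {0..S}" for r
    using dom[OF line[OF that]] line[OF that] by (auto simp: \<gamma>_def l_def)
  have \<gamma>_cont: "continuous_on {0..S} \<gamma>"
    unfolding \<gamma>_def
  proof (rule continuous_on_compose2[OF chart(4)[OF U]])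
    show "continuous_on {0..S} l"
      by (rule smooth_on_imp_continuous_on[OF l_smooth])
    show "l ` {0..S} \<subseteq> c ` U"
      using \<gamma>(1,3) by (metis image_eqI image_subsetI)
  qed
  have curve: "smooth_curve A {0..S} \<gamma>"
    unfolding smooth_curve_def
  proof (intro conjI \<gamma>_cont, safe)
    fix U' c' assume U': "(U', c') \<in> A"
    have "smooth_on {r \<in> {0..S}. \<gamma> r \<in> U'} ((c' \<circ> ci) \<circ> l)"
    proof (rule smooth_on_compose[OF smooth_fun_chart[OF smooth_fun_coordinate[OF U'] U] l_smooth])
      show "l ` {r \<in> {0..S}. \<gamma> r \<in> U'} \<subseteq> c ` (U \<inter> U')"
        using \<gamma>(1,3) by (auto simp: image_iff) (metis IntI atLeastAtMost_iff)
    qed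
    then show "smooth_on {r \<in> {0..S}. \<gamma> r \<in> U'} (c' \<circ> \<gamma>)"
      by (simp add: \<gamma>_def o_def)
  qed
  have parallel: "parallel_along A E (N t) \<gamma> s {0..S}"
    unfolding parallel_along_def has_covariant_derivative_along_def
  proof (intro ballI conjI, safe)
    fix r assume r: "r \<in> {0..S}"
    show "s r \<in> fiber E (\<gamma> r)"
      unfolding s_def by (rule triv_const_section[OF V \<gamma>(2)[OF r]])
    fix V' \<tau>' assume V': "(V', \<tau>') \<in> trivs E" "\<gamma> r \<in> V'"
    let ?m = "\<gamma> r" and ?u = "frame c e (\<gamma> r)"
    \<comment> \<open>\<open>velocity\<close> is read in the chart chosen at
      \<open>\<gamma> r\<close>, where the coordinate vector field of \<open>c\<close> has the
      derivative of the coordinate change as its value.\<close>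
    have vel: "velocity A \<gamma> r {0..S} = ?u"
    proof -
      let ?K = "fst (chart_at A ?m)" and ?k = "snd (chart_at A ?m)"
      have "(?k \<circ> ci) differentiable at (l r)"
        using smooth_fun_differentiable[OF smooth_fun_coordinate[OF chart_at(1)] _ U \<gamma>(1)[OF r]]
          chart(1)[OF chart_at(1)] chart_at(2) \<gamma>(3)[OF r] by auto
      then have "((?k \<circ> ci) has_derivative frechet_derivative (?k \<circ> ci) (at (l r))) (at (l r))"
        by (rule frechet_derivative_worksI)
      from vector_derivative_diff_chain_within[of l e r UNIV, OF dl has_derivative_at_withinI[OF this]]
      have "((?k \<circ> \<gamma>) has_vector_derivative ?u) (at r)"
        using frame_eq[OF U \<gamma>(1)[OF r]] \<gamma>(3)[OF r] by (simp add: \<gamma>_def o_def)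
      then show ?thesis
        unfolding velocity_def using r S by (intro vector_derivative_at_within_ivl) auto
    qed
    let ?w = "z r" and ?c = "const_section E \<tau>"
    \<comment> \<open>\<open>G b\<close> holds the \<open>\<tau>'\<close> components of the frame of
      \<open>\<tau>\<close>. The section is a combination of this frame with coefficients
      \<open>z q \<bullet> b\<close>, which reduces its derivative in \<open>\<tau>'\<close> to the
      known equation for \<open>z\<close>.\<close>
    define G where "G b p = \<tau>' p (?c b p)" for b p
    have G: "smooth_fun A (V' \<inter> V) (G b)" for b
      using smooth_section_const_section[OF V] V' unfolding G_def smooth_section_iff by blast
    have VV: "open (V' \<inter> V)" "?m \<in> V' \<inter> V"
      using triv(1)[OF V] triv(1)[OF V'(1)] V'(2) \<gamma>(2)[OF r] by auto
    have dG: "((G b \<circ> \<gamma>) has_vector_derivative differential A (G b) ?m ?u) (at r within {0..S})" for b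
    proof -
      have "((G b \<circ> ci) has_derivative frechet_derivative (G b \<circ> ci) (at (l r))) (at (l r))"
        using smooth_fun_differentiable[OF G VV(1) U \<gamma>(1)[OF r] VV(2)] \<gamma>(3)[OF r]
        by (intro frechet_derivative_worksI) simp
      from vector_derivative_diff_chain_within[of l e r "{0..S}", OF dl has_derivative_at_withinI[OF this]]
      show ?thesis
        using differential_eq[OF G VV(1) U \<gamma>(1)[OF r] VV(2)] \<gamma>(3)[OF r]
          differential_frame[OF U \<gamma>(1)[OF r]]
        by (simp add: \<gamma>_def o_def)
    qed
    have G_sum: "G w p = (\<Sum>b\<in>Basis. (w \<bullet> b) *\<^sub>R G b p)" if "p \<in> V' \<inter> V" for w p
    proof -
      have p: "p \<in> V'" "p \<in> V" using that by auto
      have fib: "?c b p \<in> fiber E p" for b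
        by (rule triv_const_section[OF V p(2)])
      show ?thesis
        unfolding G_def const_section_sum[OF V p(2), of w]
        by (simp add: triv_sum[OF V'(1) p(1)] triv(4)[OF V'(1) p(1)] fib subspace_scale[OF subspace_fiber])
    qed
    let ?z' = "- coef t (l r) e ?w"
    have "((\<lambda>q. \<Sum>b\<in>Basis. (z q \<bullet> b) *\<^sub>R G b (\<gamma> q)) has_vector_derivative
        (\<Sum>b\<in>Basis. (?w \<bullet> b) *\<^sub>R differential A (G b) ?m ?u + (?z' \<bullet> b) *\<^sub>R G b ?m)) (at r within {0..S})"
    proof (rule has_vector_derivative_sum)
      fix b :: 'f
      have "((\<lambda>q. z q \<bullet> b) has_real_derivative ?z' \<bullet> b) (at r within {0..S})"
        using bounded_linear.has_vector_derivative[OF bounded_linear_inner_left z[OF r]]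
        by (simp add: l_def has_real_derivative_iff_has_vector_derivative)
      from has_vector_derivative_scaleR[OF this dG[of b]]
      show "((\<lambda>q. (z q \<bullet> b) *\<^sub>R G b (\<gamma> q)) has_vector_derivative
          (?w \<bullet> b) *\<^sub>R differential A (G b) ?m ?u + (?z' \<bullet> b) *\<^sub>R G b ?m) (at r within {0..S})"
        by (simp add: o_def)
    qed
    moreover have "(\<Sum>b\<in>Basis. (?w \<bullet> b) *\<^sub>R differential A (G b) ?m ?u) = differential A (G ?w) ?m ?u"
    proof -
      have "((G b \<circ> ci) has_derivative frechet_derivative (G b \<circ> ci) (at (l r))) (at (l r))" for b
        using smooth_fun_differentiable[OF G VV(1) U \<gamma>(1)[OF r] VV(2)] \<gamma>(3)[OF r]
        by (intro frechet_derivative_worksI) simp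
      then have "((\<lambda>y. \<Sum>b\<in>Basis. (?w \<bullet> b) *\<^sub>R (G b \<circ> ci) y) has_derivative
          (\<lambda>h. \<Sum>b\<in>Basis. (?w \<bullet> b) *\<^sub>R frechet_derivative (G b \<circ> ci) (at (l r)) h)) (at (l r))"
        by (intro has_derivative_sum has_derivative_scaleR_right)
      then have "((G ?w \<circ> ci) has_derivative
          (\<lambda>h. \<Sum>b\<in>Basis. (?w \<bullet> b) *\<^sub>R frechet_derivative (G b \<circ> ci) (at (l r)) h)) (at (l r))"
      proof (rule has_derivative_transform_within_open)
        show "open (c ` (U \<inter> (V' \<inter> V)))" "l r \<in> c ` (U \<inter> (V' \<inter> V))"
          using open_chart_image[OF U VV(1)] VV(2) \<gamma>(1,3)[OF r] by (auto intro!: rev_image_eqI[of ?m])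
        show "(\<Sum>b\<in>Basis. (?w \<bullet> b) *\<^sub>R (G b \<circ> ci) y) = (G ?w \<circ> ci) y"
          if "y \<in> c ` (U \<inter> (V' \<inter> V))" for y
          using G_sum[of "ci y" ?w] that chart(5)[OF U] by auto
      qed
      from fun_cong[OF frechet_derivative_at[OF this], of "differential A c ?m ?u"]
      show ?thesis
        unfolding differential_eq[OF G VV(1) U \<gamma>(1)[OF r] VV(2)] \<gamma>(3)[OF r] .
    qed
    ultimately have sum: "((\<lambda>q. \<Sum>b\<in>Basis. (z q \<bullet> b) *\<^sub>R G b (\<gamma> q)) has_vector_derivative
        differential A (G ?w) ?m ?u + G ?z' ?m) (at r within {0..S})"
      unfolding sum.distrib G_sum[OF VV(2), of ?z'] by simp
    \<comment> \<open>This is the transformation law of the connection form between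
      \<open>\<tau>\<close> and \<open>\<tau>'\<close>.\<close>
    have eq: "differential A (G ?w) ?m ?u + G ?z' ?m =
        \<tau>' ?m (0 - N t ?m (velocity A \<gamma> r {0..S}) (const_section E \<tau>' (\<tau>' ?m (s r))))"
    proof -
      let ?n = "N t ?m ?u (?c ?w)"
      have n: "?n \<in> fiber E ?m"
        by (rule connectionD(2)[OF triv(1)[OF V] smooth_section_const_section[OF V] t \<gamma>(2)[OF r]])
      have 1: "\<tau>' ?m ?n = differential A (G ?w) ?m ?u +
          \<tau>' ?m (N t ?m ?u (const_section E \<tau>' (\<tau>' ?m (s r))))"
        using connection_triv[OF V'(1) triv(1)[OF V] smooth_section_const_section[OF V] t V'(2) \<gamma>(2)[OF r]]
        by (simp add: G_def[abs_def] s_def)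
      have "coef t (l r) e ?w = \<tau> ?m ?n"
        by (simp add: coef_def \<gamma>_def)
      then have "?c ?z' ?m = ?c (\<tau> ?m (- ?n)) ?m"
        by (simp add: triv_uminus[OF V \<gamma>(2)[OF r] n])
      also have "\<dots> = - ?n"
        using n by (intro triv_const_section(3)[OF V \<gamma>(2)[OF r]] subspace_neg[OF subspace_fiber])
      finally have "G ?z' ?m = - \<tau>' ?m ?n"
        by (simp add: G_def triv_uminus[OF V' n])
      moreover have "N t ?m ?u (const_section E \<tau>' (\<tau>' ?m (s r))) \<in> fiber E ?m"
        by (rule connectionD(2)[OF triv(1)[OF V'(1)] smooth_section_const_section[OF V'(1)] t V'(2)])
      ultimately show ?thesis
        using 1 by (simp add: vel triv_uminus[OF V'])
    qed
    \<comment> \<open>The trivialization \<open>\<tau>'\<close> covers the curve only near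
      \<open>r\<close>, so the expansion in the frame is available only there.\<close>
    obtain d where d: "0 < d" "\<And>q. q \<in> {0..S} \<Longrightarrow> dist q r < d \<Longrightarrow> \<gamma> q \<in> V'"
    proof -
      have "\<forall>\<^sub>F q in at r within {0..S}. \<gamma> q \<in> V'"
        using \<gamma>_cont r V'(2) triv(1)[OF V'(1)]
        by (auto simp: continuous_on_def intro: topological_tendstoD)
      then obtain d where d: "0 < d" "\<forall>q\<in>{0..S}. q \<noteq> r \<and> dist q r < d \<longrightarrow> \<gamma> q \<in> V'"
        by (auto simp: eventually_at)
      show ?thesis
      proof (rule that[OF d(1)])
        show "\<gamma> q \<in> V'" if "q \<in> {0..S}" "dist q r < d" for q
          using d(2) that V'(2)
          by (cases "q = r") auto
      qed
    qed
    show "((\<lambda>q. \<tau>' (\<gamma> q) (s q)) has_vector_derivative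
        \<tau>' ?m (0 - N t ?m (velocity A \<gamma> r {0..S}) (const_section E \<tau>' (\<tau>' ?m (s r))))) (at r within {0..S})"
    proof (rule has_vector_derivative_transform_within[OF sum[unfolded eq] d(1) r])
      show "(\<Sum>b\<in>Basis. (z q \<bullet> b) *\<^sub>R G b (\<gamma> q)) = \<tau>' (\<gamma> q) (s q)"
        if "q \<in> {0..S}" "dist q r < d" for q
        using G_sum[of "\<gamma> q" "z q"] d(2)[OF that] \<gamma>(2)[OF that(1)] by (simp add: G_def s_def)
    qed
  qed
  have start: "(\<gamma> 0, s 0) \<in> X"
    using X by (simp add: s_def \<gamma>_def l_def)
  note inv' = inv[unfolded parallel_transport_invariant_def, THEN spec[of _ 0], THEN spec[of _ S],
      THEN spec[of _ \<gamma>], THEN spec[of _ s]]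
  have "(\<gamma> S, s S) \<in> X"
    by (rule inv'[THEN mp]) (intro conjI S curve parallel start)
  then show ?thesis
    by (simp add: s_def \<gamma>_def l_def)
qed

end

section \<open>The flow in a coordinate box\<close>

lemma bilinear_family_bound:
  fixes \<beta> :: "'p \<Rightarrow> 'x::euclidean_space \<Rightarrow> 'y::euclidean_space \<Rightarrow> 'z::real_normed_vector"
  assumes bil: "\<And>p. p \<in> K \<Longrightarrow> bilinear (\<beta> p)"
    and bdd: "\<And>i j. i \<in> Basis \<Longrightarrow> j \<in> Basis \<Longrightarrow> bounded ((\<lambda>p. \<beta> p i j) ` K)"
  obtains C where "0 \<le> C" "\<And>p u v. p \<in> K \<Longrightarrow> norm (\<beta> p u v) \<le> C * norm u * norm v"
proof -
  have "\<exists>C. \<forall>p\<in>K. norm (\<beta> p i j) \<le> C" if "i \<in> Basis" "j \<in> Basis" for i j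
    using bdd[OF that] by (auto simp: bounded_iff)
  then obtain c where c: "\<And>p i j. p \<in> K \<Longrightarrow> i \<in> Basis \<Longrightarrow> j \<in> Basis \<Longrightarrow> norm (\<beta> p i j) \<le> c i j"
    by metis
  define C where "C = (\<Sum>(i, j)\<in>Basis \<times> Basis. \<bar>c i j\<bar>)"
  show ?thesis
  proof
    show "0 \<le> C"
      by (auto simp: C_def intro: sum_nonneg)
    fix p u v assume p: "p \<in> K"
    have "\<beta> p u v = \<beta> p (\<Sum>i\<in>Basis. (u \<bullet> i) *\<^sub>R i) (\<Sum>j\<in>Basis. (v \<bullet> j) *\<^sub>R j)"
      by (simp add: euclidean_representation)
    also have "\<dots> = (\<Sum>(i, j)\<in>Basis \<times> Basis. \<beta> p ((u \<bullet> i) *\<^sub>R i) ((v \<bullet> j) *\<^sub>R j))"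
      by (rule bilinear_sum[OF bil[OF p]])
    also have "norm \<dots> \<le> (\<Sum>(i, j)\<in>Basis \<times> Basis. \<bar>c i j\<bar> * (norm u * norm v))"
    proof (rule sum_norm_le, safe)
      fix i :: 'x and j :: 'y assume ij: "i \<in> Basis" "j \<in> Basis"
      have "norm (\<beta> p ((u \<bullet> i) *\<^sub>R i) ((v \<bullet> j) *\<^sub>R j)) = \<bar>u \<bullet> i\<bar> * \<bar>v \<bullet> j\<bar> * norm (\<beta> p i j)"
        using bil[OF p] by (simp add: bilinear_lmul bilinear_rmul abs_mult)
      also have "\<dots> \<le> (norm u * norm v) * \<bar>c i j\<bar>"
        using c[OF p ij] ij by (intro mult_mono Basis_le_norm) auto
      finally show "norm (\<beta> p ((u \<bullet> i) *\<^sub>R i) ((v \<bullet> j) *\<^sub>R j)) \<le> \<bar>c i j\<bar> * (norm u * norm v)"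
        by (simp add: mult.commute)
    qed
    also have "\<dots> = C * norm u * norm v"
      by (simp add: C_def sum_distrib_right case_prod_unfold mult.assoc)
    finally show "norm (\<beta> p u v) \<le> C * norm u * norm v" .
  qed
qed

text \<open>Gram-Schmidt for the inner product \<open>g\<close>, starting from the standard basis.
  The invariant that \<open>e i\<close> lies in the span of \<open>S\<close> makes the next
  difference nonzero, by independence. The result gives a meaning to the choice in
  \<open>metric_trace\<close>.\<close>

lemma exists_orthonormal_basis:
  fixes g :: "'a::euclidean_space \<Rightarrow> 'a \<Rightarrow> real"
  assumes lin: "\<And>w. linear (\<lambda>u. g u w)" and sym: "\<And>u v. g u v = g v u"
    and pos: "\<And>u. u \<noteq> 0 \<Longrightarrow> 0 < g u u"
  shows "\<exists>e :: 'a \<Rightarrow> 'a. \<forall>i\<in>Basis. \<forall>j\<in>Basis. g (e i) (e j) = (if i = j then 1 else 0)"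
proof -
  have "\<exists>e. (\<forall>i\<in>S. e i \<in> span S) \<and> (\<forall>i\<in>S. \<forall>j\<in>S. g (e i) (e j) = (if i = j then 1 else 0))"
    if "S \<subseteq> Basis" "finite S" for S :: "'a set"
    using that(2,1)
  proof (induction S rule: finite_induct)
    case (insert b S)
    then obtain e where e0: "\<forall>i\<in>S. e i \<in> span S"
      "\<forall>i\<in>S. \<forall>j\<in>S. g (e i) (e j) = (if i = j then 1 else 0)"
      by auto
    note e = e0[rule_format]
    define p where "p = (\<Sum>i\<in>S. g b (e i) *\<^sub>R e i)"
    define v where "v = b - p"
    have "p \<in> span S"
      unfolding p_def by (intro span_sum span_scale e(1))
    moreover have "b \<notin> span S"
      using independent_mono[OF independent_Basis insert.prems] insert.hyps(2)
      by (simp add: independent_insert)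
    ultimately have "v \<noteq> 0"
      by (auto simp: v_def)
    then have gv: "0 < g v v"
      by (rule pos)
    have orth: "g v (e j) = 0" if j: "j \<in> S" for j
    proof -
      have "g p (e j) = (\<Sum>i\<in>S. g b (e i) * g (e i) (e j))"
        unfolding p_def by (simp add: linear_sum[OF lin[of "e j"]] linear_scale[OF lin[of "e j"]])
      also have "\<dots> = (\<Sum>i\<in>S. if i = j then g b (e i) else 0)"
        using e(2)[OF _ j] by (intro sum.cong) auto
      also have "\<dots> = g b (e j)"
        using j insert.hyps(1) by simp
      finally show ?thesis
        using linear_diff[OF lin[of "e j"]] by (simp add: v_def)
    qed
    define e' where "e' = e(b := (1 / sqrt (g v v)) *\<^sub>R v)"
    have sc: "g (a *\<^sub>R u) w = a * g u w" "g u (a *\<^sub>R w) = a * g u w" for a u w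
      using linear_scale[OF lin[of w], of a u] linear_scale[OF lin[of u], of a w] sym by auto
    have "e' i \<in> span (insert b S)" if "i \<in> insert b S" for i
    proof -
      have "span S \<subseteq> span (insert b S)"
        by (rule span_mono) auto
      moreover have "b \<in> span (insert b S)"
        by (simp add: span_base)
      ultimately show ?thesis
        using that e(1) \<open>p \<in> span S\<close> unfolding e'_def v_def
        by (auto intro: span_scale span_diff)
    qed
    moreover have "g (e' i) (e' j) = (if i = j then 1 else 0)"
      if "i \<in> insert b S" "j \<in> insert b S" for i j
      using that e(2) insert.hyps(2) orth sym[of "e i" v] gv unfolding e'_def
      by (auto simp: sc real_sqrt_mult[symmetric] power2_eq_square[symmetric])
    ultimately show ?case
      by blast
  qed auto
  from this[OF order_refl finite_Basis] show ?thesis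
    by blast
qed

lemma (in vec_bundle) const_section_add:
  assumes "(V, \<tau>) \<in> trivs E" "m \<in> V"
  shows "const_section E \<tau> (a *\<^sub>R v + b *\<^sub>R w) m = a *\<^sub>R const_section E \<tau> v m + b *\<^sub>R const_section E \<tau> w m"
proof (rule triv_inject[OF assms])
  note c = triv_const_section[OF assms]
  have s: "a *\<^sub>R const_section E \<tau> v m \<in> fiber E m" for a v
    using c(1) by (rule subspace_scale[OF subspace_fiber])
  then show "a *\<^sub>R const_section E \<tau> v m + b *\<^sub>R const_section E \<tau> w m \<in> fiber E m"
    by (intro subspace_add[OF subspace_fiber])
  show "\<tau> m (const_section E \<tau> (a *\<^sub>R v + b *\<^sub>R w) m) =
      \<tau> m (a *\<^sub>R const_section E \<tau> v m + b *\<^sub>R const_section E \<tau> w m)"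
    by (simp add: triv(3,4)[OF assms] s c)
qed (rule triv_const_section[OF assms])

lemma (in vec_bundle) openin_total_topology: "openin (total_topology E) = open_in_total_space E"
  unfolding total_topology_def by (rule topology_inverse'[OF istopology_open_in_total_space])

lemma (in vec_bundle) total_space_subset_topspace: "total_space E \<subseteq> topspace (total_topology E)"
proof -
  have "{(m, w). m \<in> V \<and> (m, const_section E \<tau> w m) \<in> total_space E} = V \<times> UNIV"
    if "(V, \<tau>) \<in> trivs E" for V \<tau>
    using triv_const_section(1)[OF that] by (auto simp: total_space_def)
  then have "open_in_total_space E (total_space E)"
    using triv(1) by (auto simp: open_in_total_space_def open_Times)
  then show ?thesis
    using openin_subset openin_total_topology by metis
qed

section \<open>The evolution problem and its expression in a coordinate box\<close>

locale flow = connected_bundle A E "{0..\<epsilon>}" N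
  for A :: "('m::{t2_space,second_countable_topology}, 'a::euclidean_space) chart set"
    and E :: "('m, 'v::real_vector, 'f::euclidean_space) vbundle"
    and \<epsilon> :: real and N :: "real \<Rightarrow> 'm \<Rightarrow> 'a \<Rightarrow> ('m \<Rightarrow> 'v) \<Rightarrow> 'v" +
  fixes g :: "real \<Rightarrow> 'm \<Rightarrow> 'a \<Rightarrow> 'a \<Rightarrow> real"
    and NT :: "'m \<Rightarrow> 'a \<Rightarrow> ('m \<Rightarrow> 'a) \<Rightarrow> 'a"
    and \<phi> :: "real \<Rightarrow> 'm \<Rightarrow> 'v \<Rightarrow> 'v"
    and X :: "('m \<times> 'v) set"
    and f :: "real \<Rightarrow> 'm \<Rightarrow> 'v"
  assumes eps: "0 < \<epsilon>"
    and g: "riemannian_metric A {0..\<epsilon>} g"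
    and NT: "connection A (tangent_bundle A) UNIV (\<lambda>_. NT)"
    and phi: "vertical_vector_field A E {0..\<epsilon>} \<phi>"
    and X: "X \<subseteq> total_space E"
    and P1: "closedin (total_topology E) X"
    and P2: "\<And>m. convex {v. (m, v) \<in> X}"
    and P3: "\<And>t. t \<in> {0..\<epsilon>} \<Longrightarrow> parallel_transport_invariant A E (N t) X"
    and ODE: "\<And>m t\<^sub>0 t\<^sub>1 c. 0 \<le> t\<^sub>0 \<Longrightarrow> t\<^sub>0 < t\<^sub>1 \<Longrightarrow> t\<^sub>1 \<le> \<epsilon> \<Longrightarrow>
      (\<And>t. t \<in> {t\<^sub>0..t\<^sub>1} \<Longrightarrow> c t \<in> fiber E m) \<Longrightarrow>
      (\<And>t. t \<in> {t\<^sub>0..t\<^sub>1} \<Longrightarrow>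
        has_fiber_derivative E m c (\<phi> t m (c t)) (at t within {t\<^sub>0..t\<^sub>1})) \<Longrightarrow>
      (m, c t\<^sub>0) \<in> X \<Longrightarrow> (\<And>t. t \<in> {t\<^sub>0..t\<^sub>1} \<Longrightarrow> (m, c t) \<in> X)"
    and f_smooth: "smooth_section_family A E {0..\<epsilon>} UNIV f"
    and PDE: "\<And>m t. t \<in> {0..\<epsilon>} \<Longrightarrow>
      has_fiber_derivative E m (\<lambda>r. f r m)
        (laplacian A (g t) NT (N t) (f t) m + \<phi> t m (f t m)) (at t within {0..\<epsilon>})"
    and init: "\<And>m. (m, f 0 m) \<in> X"

locale flow_box = flow A E \<epsilon> N g NT \<phi> X f + trivialized A E "{0..\<epsilon>}" N U c V \<tau>
  for A :: "('m::{t2_space,second_countable_topology}, 'a::euclidean_space) chart set"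
    and E :: "('m, 'v::real_vector, 'f::euclidean_space) vbundle"
    and \<epsilon> N g NT \<phi> X f U c V \<tau>
begin

definition fh :: "real \<Rightarrow> 'a \<Rightarrow> 'f" where "fh t x = rep (f t) x"

definition Xh :: "'a \<Rightarrow> 'f set" where
  "Xh x = {w. (ci x, const_section E \<tau> w (ci x)) \<in> X}"

definition ph :: "real \<Rightarrow> 'a \<Rightarrow> 'f \<Rightarrow> 'f" where
  "ph t x w = \<tau> (ci x) (\<phi> t (ci x) (const_section E \<tau> w (ci x)))"

text \<open>The distance d of the overview. It depends on the trivialization through the Euclidean
  norm, so the gaps of two boxes over the same point differ by a bounded factor at best.\<close>

definition gap :: "real \<Rightarrow> 'a \<Rightarrow> real" where "gap t x = infdist (fh t x) (Xh x)"

lemma f_section: "t \<in> {0..\<epsilon>} \<Longrightarrow> smooth_section A E UNIV (f t)"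
  by (rule smooth_section_family_slice[OF f_smooth])

lemma f_fiber: "t \<in> {0..\<epsilon>} \<Longrightarrow> f t m \<in> fiber E m"
  using f_section by (auto simp: smooth_section_iff)

lemma smooth_fh: "smooth_on ({0..\<epsilon>} \<times> dom) (\<lambda>(t, x). fh t x)"
  using smooth_family_rep_dom[OF f_smooth] by (simp add: fh_def)

text \<open>The topology of the total space is defined by the trivializations, so the complement of
  X is open in product coordinates, and a fiber is a slice.\<close>

lemma closed_Xh:
  assumes "x \<in> dom"
  shows "closed (Xh x)"
proof -
  let ?W = "topspace (total_topology E) - X"
  have "open_in_total_space E ?W"
    using P1 by (simp add: closedin_def openin_total_topology)
  then have "open {(m, w). m \<in> V \<and> (m, const_section E \<tau> w m) \<in> ?W}"
    using V by (auto simp: open_in_total_space_def)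
  then have "open ((\<lambda>w. (ci x, w)) -` {(m, w). m \<in> V \<and> (m, const_section E \<tau> w m) \<in> ?W})"
    by (rule open_vimage) (simp add: continuous_on_Pair)
  also have "(\<lambda>w. (ci x, w)) -` {(m, w). m \<in> V \<and> (m, const_section E \<tau> w m) \<in> ?W} = - Xh x"
    using dom[OF assms] triv_const_section(1)[OF V] total_space_subset_topspace
    by (auto simp: Xh_def total_space_def)
  finally show ?thesis
    by (simp add: closed_def)
qed

lemma convex_Xh:
  assumes "x \<in> dom"
  shows "convex (Xh x)"
proof (rule convexI)
  fix v w and a b :: real
  assume "v \<in> Xh x" "w \<in> Xh x" "0 \<le> a" "0 \<le> b" "a + b = 1"
  then show "a *\<^sub>R v + b *\<^sub>R w \<in> Xh x"
    using convexD[OF P2[of "ci x"]] by (simp add: Xh_def const_section_add[OF V dom(2)[OF assms]])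
qed

lemma triv_mem_Xh:
  assumes "x \<in> dom" "v \<in> fiber E (ci x)"
  shows "\<tau> (ci x) v \<in> Xh x \<longleftrightarrow> (ci x, v) \<in> X"
  using triv_const_section(3)[OF V dom(2)[OF assms(1)] assms(2)] by (simp add: Xh_def)

lemma fh_mem_Xh: "x \<in> dom \<Longrightarrow> t \<in> {0..\<epsilon>} \<Longrightarrow> fh t x \<in> Xh x \<longleftrightarrow> (ci x, f t (ci x)) \<in> X"
  using triv_mem_Xh f_fiber by (simp add: fh_def rep_def)

text \<open>The initial value of the solution supplies a point of X in each fiber; nearest points
  therefore exist.\<close>

lemma Xh_nonempty: "x \<in> dom \<Longrightarrow> Xh x \<noteq> {}"
  using fh_mem_Xh[of x 0] init eps by auto

lemma gap_eq_0_iff: "x \<in> dom \<Longrightarrow> t \<in> {0..\<epsilon>} \<Longrightarrow> gap t x = 0 \<longleftrightarrow> (ci x, f t (ci x)) \<in> X"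
  unfolding gap_def using in_closed_iff_infdist_zero closed_Xh Xh_nonempty fh_mem_Xh by metis

lemma gap_nonneg: "0 \<le> gap t x"
  by (simp add: gap_def infdist_nonneg)

lemma Xh_transport:
  assumes "t \<in> {0..\<epsilon>}" "0 < S" "\<And>r. r \<in> {0..S} \<Longrightarrow> x + r *\<^sub>R e \<in> dom"
    "\<And>r. r \<in> {0..S} \<Longrightarrow> (z has_vector_derivative - coef t (x + r *\<^sub>R e) e (z r)) (at r within {0..S})"
    "z 0 \<in> Xh x"
  shows "z S \<in> Xh (x + S *\<^sub>R e)"
  using transport_along_line[OF P3[OF assms(1)] assms(1-4)] assms(5) by (simp add: Xh_def)

end

section \<open>Uniform bounds on compact sets for the coefficients, the metric and the reaction
  term\<close>

context trivialized
begin

lemma bounded_smooth_image: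
  assumes "smooth_on (P \<times> D) F" "compact P" "compact K" "K \<subseteq> D"
  shows "bounded (F ` (P \<times> K))"
proof (rule compact_imp_bounded[OF compact_continuous_image])
  show "continuous_on (P \<times> K) F"
    using smooth_on_imp_continuous_on[OF assms(1)] by (rule continuous_on_subset) (use assms(4) in auto)
  show "compact (P \<times> K)"
    using assms(2,3) by (rule compact_Times)
qed

lemma coef_bound:
  assumes "compact P" "P \<subseteq> T" "compact K" "K \<subseteq> dom"
  obtains L where "0 \<le> L"
    "\<And>t x e w. t \<in> P \<Longrightarrow> x \<in> K \<Longrightarrow> norm (coef t x e w) \<le> L * norm e * norm w"
proof (rule bilinear_family_bound[of "P \<times> K" "\<lambda>(t, x). coef t x"])
  show "bilinear (case p of (t, x) \<Rightarrow> coef t x)" if "p \<in> P \<times> K" for p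
    using that assms linear_coef linear_coef_direction unfolding bilinear_def by fast
  show "bounded ((\<lambda>p. (case p of (t, x) \<Rightarrow> coef t x) i j) ` (P \<times> K))" for i j
    using bounded_smooth_image[OF smooth_on_subset[OF smooth_coef, of "P \<times> dom" i j] assms(1,3,4)] assms(2)
    by (auto simp: case_prod_unfold)
next
  fix L assume "0 \<le> L" and L: "\<And>p u v. p \<in> P \<times> K \<Longrightarrow>
    norm ((case p of (t, x) \<Rightarrow> coef t x) u v) \<le> L * norm u * norm v"
  show thesis
  proof (rule that[OF \<open>0 \<le> L\<close>])
    show "norm (coef t x e w) \<le> L * norm e * norm w" if "t \<in> P" "x \<in> K" for t x e w
      using L[of "(t, x)" e w] that by simp
  qed
qed

text \<open>The derivative of \<open>coef t x e w\<close> in \<open>x\<close> in the direction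
  \<open>h\<close>. Expanding \<open>e\<close> in the basis makes the bilinearity in
  \<open>e\<close> and \<open>h\<close> visible and leaves only the derivatives of finitely many
  smooth functions to be bounded.\<close>

definition dcoef :: "real \<Rightarrow> 'a \<Rightarrow> 'f \<Rightarrow> 'a \<Rightarrow> 'a \<Rightarrow> 'f" where
  "dcoef t x w e h = (\<Sum>i\<in>Basis. (e \<bullet> i) *\<^sub>R frechet_derivative (\<lambda>y. coef t y i w) (at x) h)"

lemma differentiable_coef:
  assumes "t \<in> T" "x \<in> dom"
  shows "(\<lambda>y. coef t y e w) differentiable at x"
  using smooth_on_differentiable[OF smooth_on_slice[OF smooth_coef assms(1)] open_dom assms(2)] by simp

lemma has_derivative_coef:
  assumes "t \<in> T" "x \<in> dom"
  shows "((\<lambda>y. coef t y e w) has_derivative dcoef t x w e) (at x)"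
proof -
  have "((\<lambda>y. \<Sum>i\<in>Basis. (e \<bullet> i) *\<^sub>R coef t y i w) has_derivative dcoef t x w e) (at x)"
    unfolding dcoef_def
    by (intro has_derivative_sum has_derivative_scaleR_right frechet_derivative_worksI differentiable_coef assms)
  then show ?thesis
  proof (rule has_derivative_transform_within_open[OF _ open_dom assms(2)])
    show "(\<Sum>i\<in>Basis. (e \<bullet> i) *\<^sub>R coef t y i w) = coef t y e w" if "y \<in> dom" for y
      using linear_Basis_sum[OF linear_coef_direction[OF assms(1) that], of e w] by simp
  qed
qed

lemma dcoef_bound:
  assumes "compact P" "P \<subseteq> T" "compact K" "K \<subseteq> dom"
  obtains L where "0 \<le> L"
    "\<And>t x e h. t \<in> P \<Longrightarrow> x \<in> K \<Longrightarrow> norm (dcoef t x w e h) \<le> L * norm e * norm h"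
proof (rule bilinear_family_bound[of "P \<times> K" "\<lambda>(t, x). dcoef t x w"])
  show "bilinear (case p of (t, x) \<Rightarrow> dcoef t x w)" if p: "p \<in> P \<times> K" for p
  proof -
    obtain t x where p': "p = (t, x)" "t \<in> T" "x \<in> dom"
      using p assms(2,4) by (cases p) auto
    have "linear (dcoef t x w e)" for e
      using has_derivative_linear[OF has_derivative_coef[OF p'(2,3)]] .
    moreover have "linear (\<lambda>e. dcoef t x w e h)" for h
      unfolding dcoef_def
      by (auto intro!: linearI simp: inner_add_left scaleR_add_left sum.distrib scaleR_sum_right)
    ultimately show ?thesis
      by (simp add: p' bilinear_def)
  qed
  show "bounded ((\<lambda>p. (case p of (t, x) \<Rightarrow> dcoef t x w) i j) ` (P \<times> K))" for i j
  proof -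
    have 1: "smooth_on (P \<times> dom) (\<lambda>(t, x). frechet_derivative (\<lambda>y. coef t y k w) (at x) j)" for k
      using smooth_on_slice_derivative[OF smooth_on_subset[OF smooth_coef, of "P \<times> dom" k w] open_dom] assms(2)
      by (auto simp: case_prod_unfold)
    have "smooth_on (P \<times> dom) (\<lambda>z. \<Sum>k\<in>Basis. (i \<bullet> k) *\<^sub>R
        (case z of (t, x) \<Rightarrow> frechet_derivative (\<lambda>y. coef t y k w) (at x) j))"
      by (intro smooth_on_sum smooth_on_scaleR smooth_on_const 1)
    from bounded_smooth_image[OF this assms(1,3,4)] show ?thesis
      by (simp add: dcoef_def case_prod_unfold)
  qed
next
  fix L assume "0 \<le> L" and L: "\<And>p u v. p \<in> P \<times> K \<Longrightarrow>
    norm ((case p of (t, x) \<Rightarrow> dcoef t x w) u v) \<le> L * norm u * norm v"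
  show thesis
  proof (rule that[OF \<open>0 \<le> L\<close>])
    show "norm (dcoef t x w e h) \<le> L * norm e * norm h" if "t \<in> P" "x \<in> K" for t x e h
      using L[of "(t, x)" e h] that by simp
  qed
qed

end

text \<open>Here \<open>tan.coef\<close> provides the Christoffel symbols of \<open>NT\<close> in
  the chart \<open>c\<close>, which occur in the first-order part of the Laplacian.\<close>

sublocale flow_box \<subseteq> tan: trivialized A "tangent_bundle A" UNIV "\<lambda>_. NT" U c U "differential A c"
  using NT U tangent_triv[OF U] by unfold_locales

context flow_box
begin

lemma dom_subset_tan: "dom \<subseteq> tan.dom"
  by (auto simp: dom_def tan.dom_def)

lemma g_bilinear:
  assumes "t \<in> {0..\<epsilon>}"
  shows "linear (\<lambda>u. g t m u v)" "g t m u v = g t m v u" "u \<noteq> 0 \<Longrightarrow> 0 < g t m u u"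
proof -
  have *: "\<forall>m u v. g t m u v = g t m v u \<and> (\<forall>w. g t m (u + v) w = g t m u w + g t m v w) \<and>
      (\<forall>a. g t m (a *\<^sub>R u) v = a * g t m u v) \<and> (u \<noteq> 0 \<longrightarrow> 0 < g t m u u)"
    using g[unfolded bundle_metric_def, THEN conjunct1, THEN bspec, OF assms]
    unfolding fiber_tangent_bundle by blast
  then show "g t m u v = g t m v u" "u \<noteq> 0 \<Longrightarrow> 0 < g t m u u"
    by blast+
  show "linear (\<lambda>u. g t m u v)"
  proof (rule linearI)
    show "g t m (u + w) v = g t m u v + g t m w v" for u w
      using * by blast
    show "g t m (a *\<^sub>R u) v = a *\<^sub>R g t m u v" for a u
      unfolding real_scaleR_def using * by blast
  qed
qed

text \<open>The trace uses orthonormal vectors that vary with the point in an uncontrolled way.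
  Their coordinate length is bounded since \<open>g\<close>, written in the coordinate frame, is
  continuous and positive, hence bounded below on unit vectors over a compact set.\<close>

lemma orthonormal_frame_bound:
  assumes "compact K" "K \<subseteq> dom"
  obtains C where "0 \<le> C"
    "\<And>t x v. t \<in> {0..\<epsilon>} \<Longrightarrow> x \<in> K \<Longrightarrow> g t (ci x) v v = 1 \<Longrightarrow> norm (differential A c (ci x) v) \<le> C"
proof (cases "K = {}")
  case True
  with that[of 0] show ?thesis by simp
next
  case False
  define G where "G t x e e' = g t (ci x) (frame c e (ci x)) (frame c e' (ci x))" for t x e e'
  have G_smooth: "smooth_on ({0..\<epsilon>} \<times> tan.dom) (\<lambda>(t, x). G t x e e')" for e e'
  proof -
    have "smooth_family A {0..\<epsilon>} U (\<lambda>t m. g t m (frame c e m) (frame c e' m))"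
      using g chart(1)[OF U] smooth_section_frame unfolding bundle_metric_def by blast
    from smooth_family_chart[OF this U] show ?thesis
      by (simp add: G_def tan.dom_def)
  qed
  have G_add: "G t x (a *\<^sub>R u + b *\<^sub>R v) w = a * G t x u w + b * G t x v w"
    and G_sym: "G t x u v = G t x v u" if "t \<in> {0..\<epsilon>}" "x \<in> dom" for t x u v w a b
    unfolding G_def g_bilinear(2)[OF that(1), of _ "frame c u (ci x)" "frame c v (ci x)"]
    by (simp_all add: linear_add[OF linear_frame[OF dom(1)[OF that(2)]]]
        linear_scale[OF linear_frame[OF dom(1)[OF that(2)]]]
        linear_add[OF g_bilinear(1)[OF that(1)]] linear_scale[OF g_bilinear(1)[OF that(1)]])
  have G_bil: "bilinear (G t x)" if "t \<in> {0..\<epsilon>}" "x \<in> dom" for t x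
  proof -
    have l: "linear (\<lambda>u. G t x u w)" for w
      using G_add[OF that, of 1 _ 1] G_add[OF that, of _ _ 0 0] by (intro linearI) auto
    moreover have "(\<lambda>w. G t x u w) = (\<lambda>w. G t x w u)" for u
      using G_sym[OF that] by blast
    ultimately show ?thesis
      unfolding bilinear_def by metis
  qed
  let ?S = "{0..\<epsilon>} \<times> K \<times> sphere (0 :: 'a) 1"
  have G_sum: "G t x e e = (\<Sum>(i, j)\<in>Basis \<times> Basis. (e \<bullet> i) * (e \<bullet> j) * G t x i j)"
    if "t \<in> {0..\<epsilon>}" "x \<in> dom" for t x e
  proof -
    have "G t x e e = G t x (\<Sum>i\<in>Basis. (e \<bullet> i) *\<^sub>R i) (\<Sum>j\<in>Basis. (e \<bullet> j) *\<^sub>R j)"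
      by (simp add: euclidean_representation)
    also have "\<dots> = (\<Sum>(i, j)\<in>Basis \<times> Basis. G t x ((e \<bullet> i) *\<^sub>R i) ((e \<bullet> j) *\<^sub>R j))"
      by (rule bilinear_sum[OF G_bil[OF that]])
    also have "\<dots> = (\<Sum>(i, j)\<in>Basis \<times> Basis. (e \<bullet> i) * (e \<bullet> j) * G t x i j)"
      using G_bil[OF that] by (simp add: bilinear_lmul bilinear_rmul mult.assoc)
    finally show ?thesis .
  qed
  have cont: "continuous_on ?S (\<lambda>(t, x, e). G t x e e)"
  proof -
    have 1: "continuous_on ?S (\<lambda>z. G (fst z) (fst (snd z)) i j)" for i j
    proof -
      have "continuous_on ?S (\<lambda>z. (\<lambda>(t, x). G t x i j) (fst z, fst (snd z)))"
        using assms(2) dom_subset_tan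
        by (intro continuous_on_compose2[OF smooth_on_imp_continuous_on[OF G_smooth]] continuous_intros) auto
      then show ?thesis by simp
    qed
    have "continuous_on ?S (\<lambda>z. \<Sum>p\<in>Basis \<times> Basis. (snd (snd z) \<bullet> fst p) * (snd (snd z) \<bullet> snd p) *
        G (fst z) (fst (snd z)) (fst p) (snd p))"
      by (intro continuous_intros 1)
    then show ?thesis
      by (rule continuous_on_cong[THEN iffD1, OF refl, rotated])
        (use assms(2) G_sum in \<open>auto simp: case_prod_unfold\<close>)
  qed
  have "compact ?S"
    using assms(1) by (intro compact_Times) auto
  moreover have "?S \<noteq> {}"
    using False eps by (auto simp: sphere_eq_empty)
  ultimately obtain z where z: "z \<in> ?S" and min: "\<And>y. y \<in> ?S \<Longrightarrow>
      (\<lambda>(t, x, e). G t x e e) z \<le> (\<lambda>(t, x, e). G t x e e) y"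
    using continuous_attains_inf[OF _ _ cont] by blast
  define l where "l = (\<lambda>(t, x, e). G t x e e) z"
  have "0 < l"
  proof -
    obtain t x e where z': "z = (t, x, e)" "t \<in> {0..\<epsilon>}" "x \<in> K" "norm e = 1"
      using z by (cases z) auto
    have "differential A c (ci x) (frame c e (ci x)) = e"
      using differential_frame[OF U] dom(1) z'(3) assms(2) by blast
    moreover have "differential A c (ci x) 0 = 0"
      using differential_coordinate(1)[OF U] dom(1) z'(3) assms(2) linear_0 by blast
    ultimately have "frame c e (ci x) \<noteq> 0"
      using z'(4) by fastforce
    then show ?thesis
      using g_bilinear(3)[OF z'(2)] by (simp add: l_def z'(1) G_def)
  qed
  show ?thesis
  \<comment> \<open>With \<open>l\<close> the minimum on coordinate unit vectors, a vector of
    coordinates \<open>e\<close> and \<open>g\<close>-length 1 satisfies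
    \<open>(norm e)\<^sup>2 * l \<le> 1\<close>.\<close>
  proof (rule that[of "sqrt (1 / l)"])
    show "0 \<le> sqrt (1 / l)"
      using \<open>0 < l\<close> by simp
    fix t x v assume t: "t \<in> {0..\<epsilon>}" and x: "x \<in> K" and v: "g t (ci x) v v = 1"
    have xd: "x \<in> dom" using x assms(2) by auto
    define e where "e = differential A c (ci x) v"
    have fe: "frame c e (ci x) = v"
      unfolding e_def by (rule frame_differential[OF U dom(1)[OF xd]])
    show "norm (differential A c (ci x) v) \<le> sqrt (1 / l)"
    proof (cases "e = 0")
      case True
      then show ?thesis
        using \<open>0 < l\<close> by (simp add: e_def)
    next
      case False
      define e1 where "e1 = (1 / norm e) *\<^sub>R e"
      have e1: "e = norm e *\<^sub>R e1" "norm e1 = 1"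
        using False by (auto simp: e1_def)
      have "l \<le> G t x e1 e1"
        using min[of "(t, x, e1)"] t x e1(2) by (simp add: l_def)
      moreover have "G t x e e = norm e * norm e * G t x e1 e1"
        using G_bil[OF t xd] by (subst (1 2) e1(1)) (simp add: bilinear_lmul bilinear_rmul)
      moreover have "G t x e e = 1"
        using v by (simp add: G_def fe)
      ultimately have "(norm e)\<^sup>2 * l \<le> 1"
        by (simp add: power2_eq_square) (metis mult_left_mono norm_ge_zero zero_le_mult_iff)
      then have "(norm e)\<^sup>2 \<le> 1 / l"
        using \<open>0 < l\<close> by (simp add: field_simps)
      then show ?thesis
        using real_le_rsqrt by (simp add: e_def)
    qed
  qed
qed

lemma smooth_ph: "smooth_on (({0..\<epsilon>} \<times> dom) \<times> UNIV) (\<lambda>((t, x), w). ph t x w)"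
proof -
  have "smooth_family A ({0..\<epsilon>} \<times> (UNIV :: 'f set)) V (\<lambda>(t, w) m. \<tau> m (\<phi> t m (const_section E \<tau> w m)))"
    using phi V by (auto simp: vertical_vector_field_def)
  from smooth_family_chart[OF this U]
  have 1: "smooth_on (({0..\<epsilon>} \<times> UNIV) \<times> dom) (\<lambda>((t, w), x). ph t x w)"
    by (simp add: ph_def dom_def case_prod_unfold)
  have "linear (\<lambda>z :: (real \<times> 'a) \<times> 'f. ((fst (fst z), snd z), snd (fst z)))"
    by (auto intro!: linearI)
  have "smooth_on (({0..\<epsilon>} \<times> dom) \<times> UNIV)
      ((\<lambda>((t, w), x). ph t x w) \<circ> (\<lambda>z. ((fst (fst z), snd z), snd (fst z))))"
    by (rule smooth_on_compose[OF 1 smooth_on_linear[OF \<open>linear _\<close>]]) auto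
  then show ?thesis
    by (rule smooth_on_cong) auto
qed

text \<open>The derivative in the fiber variable is bounded on a compact set, and the mean value
  inequality holds on the convex ball.\<close>

lemma ph_lipschitz:
  assumes "compact K" "K \<subseteq> dom"
  obtains L where "0 \<le> L" "\<And>t x w w'. t \<in> {0..\<epsilon>} \<Longrightarrow> x \<in> K \<Longrightarrow> w \<in> cball q R \<Longrightarrow> w' \<in> cball q R \<Longrightarrow>
    norm (ph t x w - ph t x w') \<le> L * norm (w - w')"
proof -
  let ?S = "({0..\<epsilon>} \<times> K) \<times> cball q R"
  define D where "D = (\<lambda>((t, x), w). frechet_derivative (\<lambda>w. ph t x w) (at w))"
  have diff: "((\<lambda>w. ph t x w) has_derivative D ((t, x), w)) (at w)" if "t \<in> {0..\<epsilon>}" "x \<in> dom" for t x w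
    using smooth_on_differentiable[OF smooth_on_slice[OF smooth_ph, of "(t, x)"] open_UNIV] that
    unfolding D_def by (auto intro: frechet_derivative_worksI)
  have bdd: "bounded ((\<lambda>p. D p v) ` ?S)" for v
  proof (rule compact_imp_bounded[OF compact_continuous_image])
    have "smooth_on (({0..\<epsilon>} \<times> dom) \<times> UNIV) (\<lambda>p. D p v)"
      using smooth_on_slice_derivative[OF smooth_ph open_UNIV, of v]
      by (simp add: D_def case_prod_unfold)
    then show "continuous_on ?S (\<lambda>p. D p v)"
      using assms(2) by (intro continuous_on_subset[OF smooth_on_imp_continuous_on]) auto
    show "compact ?S"
      using assms(1) by (intro compact_Times) auto
  qed
  \<comment> \<open>The dummy scalar \<open>u\<close> turns the linear family \<open>D p\<close>
    into a bilinear one, so that the bound for bilinear families applies.\<close>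
  obtain L where L: "0 \<le> L" "\<And>p u v. p \<in> ?S \<Longrightarrow> norm (u *\<^sub>R D p v) \<le> L * norm (u :: real) * norm v"
  proof (rule bilinear_family_bound[of ?S "\<lambda>p u v. u *\<^sub>R D p v"])
    show "bilinear (\<lambda>u v. u *\<^sub>R D p v)" if "p \<in> ?S" for p
    proof -
      obtain t x w where "p = ((t, x), w)"
        by (metis surj_pair)
      then have "linear (D p)"
        using that assms(2) has_derivative_linear[OF diff[of t x w]] by auto
      then show ?thesis
        by (auto simp: bilinear_def intro!: linearI simp: linear_add linear_scale algebra_simps)
    qed
    show "bounded ((\<lambda>p. i *\<^sub>R D p j) ` ?S)" if "i \<in> Basis" for i :: real and j
      using bdd[of j] that by simp
  qed blast
  show ?thesis
  proof (rule that[OF L(1)])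
    fix t x w w' assume *: "t \<in> {0..\<epsilon>}" "x \<in> K" "w \<in> cball q R" "w' \<in> cball q R"
    show "norm (ph t x w - ph t x w') \<le> L * norm (w - w')"
    proof (rule differentiable_bound[OF convex_cball _ _ *(3,4)])
      fix y assume y: "y \<in> cball q R"
      show "(ph t x has_derivative D ((t, x), y)) (at y within cball q R)"
        using diff[of t x y] * assms(2) by (auto intro: has_derivative_at_withinI)
      show "onorm (D ((t, x), y)) \<le> L"
        using L(2)[of "((t, x), y)" 1] * y L(1) by (intro onorm_bound) auto
    qed
  qed
qed

end

section \<open>Upper semicontinuous functions, and semicontinuity of the gap\<close>

lemma usc_attains_max:
  fixes F :: "'p::topological_space \<Rightarrow> real"
  assumes K: "compact K" "K \<noteq> {}"
    and usc: "\<And>p b. p \<in> K \<Longrightarrow> F p < b \<Longrightarrow> \<forall>\<^sub>F q in at p within K. F q < b"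
  obtains p where "p \<in> K" "\<And>q. q \<in> K \<Longrightarrow> F q \<le> F p"
proof (rule ccontr)
  assume "\<not> thesis"
  then have "\<forall>p\<in>K. \<exists>q\<in>K. F p < F q"
    using that by (meson not_le)
  then obtain q where q: "\<And>p. p \<in> K \<Longrightarrow> q p \<in> K" "\<And>p. p \<in> K \<Longrightarrow> F p < F (q p)"
    by metis
  \<comment> \<open>Without a maximum each \<open>p\<close> is beaten by some \<open>q p\<close>,
    and \<open>F\<close> stays below \<open>F (q p)\<close> near \<open>p\<close>. Among the
    finitely many points \<open>q p\<close> of a subcover the best one lies in one of these
    neighborhoods and is beaten again.\<close>
  have "\<exists>W. open W \<and> p \<in> W \<and> (\<forall>y\<in>K \<inter> W. F y < F (q p))" if p: "p \<in> K" for p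
  proof -
    obtain W where W: "open W" "p \<in> W" "\<forall>y\<in>W. y \<noteq> p \<longrightarrow> y \<in> K \<longrightarrow> F y < F (q p)"
      using usc[OF p q(2)[OF p]] by (auto simp: eventually_at_topological)
    show ?thesis
    proof (intro exI[of _ W] conjI ballI)
      show "F y < F (q p)" if "y \<in> K \<inter> W" for y
        using W(3) q(2)[OF \<open>p \<in> K\<close>] that by (cases "y = p") auto
    qed (rule W)+
  qed
  then obtain W where W: "\<And>p. p \<in> K \<Longrightarrow> open (W p)" "\<And>p. p \<in> K \<Longrightarrow> p \<in> W p"
    "\<And>p y. p \<in> K \<Longrightarrow> y \<in> K \<Longrightarrow> y \<in> W p \<Longrightarrow> F y < F (q p)"
    by (metis IntI)
  obtain D where D: "D \<subseteq> K" "finite D" "K \<subseteq> (\<Union>p\<in>D. W p)"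
    using compactE_image[OF K(1), of K W] W(1,2) by blast
  with K(2) have "D \<noteq> {}" by auto
  with D(2) obtain p where p: "p \<in> D" "\<forall>y\<in>D. F (q y) \<le> F (q p)"
    using Max_in[of "(\<lambda>y. F (q y)) ` D"] Max_ge[of "(\<lambda>y. F (q y)) ` D"] by fastforce
  obtain p' where "p' \<in> D" "q p \<in> W p'"
    using D(1,3) p(1) q(1) by blast
  then have "F (q p) < F (q p')"
    using W(3)[of p' "q p"] q(1)[of p] D(1) p(1) by blast
  with p(2) \<open>p' \<in> D\<close> show False
    by force
qed

lemma usc_mult:
  fixes F h :: "'p::topological_space \<Rightarrow> real"
  assumes usc: "\<And>b. F p < b \<Longrightarrow> \<forall>\<^sub>F q in at p within K. F q < b"
    and h: "continuous_on K h" "\<And>q. q \<in> K \<Longrightarrow> 0 \<le> h q" and p: "p \<in> K" and b: "h p * F p < b"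
  shows "\<forall>\<^sub>F q in at p within K. h q * F q < b"
proof -
  \<comment> \<open>Chosen so that raising \<open>F p\<close> by \<open>d\<close> costs at most half
    of the margin \<open>b - h p * F p\<close> after multiplication by \<open>h p\<close>; the
    summand 1 covers \<open>h p = 0\<close>.\<close>
  define d where "d = (b - h p * F p) / (2 * (h p + 1))"
  define b1 where "b1 = F p + d"
  have hp: "0 \<le> h p" using h(2) p by simp
  then have "0 < d"
    using b by (simp add: d_def)
  then have 1: "\<forall>\<^sub>F q in at p within K. F q < b1"
    by (intro usc) (simp add: b1_def)
  have "h p * d \<le> (b - h p * F p) / 2"
    using hp b by (simp add: d_def field_simps)
  moreover have "h p * b1 = h p * F p + h p * d"
    by (simp add: b1_def distrib_left)
  ultimately have "h p * b1 \<le> h p * F p + (b - h p * F p) / 2"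
    by simp
  also have "\<dots> < b"
    using b by (simp add: field_simps)
  finally have "h p * b1 < b" .
  moreover have "((\<lambda>q. h q * b1) \<longlongrightarrow> h p * b1) (at p within K)"
    using h(1) p by (intro tendsto_mult tendsto_const) (simp add: continuous_on_def)
  ultimately have 2: "\<forall>\<^sub>F q in at p within K. h q * b1 < b"
    by (simp add: order_tendstoD(2))
  have 3: "\<forall>\<^sub>F q in at p within K. q \<in> K"
    by (simp add: eventually_at_filter)
  from 1 2 3 show ?thesis
  proof eventually_elim
    case (elim q)
    then have "h q * F q \<le> h q * b1"
      using h(2) by (intro mult_left_mono) auto
    with elim show ?case by simp
  qed
qed

context flow_box
begin

text \<open>A nearest point \<open>w\<close> over \<open>x0\<close> is transported along the segment
  to \<open>x\<close>. It arrives in X, displaced by at most a multiple of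
  \<open>norm (x - x0)\<close>, and bounds the gap at \<open>x\<close> from above.\<close>

lemma gap_usc:
  assumes K: "cball xc R \<subseteq> dom" and t0: "t0 \<in> {0..\<epsilon>}" and x0: "x0 \<in> cball xc R" and b: "gap t0 x0 < b"
  shows "\<forall>\<^sub>F z in at (t0, x0) within {0..\<epsilon>} \<times> cball xc R. gap (fst z) (snd z) < b"
proof -
  let ?K = "cball xc R" and ?S = "{0..\<epsilon>} \<times> cball xc R"
  have x0d: "x0 \<in> dom" using x0 K by auto
  obtain w where w: "w \<in> Xh x0" "gap t0 x0 = dist (fh t0 x0) w"
    using infdist_attains_inf[OF closed_Xh[OF x0d] Xh_nonempty[OF x0d]] unfolding gap_def by metis
  obtain L where L: "0 \<le> L"
    "\<And>t x e w. t \<in> {0..\<epsilon>} \<Longrightarrow> x \<in> ?K \<Longrightarrow> norm (coef t x e w) \<le> L * norm e * norm w"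
    using coef_bound[OF compact_Icc order_refl compact_cball K] by blast
  \<comment> \<open>X does not depend on time, so the connection of any single time relates its
    fibers; time 0 is taken.\<close>
  have 0: "0 \<in> {0..\<epsilon>}" using eps by simp
  have est: "gap t x \<le> dist (fh t x) (fh t0 x0) + gap t0 x0 + 2 * (L * norm (x - x0)) * norm w"
    if x: "x \<in> ?K" and small: "L * norm (x - x0) \<le> 1 / 2" for t x
  proof -
    define e where "e = x - x0"
    have seg: "x0 + r *\<^sub>R e \<in> ?K" if "r \<in> {0..1}" for r
    proof -
      have "x0 + r *\<^sub>R e = (1 - r) *\<^sub>R x0 + r *\<^sub>R x"
        by (simp add: e_def algebra_simps)
      then show ?thesis
        using convexD[OF convex_cball x0 x, of "1 - r" r] that by simp
    qed
    then have segd: "x0 + r *\<^sub>R e \<in> dom" if "r \<in> {0..1}" for r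
      using that K by blast
    obtain u where u: "u 0 = w"
      "\<And>r. r \<in> {0..1} \<Longrightarrow> (u has_vector_derivative - coef 0 (x0 + r *\<^sub>R e) e (u r)) (at r within {0..1})"
      "\<And>r. r \<in> {0..1} \<Longrightarrow> norm (u r - w) \<le> 2 * 1 * (L * norm e) * norm w"
    proof (rule linear_ode[of 1 "\<lambda>r w. - coef 0 (x0 + r *\<^sub>R e) e w" "L * norm e" w])
      show "linear (\<lambda>w. - coef 0 (x0 + r *\<^sub>R e) e w)" if "r \<in> {0..1}" for r
        using linear_coef[OF 0 segd[OF that]] by (intro linear_compose_neg) auto
      show "continuous_on {0..1} (\<lambda>r. - coef 0 (x0 + r *\<^sub>R e) e b)" for b
        using segd
        by (intro continuous_intros continuous_on_compose2[OF smooth_on_imp_continuous_on[OF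
                smooth_on_slice[OF smooth_coef 0], simplified]]) auto
      show "norm (- coef 0 (x0 + r *\<^sub>R e) e b) \<le> L * norm e * norm b" if "r \<in> {0..1}" for r b
        using L(2)[OF 0 seg[OF that]] by simp
    qed (use L(1) small in \<open>auto simp: e_def\<close>)
    have "u 1 \<in> Xh (x0 + 1 *\<^sub>R e)"
      by (rule Xh_transport[OF 0 zero_less_one segd u(2)]) (use u(1) w in auto)
    then have "gap t x \<le> dist (fh t x) (u 1)"
      unfolding gap_def by (intro infdist_le) (simp add: e_def)
    also have "\<dots> \<le> dist (fh t x) (fh t0 x0) + dist (fh t0 x0) w + dist w (u 1)"
      using dist_triangle[of "fh t x" "u 1" "fh t0 x0"] dist_triangle[of "fh t0 x0" "u 1" w] by linarith
    also have "dist w (u 1) \<le> 2 * (L * norm (x - x0)) * norm w"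
      using u(3)[of 1] by (simp add: dist_norm norm_minus_commute e_def)
    finally show ?thesis
      using w(2) by simp
  qed
  have c: "continuous_on ?S (\<lambda>z. fh (fst z) (snd z))"
    using continuous_on_subset[OF smooth_on_imp_continuous_on[OF smooth_fh], of ?S] K
    by (auto simp: case_prod_unfold)
  have "((\<lambda>z. dist (fh (fst z) (snd z)) (fh t0 x0) + gap t0 x0 + 2 * (L * norm (snd z - x0)) * norm w)
      \<longlongrightarrow> dist (fh t0 x0) (fh t0 x0) + gap t0 x0 + 2 * (L * norm (x0 - x0)) * norm w) (at (t0, x0) within ?S)"
    using c[unfolded continuous_on_def, rule_format, of "(t0, x0)"] t0 x0
    by (intro tendsto_intros) (auto intro!: tendsto_eq_intros)
  then have 1: "\<forall>\<^sub>F z in at (t0, x0) within ?S.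
      dist (fh (fst z) (snd z)) (fh t0 x0) + gap t0 x0 + 2 * (L * norm (snd z - x0)) * norm w < b"
    by (rule order_tendstoD(2)) (use b in simp)
  have "((\<lambda>z. L * norm (snd z - x0)) \<longlongrightarrow> L * norm (x0 - x0)) (at (t0, x0) within ?S)"
    by (intro tendsto_intros) (auto intro!: tendsto_eq_intros)
  then have 2: "\<forall>\<^sub>F z in at (t0, x0) within ?S. L * norm (snd z - x0) < 1 / 2"
    by (rule order_tendstoD(2)) simp
  have 3: "\<forall>\<^sub>F z in at (t0, x0) within ?S. z \<in> ?S"
    by (simp add: eventually_at_filter)
  from 1 2 3 show ?thesis
  proof eventually_elim
    case (elim z)
    then show ?case
      using est[of "snd z" "fst z"] by (auto simp: mem_Times_iff)
  qed
qed

text \<open>Places all nearest points in one ball, on which the reaction term has a uniform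
  Lipschitz constant.\<close>

lemma gap_bounded:
  assumes "cball xc R \<subseteq> dom"
  obtains G where "\<And>t x. t \<in> {0..\<epsilon>} \<Longrightarrow> x \<in> cball xc R \<Longrightarrow> gap t x \<le> G"
proof (cases "cball xc R = {}")
  case False
  obtain p where "\<And>q. q \<in> {0..\<epsilon>} \<times> cball xc R \<Longrightarrow> gap (fst q) (snd q) \<le> gap (fst p) (snd p)"
  proof (rule usc_attains_max)
    show "compact ({0..\<epsilon>} \<times> cball xc R)"
      by (intro compact_Times) auto
    show "{0..\<epsilon>} \<times> cball xc R \<noteq> {}"
      using False eps by auto
    show "\<forall>\<^sub>F q in at p within {0..\<epsilon>} \<times> cball xc R. gap (fst q) (snd q) < b"
      if "p \<in> {0..\<epsilon>} \<times> cball xc R" "gap (fst p) (snd p) < b" for p b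
      using gap_usc[OF assms, of "fst p" "snd p" b] that by (simp add: mem_Times_iff)
  qed blast
  then have p: "gap t x \<le> gap (fst p) (snd p)" if "t \<in> {0..\<epsilon>}" "x \<in> cball xc R" for t x
    using that by force
  show ?thesis
    by (rule that[OF p])
qed (use that in auto)

text \<open>The solution of the ODE that starts at the boundary point \<open>w\<close> exists for a
  short time and stays in the fiber, so \<open>\<nu> \<bullet> (u s - w)\<close> is never positive.
  Its derivative at the start is the claimed quantity.\<close>

lemma reaction_normal:
  assumes x: "x \<in> dom" and t: "t \<in> {0..\<epsilon>}" and w: "w \<in> Xh x"
    and \<nu>: "\<And>y. y \<in> Xh x \<Longrightarrow> \<nu> \<bullet> y \<le> \<nu> \<bullet> w"
  shows "\<nu> \<bullet> ph t x w \<le> 0"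
proof -
  let ?m = "ci x" and ?c = "const_section E \<tau>"
  have cont: "continuous_on ({0..\<epsilon>} \<times> UNIV) (\<lambda>(t, w). ph t x w)"
  proof -
    have "continuous_on ({0..\<epsilon>} \<times> UNIV) (\<lambda>z. (\<lambda>((t, x), w). ph t x w) ((fst z, x), snd z))"
      using x by (intro continuous_on_compose2[OF smooth_on_imp_continuous_on[OF smooth_ph]] continuous_intros)
        auto
    then show ?thesis by (simp add: case_prod_unfold)
  qed
  have "compact {x}" "{x} \<subseteq> dom"
    using x by auto
  then obtain L where L: "0 \<le> L"
    "\<And>t x' y z. t \<in> {0..\<epsilon>} \<Longrightarrow> x' \<in> {x} \<Longrightarrow> y \<in> cball w 1 \<Longrightarrow> z \<in> cball w 1 \<Longrightarrow>
      norm (ph t x' y - ph t x' z) \<le> L * norm (y - z)"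
    by (rule ph_lipschitz[of _ w 1]) blast
  have "bounded ((\<lambda>(t, w). ph t x w) ` ({0..\<epsilon>} \<times> cball w 1))"
    by (intro compact_imp_bounded compact_continuous_image continuous_on_subset[OF cont] compact_Times) auto
  then obtain B where B: "\<And>t y. t \<in> {0..\<epsilon>} \<Longrightarrow> y \<in> cball w 1 \<Longrightarrow> norm (ph t x y) \<le> B"
    unfolding bounded_iff by fastforce
  have B0: "0 \<le> B"
    using B[of 0 w] eps norm_ge_zero[of "ph 0 x w"] by (auto simp del: norm_ge_zero)
  have main: "\<nu> \<bullet> ph t x w \<le> 0" if t: "t \<in> {0..<\<epsilon>}" for t
  proof -
    \<comment> \<open>\<open>B\<close> bounds the speed and \<open>L\<close> is the Lipschitz
      constant on the unit ball about \<open>w\<close>. This length keeps the solution in that ball,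
      makes the Picard operator contract and does not run past \<open>\<epsilon>\<close>.\<close>
    define S where "S = min (\<epsilon> - t) (1 / (B + L + 1))"
    have S: "0 < S" "t + S \<le> \<epsilon>"
      using t B0 L(1) by (auto simp: S_def)
    have "S \<le> 1 / (B + L + 1)"
      by (simp add: S_def)
    note mult_right_mono[OF this B0] mult_right_mono[OF this L(1)]
    moreover have "1 / (B + L + 1) * B \<le> 1" "1 / (B + L + 1) * L < 1"
      using B0 L(1) by (auto simp: field_simps)
    ultimately have SBL: "S * B \<le> 1" "S * L < 1"
      by linarith+
    have ts: "t + s \<in> {0..\<epsilon>}" if "s \<in> {0..S}" for s
      using that S t by auto
    have c: "continuous_on ({0..S} \<times> cball w 1) (\<lambda>(s, y). ph (t + s) x y)"
    proof -
      have "continuous_on ({0..S} \<times> cball w 1) (\<lambda>z. (\<lambda>(t, w). ph t x w) (t + fst z, snd z))"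
        using ts by (intro continuous_on_compose2[OF cont] continuous_intros) auto
      then show ?thesis by (simp add: case_prod_unfold)
    qed
    obtain u where u: "u 0 = w"
      "\<And>s. s \<in> {0..S} \<Longrightarrow> (u has_vector_derivative ph (t + s) x (u s)) (at s within {0..S})"
      using picard_lindelof[OF S(1) zero_le_one c B[OF ts] SBL(1) L(2)[OF ts singletonI] L(1) SBL(2)] by blast
    define k where "k r = ?c (u (r - t)) ?m" for r
    have k: "(?m, k r) \<in> X" if "r \<in> {t..t + S}" for r
    proof (rule ODE[of t "t + S" k ?m r])
      show "k r \<in> fiber E ?m" for r
        unfolding k_def by (rule triv_const_section[OF V dom(2)[OF x]])
      show "(?m, k t) \<in> X"
        using w u(1) by (simp add: k_def Xh_def)
      fix r assume r: "r \<in> {t..t + S}"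
      have shift: "((\<lambda>r. u (r - t)) has_vector_derivative ph r x (u (r - t))) (at r within {t..t + S})"
      proof -
        have "((\<lambda>r. r - t) has_vector_derivative 1) (at r within {t..t + S})"
          by (auto intro!: derivative_eq_intros)
        moreover have "(u has_vector_derivative ph r x (u (r - t))) (at (r - t) within (\<lambda>r. r - t) ` {t..t + S})"
          using u(2)[of "r - t"] r by (auto intro: has_vector_derivative_within_subset)
        ultimately show ?thesis
          using vector_diff_chain_within[of "\<lambda>r. r - t" 1 r "{t..t + S}" u] by (simp add: o_def)
      qed
      show "has_fiber_derivative E ?m k (\<phi> r ?m (k r)) (at r within {t..t + S})"
        unfolding has_fiber_derivative_def
      proof safe
        fix V' \<tau>' assume V': "(V', \<tau>') \<in> trivs E" "?m \<in> V'"
        \<comment> \<open>A fiber derivative has to be verified in every trivialization; over the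
          single point \<open>?m\<close> the change from \<open>\<tau>\<close> is one fixed linear
          map.\<close>
        have "linear (\<lambda>v. \<tau>' ?m (?c v ?m))"
        proof (rule linearI)
          note ca = const_section_add[OF V dom(2)[OF x]] and fib = triv_const_section(1)[OF V dom(2)[OF x]]
          show "\<tau>' ?m (?c (v + v') ?m) = \<tau>' ?m (?c v ?m) + \<tau>' ?m (?c v' ?m)" for v v'
            using ca[of 1 v 1 v'] by (simp add: triv(3)[OF V'] fib)
          show "\<tau>' ?m (?c (a *\<^sub>R v) ?m) = a *\<^sub>R \<tau>' ?m (?c v ?m)" for a v
            using ca[of a v 0 v] by (simp add: triv(4)[OF V'] fib)
        qed
        then have "bounded_linear (\<lambda>v. \<tau>' ?m (?c v ?m))"
          by (simp add: linear_conv_bounded_linear)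
        from bounded_linear.has_vector_derivative[OF this shift]
        have "((\<lambda>r. \<tau>' ?m (k r)) has_vector_derivative \<tau>' ?m (?c (ph r x (u (r - t))) ?m)) (at r within {t..t + S})"
          by (simp add: k_def)
        moreover have "?c (ph r x (u (r - t))) ?m = \<phi> r ?m (k r)"
        proof -
          have "k r \<in> fiber E ?m"
            unfolding k_def by (rule triv_const_section[OF V dom(2)[OF x]])
          then have "\<phi> r ?m (k r) \<in> fiber E ?m"
            using phi r t S by (auto simp: vertical_vector_field_def)
          from triv_const_section(3)[OF V dom(2)[OF x] this] show ?thesis
            by (simp add: ph_def k_def)
        qed
        ultimately show "((\<lambda>r. \<tau>' ?m (k r)) has_vector_derivative \<tau>' ?m (\<phi> r ?m (k r))) (at r within {t..t + S})"
          by simp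
      qed
    qed (use that S t in auto)
    have uX: "u s \<in> Xh x" if "s \<in> {0..S}" for s
      using k[of "t + s"] that by (simp add: k_def Xh_def)
    show ?thesis
    proof (rule one_sided_max_first[OF S(1), of "\<lambda>s. \<nu> \<bullet> (u s - w)"])
      have "((\<lambda>s. u s - w) has_vector_derivative ph t x w) (at 0 within {0..S})"
        using u(2)[of 0] u(1) S(1) by (auto intro!: derivative_eq_intros)
      from bounded_linear.has_vector_derivative[OF bounded_linear_inner_right this]
      show "((\<lambda>s. \<nu> \<bullet> (u s - w)) has_real_derivative \<nu> \<bullet> ph t x w) (at 0 within {0..S})"
        by (simp add: has_real_derivative_iff_has_vector_derivative)
      show "\<nu> \<bullet> (u s - w) \<le> 0" if "s \<in> {0..S}" for s
        using \<nu>[OF uX[OF that]] by (simp add: inner_diff_right)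
    qed (simp add: u(1))
  qed
  \<comment> \<open>At the final time no forward solution is available, so the inequality there is a
    limit of earlier ones.\<close>
  have cl: "closure {0..<\<epsilon>} = {0..\<epsilon>}"
    using eps by simp
  have "continuous_on {0..\<epsilon>} (\<lambda>t. (\<lambda>(t, w). ph t x w) (t, w))"
    by (intro continuous_on_compose2[OF cont] continuous_intros) auto
  then have "continuous_on (closure {0..<\<epsilon>}) (\<lambda>t. \<nu> \<bullet> ph t x w)"
    unfolding cl by (intro continuous_intros) simp
  then show ?thesis
    by (rule continuous_le_on_closure) (use t main cl in auto)
qed

end

section \<open>The estimate at a spatial maximum\<close>

context flow_box
begin

text \<open>A spatial maximum of \<rho> d over the ball, with nearest point \<open>w\<close> and
  unit normal \<open>\<nu>\<close>. It is a predicate so that constants valid at all such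
  configurations can be fixed before the weight in time, and with it the maximum, is chosen.\<close>

definition touching :: "'a \<Rightarrow> real \<Rightarrow> real \<Rightarrow> 'a \<Rightarrow> 'f \<Rightarrow> 'f \<Rightarrow> bool" where
  "touching xc R t x \<nu> w \<longleftrightarrow> t \<in> {0..\<epsilon>} \<and> norm (x - xc) < R \<and>
    (\<forall>y\<in>cball xc R. (R\<^sup>2 - (norm (y - xc))\<^sup>2) * gap t y \<le> (R\<^sup>2 - (norm (x - xc))\<^sup>2) * gap t x) \<and>
    norm \<nu> = 1 \<and> fh t x = w + gap t x *\<^sub>R \<nu> \<and> w \<in> Xh x \<and> (\<forall>y\<in>Xh x. \<nu> \<bullet> y \<le> \<nu> \<bullet> w)"

text \<open>The one-dimensional test along the segment \<open>x + s *\<^sub>R e\<close>, with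
  \<open>r s\<close> the weight \<rho> on the segment. Its first derivative at 0 is
  \<open>- 2 * ((x - xc) \<bullet> e)\<close>, its second
  \<open>- 2 * (norm e)\<^sup>2\<close>.\<close>

lemma covd_line_inequality:
  assumes K: "cball xc R \<subseteq> dom" and touching: "touching xc R t x \<nu> w"
    and L: "0 \<le> L" "\<And>x e w. x \<in> cball xc R \<Longrightarrow> norm (coef t x e w) \<le> L * norm e * norm w"
    and L1: "\<And>x e b. x \<in> cball xc R \<Longrightarrow> b \<in> Basis \<Longrightarrow> norm (dcoef t x b e e) \<le> L1 * norm e * norm e"
  defines "\<rho> \<equiv> R\<^sup>2 - (norm (x - xc))\<^sup>2" and "\<delta> \<equiv> gap t x"
  shows "(\<nu> \<bullet> covd t (f t) x e) * \<rho> - \<delta> * (2 * ((x - xc) \<bullet> e)) \<le> \<rho> * \<delta> * (\<nu> \<bullet> coef t x e \<nu>)" (is ?A)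
    and "(\<nu> \<bullet> covd t (f t) x e) * \<rho> - \<delta> * (2 * ((x - xc) \<bullet> e)) = \<rho> * \<delta> * (\<nu> \<bullet> coef t x e \<nu>) \<Longrightarrow>
      (\<nu> \<bullet> frechet_derivative (\<lambda>y. covd t (f t) y e) (at x) e + \<nu> \<bullet> coef t x e (covd t (f t) x e)) * \<rho>
        - 4 * (\<nu> \<bullet> covd t (f t) x e) * ((x - xc) \<bullet> e) - 2 * \<delta> * (norm e)\<^sup>2
      \<le> \<rho> * \<delta> * (2 * (L * norm e)\<^sup>2 + DIM('f) * (L1 * norm e * norm e))" (is "?B \<Longrightarrow> ?C")
proof -
  have t: "t \<in> {0..\<epsilon>}" and x: "norm (x - xc) < R"
    and max: "\<And>y. y \<in> cball xc R \<Longrightarrow>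
      (R\<^sup>2 - (norm (y - xc))\<^sup>2) * gap t y \<le> (R\<^sup>2 - (norm (x - xc))\<^sup>2) * \<delta>"
    and \<delta>: "0 \<le> \<delta>" and \<nu>: "norm \<nu> = 1" "fh t x = w + \<delta> *\<^sub>R \<nu>" "\<And>y. y \<in> Xh x \<Longrightarrow> \<nu> \<bullet> y \<le> \<nu> \<bullet> w"
    using touching gap_nonneg by (auto simp: touching_def \<delta>_def)
  \<comment> \<open>The segment must stay in the ball, where maximality and the bounds hold; the
    summand 1 covers \<open>e = 0\<close>.\<close>
  define S where "S = (R - norm (x - xc)) / (norm e + 1)"
  have S: "0 < S"
    using x by (simp add: S_def add_nonneg_pos)
  have Se: "S * norm e \<le> R - norm (x - xc)"
  proof -
    have "norm e / (norm e + 1) \<le> 1"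
      by (simp add: add_nonneg_pos)
    then have "(R - norm (x - xc)) * (norm e / (norm e + 1)) \<le> (R - norm (x - xc)) * 1"
      using x by (intro mult_left_mono) auto
    then show ?thesis
      by (simp add: S_def)
  qed
  define l where "l s = x + s *\<^sub>R e" for s :: real
  have lK: "l s \<in> cball xc R" if s: "s \<in> {0..S}" for s
  proof -
    have "norm (l s - xc) \<le> norm (x - xc) + s * norm e"
      using norm_triangle_ineq[of "x - xc" "s *\<^sub>R e"] s by (simp add: l_def algebra_simps)
    also have "s * norm e \<le> S * norm e"
      using s by (intro mult_right_mono) auto
    finally show ?thesis
      using Se by (simp add: dist_norm norm_minus_commute)
  qed
  then have ld: "l s \<in> dom" if "s \<in> {0..S}" for s
    using K that by blast
  have l0: "l 0 = x"
    by (simp add: l_def)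
  have dl: "(l has_vector_derivative e) F" for F
    unfolding l_def has_vector_derivative_def by (auto intro!: derivative_eq_intros)
  have chain: "((\<lambda>s. h (l s)) has_vector_derivative h' e) (at s within {0..S})"
    if "(h has_derivative h') (at (l s))" for h h' and s :: real
    using vector_derivative_diff_chain_within[OF dl has_derivative_at_withinI[OF that]] by (simp add: o_def)
  have 0: "0 \<in> {0..S}"
    using S by simp
  let ?r = "\<lambda>s. R\<^sup>2 - (l s - xc) \<bullet> (l s - xc)" and ?r1 = "\<lambda>s. - (2 * ((l s - xc) \<bullet> e))"
  have dr: "(?r has_real_derivative ?r1 s) (at s within {0..S})"
    "(?r1 has_real_derivative - (2 * (e \<bullet> e))) (at s within {0..S})" for s
  proof -
    have d: "((\<lambda>s. l s - xc) has_vector_derivative e) (at s within {0..S})"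
      using dl by (auto intro!: derivative_eq_intros)
    from bounded_bilinear.has_vector_derivative[OF bounded_bilinear_inner d d]
    have "((\<lambda>s. (l s - xc) \<bullet> (l s - xc)) has_real_derivative 2 * ((l s - xc) \<bullet> e)) (at s within {0..S})"
      by (simp add: has_real_derivative_iff_has_vector_derivative inner_commute)
    then show "(?r has_real_derivative ?r1 s) (at s within {0..S})"
      by (auto intro!: derivative_eq_intros)
    from bounded_linear.has_vector_derivative[OF bounded_linear_inner_left d]
    have "((\<lambda>s. (l s - xc) \<bullet> e) has_real_derivative e \<bullet> e) (at s within {0..S})"
      by (simp add: has_real_derivative_iff_has_vector_derivative)
    then show "(?r1 has_real_derivative - (2 * (e \<bullet> e))) (at s within {0..S})"
      by (auto intro!: derivative_eq_intros)
  qed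
  have smooth_f: "smooth_on dom (rep (f t))"
    by (rule smooth_rep_dom[OF f_section[OF t]]) auto
  have coef_cont: "continuous_on {0..S} (\<lambda>s. coef t (l s) e b)" for b
  proof -
    have "continuous_on {0..S} l"
      unfolding l_def by (intro continuous_intros)
    moreover have "l ` {0..S} \<subseteq> dom"
      using ld by auto
    ultimately show ?thesis
      using continuous_on_compose2[OF smooth_on_imp_continuous_on[OF smooth_on_slice[OF smooth_coef t, of e b]]]
      by simp
  qed
  have coef_deriv: "((\<lambda>s. coef t (l s) e b) has_vector_derivative dcoef t x b e e) (at 0 within {0..S})" for b
    using chain[OF has_derivative_coef[OF t ld[OF 0], of e b]] by (simp add: l0)
  have f_deriv: "((\<lambda>s. fh t (l s)) has_vector_derivative covd t (f t) (l s) e - coef t (l s) e (fh t (l s)))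
      (at s within {0..S})" if "s \<in> {0..S}" for s
  proof -
    have "(rep (f t) has_derivative frechet_derivative (rep (f t)) (at (l s))) (at (l s))"
      by (rule frechet_derivative_worksI[OF smooth_on_differentiable[OF smooth_f open_dom ld[OF that]]])
    from chain[OF this] show ?thesis
      by (simp add: fh_def covd_def)
  qed
  have covd_deriv: "((\<lambda>s. covd t (f t) (l s) e) has_vector_derivative
      frechet_derivative (\<lambda>y. covd t (f t) y e) (at x) e) (at 0 within {0..S})"
    using chain[OF frechet_derivative_worksI[OF smooth_on_differentiable[OF
          smooth_covd[OF f_section[OF t] t, of e] open_dom ld[OF 0]]]] by (simp add: l0)
  have r_nonneg: "0 \<le> ?r s" if "s \<in> {0..S}" for s
    using lK[OF that] power_mono[of "norm (l s - xc)" R 2]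
    by (simp add: dot_square_norm dist_norm norm_minus_commute)
  \<comment> \<open>Transport from \<open>l s\<close> back to \<open>l 0\<close> runs in the
    direction \<open>- e\<close>, and linearity of the connection form in the direction turns its
    sign into the one required here.\<close>
  have transport: "z s \<in> Xh (l 0)" if s: "s \<in> {0<..S}" and z: "z 0 \<in> Xh (l s)"
    "\<And>q. q \<in> {0..s} \<Longrightarrow> (z has_vector_derivative coef t (l (s - q)) e (z q)) (at q within {0..s})" for s z
  proof -
    have eq: "l s + q *\<^sub>R (- e) = l (s - q)" for q
      by (simp add: l_def algebra_simps)
    have ls: "l (s - q) \<in> dom" if "q \<in> {0..s}" for q
      using ld[of "s - q"] that s by auto
    have "z s \<in> Xh (l s + s *\<^sub>R (- e))"
    proof (rule Xh_transport[OF t])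
      fix q assume q: "q \<in> {0..s}"
      show "l s + q *\<^sub>R - e \<in> dom"
        unfolding eq by (rule ls[OF q])
      have "- coef t (l (s - q)) (- e) (z q) = coef t (l (s - q)) e (z q)"
        using linear_neg[OF linear_coef_direction[OF t ls[OF q], of "z q"], of e] by simp
      then show "(z has_vector_derivative - coef t (l s + q *\<^sub>R - e) (- e) (z q)) (at q within {0..s})"
        using z(2)[OF q] unfolding eq by simp
    qed (use s z in auto)
    then show ?thesis
      unfolding eq by simp
  qed
  have max': "?r s * infdist (fh t (l s)) (Xh (l s)) \<le> ?r 0 * \<delta>" if "s \<in> {0..S}" for s
    using max[OF lK[OF that]] by (simp add: gap_def l0 dot_square_norm)
  have "0 \<le> L * norm e" "fh t (l 0) = w + \<delta> *\<^sub>R \<nu>" "\<And>y. y \<in> Xh (l 0) \<Longrightarrow> \<nu> \<bullet> y \<le> \<nu> \<bullet> w"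
    using L(1) \<nu>(2,3) by (simp_all add: l0)
  note line = spatial_max_along_line[of S "\<lambda>s. coef t (l s) e" "L * norm e" "\<lambda>b. dcoef t x b e e"
      "L1 * norm e * norm e" "\<lambda>s. fh t (l s)" "\<lambda>s. covd t (f t) (l s) e"
      "frechet_derivative (\<lambda>y. covd t (f t) y e) (at x) e" ?r ?r1 "- (2 * (e \<bullet> e))" "\<lambda>s. Xh (l s)" \<delta> \<nu> w,
      OF S linear_coef[OF t ld, of _ e] coef_cont L(2)[OF lK, of _ e] this(1) coef_deriv
      L1[OF lK[OF 0], unfolded l0, of _ e] f_deriv covd_deriv r_nonneg dr closed_Xh[OF ld] Xh_nonempty[OF ld]
      _ max' \<delta> \<nu>(1) this(2,3)]
  have main1: "(\<nu> \<bullet> covd t (f t) (l 0) e) * ?r 0 + \<delta> * ?r1 0 \<le> ?r 0 * \<delta> * (\<nu> \<bullet> coef t (l 0) e \<nu>)"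
  proof (rule line(1))
    fix s z assume "s \<in> {0<..S}" "z 0 \<in> Xh (l s)"
      "\<And>q. q \<in> {0..s} \<Longrightarrow> (z has_vector_derivative coef t (l (s - q)) e (z q)) (at q within {0..s})"
    then show "z s \<in> Xh (l 0)"
      by (rule transport)
  qed
  have main2: "(\<nu> \<bullet> frechet_derivative (\<lambda>y. covd t (f t) y e) (at x) e +
        \<nu> \<bullet> coef t (l 0) e (covd t (f t) (l 0) e)) * ?r 0
        + 2 * (\<nu> \<bullet> covd t (f t) (l 0) e) * ?r1 0 + \<delta> * - (2 * (e \<bullet> e))
      \<le> ?r 0 * \<delta> * (2 * (L * norm e)\<^sup>2 + DIM('f) * (L1 * norm e * norm e))"
    if eq: "(\<nu> \<bullet> covd t (f t) (l 0) e) * ?r 0 + \<delta> * ?r1 0 = ?r 0 * \<delta> * (\<nu> \<bullet> coef t (l 0) e \<nu>)"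
  proof (rule line(2))
    show "(\<nu> \<bullet> covd t (f t) (l 0) e) * ?r 0 + \<delta> * ?r1 0 = ?r 0 * \<delta> * (\<nu> \<bullet> coef t (l 0) e \<nu>)"
      by (rule eq)
  next
    fix s z assume "s \<in> {0<..S}" "z 0 \<in> Xh (l s)"
      "\<And>q. q \<in> {0..s} \<Longrightarrow> (z has_vector_derivative coef t (l (s - q)) e (z q)) (at q within {0..s})"
    then show "z s \<in> Xh (l 0)"
      by (rule transport)
  qed
  have r0: "?r 0 = \<rho>"
    by (simp add: l0 \<rho>_def dot_square_norm)
  show ?A
    using main1 unfolding r0 unfolding l0 by simp
  show ?C if ?B
    using main2 that unfolding r0 unfolding l0 by (simp add: dot_square_norm)
qed

text \<open>Both sides of the first-order inequality are odd in \<open>e\<close>, so testing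
  \<open>e\<close> and \<open>- e\<close> gives equality. This bounds every
  \<open>\<nu> \<bullet> covd t (f t) x e\<close> by a multiple of the gap and opens the
  second-order test, whose remaining terms are then multiples of the gap too.\<close>

lemma spatial_estimate:
  assumes K: "cball xc R \<subseteq> dom" and \<kappa>: "0 < \<kappa>" and R: "0 < R"
  obtains C where "0 \<le> C"
    "\<And>t x e \<nu> w. touching xc R t x \<nu> w \<Longrightarrow> \<kappa> \<le> R\<^sup>2 - (norm (x - xc))\<^sup>2 \<Longrightarrow>
      \<nu> \<bullet> (frechet_derivative (\<lambda>y. covd t (f t) y e) (at x) e + coef t x e (covd t (f t) x e)
        - covd t (f t) x (tan.coef 0 x e e)) \<le> C * gap t x * (norm e)\<^sup>2"
proof -
  obtain L where L: "0 \<le> L"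
    "\<And>t x e w. t \<in> {0..\<epsilon>} \<Longrightarrow> x \<in> cball xc R \<Longrightarrow> norm (coef t x e w) \<le> L * norm e * norm w"
    using coef_bound[OF compact_Icc order_refl compact_cball K] by blast
  have "\<exists>L1\<ge>0. \<forall>t\<in>{0..\<epsilon>}. \<forall>x\<in>cball xc R. \<forall>e h. norm (dcoef t x b e h) \<le> L1 * norm e * norm h" for b
    using dcoef_bound[OF compact_Icc order_refl compact_cball K, of b] by metis
  then obtain l1 where l1: "\<And>b. 0 \<le> l1 b"
    "\<And>b t x e h. t \<in> {0..\<epsilon>} \<Longrightarrow> x \<in> cball xc R \<Longrightarrow> norm (dcoef t x b e h) \<le> l1 b * norm e * norm h"
    by metis
  define L1 where "L1 = (\<Sum>b\<in>Basis. l1 b)"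
  have L1: "norm (dcoef t x b e e) \<le> L1 * norm e * norm e"
    if "t \<in> {0..\<epsilon>}" "x \<in> cball xc R" "b \<in> Basis" for t x e b
  proof -
    have "l1 b \<le> L1"
      unfolding L1_def using that(3) l1(1) by (intro member_le_sum) auto
    then have "l1 b * norm e * norm e \<le> L1 * norm e * norm e"
      by (intro mult_right_mono) auto
    with l1(2)[OF that(1,2)] show ?thesis
      by (rule order_trans)
  qed
  have L1_nonneg: "0 \<le> L1"
    unfolding L1_def by (intro sum_nonneg l1(1))
  have K': "cball xc R \<subseteq> tan.dom"
    using K dom_subset_tan by blast
  obtain H where H: "0 \<le> H"
    "\<And>x e w. x \<in> cball xc R \<Longrightarrow> norm (tan.coef 0 x e w) \<le> H * norm e * norm w"
    using tan.coef_bound[OF compact_sing[of 0] subset_UNIV compact_cball K'] by (metis singletonI)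
  \<comment> \<open>Solving the first-order equality gives
    \<open>q e = \<delta> * a e + 2 * \<delta> * p e / \<rho>\<close>; the bounds \<open>L\<close>
    on \<open>a\<close>, \<open>R\<close> on \<open>p\<close> and
    \<open>\<kappa> \<le> \<rho>\<close> yield this constant.\<close>
  define Q where "Q = L + 2 * R / \<kappa>"
  have Q: "0 \<le> Q"
    using L(1) R \<kappa> by (simp add: Q_def)
  define C where "C = 2 * L\<^sup>2 + DIM('f) * L1 + (4 * Q * R + 2) / \<kappa> + Q * H"
  show ?thesis
  proof (rule that[of C])
    show "0 \<le> C"
      using L(1) L1_nonneg Q H(1) R \<kappa> by (simp add: C_def)
    fix t x e \<nu> w
    assume touching: "touching xc R t x \<nu> w" and \<kappa>': "\<kappa> \<le> R\<^sup>2 - (norm (x - xc))\<^sup>2"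
    then have t: "t \<in> {0..\<epsilon>}" and x: "norm (x - xc) < R" and \<nu>: "norm \<nu> = 1"
      by (auto simp: touching_def)
    define \<delta> where "\<delta> = gap t x"
    have \<delta>: "0 \<le> \<delta>"
      by (simp add: \<delta>_def gap_nonneg)
    define \<rho> where "\<rho> = R\<^sup>2 - (norm (x - xc))\<^sup>2"
    have \<rho>: "\<kappa> \<le> \<rho>" "0 < \<rho>"
      using \<kappa> \<kappa>' by (auto simp: \<rho>_def)
    have xK: "x \<in> cball xc R"
      using x by (simp add: dist_norm norm_minus_commute)
    then have xd: "x \<in> dom"
      using K by blast
    note line = covd_line_inequality[OF K touching L(1) L(2)[OF t] L1[OF t], folded \<rho>_def \<delta>_def]
    define q where "q e = \<nu> \<bullet> covd t (f t) x e" for e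
    define a where "a e = \<nu> \<bullet> coef t x e \<nu>" for e
    define p where "p e = (x - xc) \<bullet> e" for e
    have "linear (covd t (f t) x)"
      by (rule linear_covd[OF f_section[OF t] open_UNIV t xd UNIV_I])
    then have q_neg: "q (- e) = - q e" for e
      by (simp add: q_def linear_neg)
    have a_neg: "a (- e) = - a e" for e
      using linear_neg[OF linear_coef_direction[OF t xd, of \<nu>], of e] by (simp add: a_def)
    \<comment> \<open>The two inequalities for \<open>e\<close> and \<open>- e\<close> are opposite
      to each other.\<close>
    have first: "q e * \<rho> - \<delta> * (2 * p e) = \<rho> * \<delta> * a e" for e
      using line(1)[of e] line(1)[of "- e"] q_neg[of e] a_neg[of e]
      unfolding q_def[symmetric] a_def[symmetric] p_def[symmetric]
      by (auto simp: p_def)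
    have p_le: "\<bar>p e\<bar> \<le> R * norm e" for e
    proof -
      have "\<bar>p e\<bar> \<le> norm (x - xc) * norm e"
        unfolding p_def by (rule Cauchy_Schwarz_ineq2)
      also have "\<dots> \<le> R * norm e"
        using x by (intro mult_right_mono) auto
      finally show ?thesis .
    qed
    have a_le: "\<bar>a e\<bar> \<le> L * norm e" for e
      using Cauchy_Schwarz_ineq2[of \<nu> "coef t x e \<nu>"] L(2)[OF t xK, of e \<nu>] \<nu> by (simp add: a_def)
    have q_le: "\<bar>q e\<bar> \<le> \<delta> * Q * norm e" for e
    proof -
      have "q e = \<delta> * a e + \<delta> * (2 * p e) / \<rho>"
        using first[of e] \<rho>(2) by (simp add: field_simps)
      then have "\<bar>q e\<bar> \<le> \<delta> * \<bar>a e\<bar> + \<delta> * (2 * \<bar>p e\<bar>) / \<rho>"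
        using \<delta> \<rho>(2) abs_triangle_ineq[of "\<delta> * a e" "\<delta> * (2 * p e) / \<rho>"] by (simp add: abs_mult)
      also have "\<dots> \<le> \<delta> * (L * norm e) + \<delta> * (2 * (R * norm e)) / \<kappa>"
        using \<delta> \<rho> \<kappa> R p_le[of e] a_le[of e]
        by (intro add_mono mult_left_mono frac_le) auto
      finally show ?thesis
        by (simp add: Q_def algebra_simps)
    qed
    define \<mu> where "\<mu> = \<nu> \<bullet> frechet_derivative (\<lambda>y. covd t (f t) y e) (at x) e
      + \<nu> \<bullet> coef t x e (covd t (f t) x e)"
    let ?n = "(norm e)\<^sup>2"
    have "\<mu> * \<rho> - 4 * q e * p e - 2 * \<delta> * ?n \<le> \<rho> * \<delta> * (2 * L\<^sup>2 + DIM('f) * L1) * ?n"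
      using line(2)[of e] first[of e]
      unfolding \<mu>_def q_def p_def a_def by (simp add: power_mult_distrib power2_eq_square algebra_simps)
    moreover have "q e * p e \<le> \<delta> * Q * R * ?n"
    proof -
      have "q e * p e \<le> \<bar>q e\<bar> * \<bar>p e\<bar>"
        by (metis abs_ge_self abs_mult)
      also have "\<dots> \<le> (\<delta> * Q * norm e) * (R * norm e)"
        using q_le[of e] p_le[of e] \<delta> Q by (intro mult_mono) auto
      finally show ?thesis
        by (simp add: power2_eq_square algebra_simps)
    qed
    ultimately have "\<mu> * \<rho> \<le> \<rho> * (\<delta> * (2 * L\<^sup>2 + DIM('f) * L1) * ?n) + \<delta> * (4 * Q * R + 2) * ?n"
      by (simp add: algebra_simps)
    \<comment> \<open>The terms produced by the derivatives of the weight carry no factor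
      \<open>\<rho>\<close>; since \<open>1 \<le> \<rho> / \<kappa>\<close>, one can be inserted and
      later divided out.\<close>
    also have "\<delta> * (4 * Q * R + 2) * ?n \<le> \<rho> * (\<delta> * ((4 * Q * R + 2) / \<kappa>) * ?n)"
    proof -
      have "1 \<le> \<rho> / \<kappa>"
        using \<rho> \<kappa> by simp
      from mult_left_mono[OF this, of "\<delta> * (4 * Q * R + 2) * ?n"] show ?thesis
        using \<delta> Q R by (simp add: algebra_simps add_divide_distrib)
    qed
    finally have "\<rho> * \<mu> \<le> \<rho> * (\<delta> * (2 * L\<^sup>2 + DIM('f) * L1 + (4 * Q * R + 2) / \<kappa>) * ?n)"
      by (simp add: algebra_simps)
    then have "\<mu> \<le> \<delta> * (2 * L\<^sup>2 + DIM('f) * L1 + (4 * Q * R + 2) / \<kappa>) * ?n"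
      using \<rho>(2) by simp
    \<comment> \<open>The contribution of \<open>NT\<close> is of first order in the section and is
      controlled by the bound on \<open>q\<close>; no compatibility of \<open>NT\<close> with the
      metric enters.\<close>
    moreover have "- q (tan.coef 0 x e e) \<le> \<delta> * (Q * H) * ?n"
    proof -
      have "- q (tan.coef 0 x e e) \<le> \<delta> * Q * norm (tan.coef 0 x e e)"
        using q_le[of "tan.coef 0 x e e"] by simp
      also have "\<dots> \<le> \<delta> * Q * (H * norm e * norm e)"
        using H(2)[OF xK, of e e] \<delta> Q by (intro mult_left_mono) auto
      finally show ?thesis
        by (simp add: power2_eq_square algebra_simps)
    qed
    ultimately have "\<mu> - q (tan.coef 0 x e e) \<le> C * \<delta> * ?n"
      by (simp add: C_def algebra_simps)
    then show "\<nu> \<bullet> (frechet_derivative (\<lambda>y. covd t (f t) y e) (at x) e + coef t x e (covd t (f t) x e)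
        - covd t (f t) x (tan.coef 0 x e e)) \<le> C * gap t x * ?n"
      by (simp add: \<mu>_def q_def \<delta>_def inner_add_right inner_diff_right)
  qed
qed

text \<open>The choice operator in \<open>metric_trace\<close> returns an orthonormal basis because
  one exists. The unit length of its vectors is what bounds their coordinates later.\<close>

lemma laplacian_sum:
  assumes "t \<in> {0..\<epsilon>}"
  obtains e :: "'a \<Rightarrow> 'a" where "\<And>i. i \<in> Basis \<Longrightarrow> g t m (e i) (e i) = 1"
    "laplacian A (g t) NT (N t) s m =
      (\<Sum>i\<in>Basis. form_connection A NT (N t) (\<lambda>p u. N t p u s) m (e i) (e i))"
proof -
  define e where "e = (SOME e :: 'a \<Rightarrow> 'a. \<forall>i\<in>Basis. \<forall>j\<in>Basis. g t m (e i) (e j) = (if i = j then 1 else 0))"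
  have "\<forall>i\<in>Basis. \<forall>j\<in>Basis. g t m (e i) (e j) = (if i = j then 1 else 0)"
    unfolding e_def
    by (rule someI_ex[OF exists_orthonormal_basis[OF g_bilinear(1,2,3)[OF assms]]])
  then have 1: "g t m (e i) (e i) = 1" if "i \<in> Basis" for i
    using that by auto
  have "laplacian A (g t) NT (N t) s m =
      (\<Sum>i\<in>Basis. form_connection A NT (N t) (\<lambda>p u. N t p u s) m (e i) (e i))"
    unfolding laplacian_def metric_trace_def Let_def e_def by (rule refl)
  with 1 show ?thesis
    by (rule that)
qed

text \<open>The Laplacian is a sum of second covariant derivatives in the directions of a frame of
  bounded coordinate length. The reaction term is compared with its value at the nearest point,
  where the normal component is not positive; the difference is Lipschitz in the distance.\<close>

lemma evolution_estimate:
  assumes K: "cball xc R \<subseteq> dom" and \<kappa>: "0 < \<kappa>" and R: "0 < R"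
  obtains C where "0 \<le> C"
    "\<And>t x \<nu> w. touching xc R t x \<nu> w \<Longrightarrow> \<kappa> \<le> R\<^sup>2 - (norm (x - xc))\<^sup>2 \<Longrightarrow>
      \<nu> \<bullet> \<tau> (ci x) (laplacian A (g t) NT (N t) (f t) (ci x) + \<phi> t (ci x) (f t (ci x))) \<le> C * gap t x"
proof -
  obtain C1 where C1: "0 \<le> C1"
    "\<And>t x e \<nu> w. touching xc R t x \<nu> w \<Longrightarrow> \<kappa> \<le> R\<^sup>2 - (norm (x - xc))\<^sup>2 \<Longrightarrow>
      \<nu> \<bullet> (frechet_derivative (\<lambda>y. covd t (f t) y e) (at x) e + coef t x e (covd t (f t) x e)
        - covd t (f t) x (tan.coef 0 x e e)) \<le> C1 * gap t x * (norm e)\<^sup>2"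
    by (rule spatial_estimate[OF K \<kappa> R]) blast
  obtain G where G: "0 \<le> G" "\<And>t x v. t \<in> {0..\<epsilon>} \<Longrightarrow> x \<in> cball xc R \<Longrightarrow> g t (ci x) v v = 1 \<Longrightarrow>
      norm (differential A c (ci x) v) \<le> G"
    by (rule orthonormal_frame_bound[OF compact_cball K]) blast
  \<comment> \<open>The nearest point \<open>w\<close> is within \<open>B\<close> of a value of norm
    at most \<open>F\<close>, so the ball of radius \<open>F + B\<close> contains both arguments of
    the reaction term.\<close>
  obtain B where B: "\<And>t x. t \<in> {0..\<epsilon>} \<Longrightarrow> x \<in> cball xc R \<Longrightarrow> gap t x \<le> B"
    by (rule gap_bounded[OF K]) blast
  have "bounded ((\<lambda>(t, x). fh t x) ` ({0..\<epsilon>} \<times> cball xc R))"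
    by (rule bounded_smooth_image[OF smooth_fh compact_Icc compact_cball K])
  then obtain F where F: "\<And>t x. t \<in> {0..\<epsilon>} \<Longrightarrow> x \<in> cball xc R \<Longrightarrow> norm (fh t x) \<le> F"
    unfolding bounded_iff by fastforce
  obtain L where L: "0 \<le> L" "\<And>t x w w'. t \<in> {0..\<epsilon>} \<Longrightarrow> x \<in> cball xc R \<Longrightarrow> w \<in> cball 0 (F + B) \<Longrightarrow>
      w' \<in> cball 0 (F + B) \<Longrightarrow> norm (ph t x w - ph t x w') \<le> L * norm (w - w')"
    by (rule ph_lipschitz[OF compact_cball K, of 0 "F + B"]) blast
  define C where "C = DIM('a) * (C1 * G\<^sup>2) + L"
  show ?thesis
  proof (rule that[of C])
    show "0 \<le> C"
      using C1(1) L(1) by (simp add: C_def)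
    fix t x \<nu> w
    assume touching: "touching xc R t x \<nu> w" and \<kappa>': "\<kappa> \<le> R\<^sup>2 - (norm (x - xc))\<^sup>2"
    then have t: "t \<in> {0..\<epsilon>}" and x: "norm (x - xc) < R"
      and \<nu>: "norm \<nu> = 1" "fh t x = w + gap t x *\<^sub>R \<nu>" and w: "w \<in> Xh x"
      and supp: "\<And>y. y \<in> Xh x \<Longrightarrow> \<nu> \<bullet> y \<le> \<nu> \<bullet> w"
      by (auto simp: touching_def)
    let ?m = "ci x"
    have xK: "x \<in> cball xc R"
      using x by (simp add: dist_norm norm_minus_commute)
    then have xd: "x \<in> dom"
      using K by blast
    note m = dom(1,2)[OF xd]
    obtain e :: "'a \<Rightarrow> 'a" where e: "\<And>i. i \<in> Basis \<Longrightarrow> g t ?m (e i) (e i) = 1"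
      "laplacian A (g t) NT (N t) (f t) ?m =
        (\<Sum>i\<in>Basis. form_connection A NT (N t) (\<lambda>p u. N t p u (f t)) ?m (e i) (e i))"
      by (rule laplacian_sum[OF t, of ?m "f t"]) blast
    note fc = form_connection_rep[OF NT f_section[OF t] t m, unfolded dom(3)[OF xd]]
    have lap_fib: "laplacian A (g t) NT (N t) (f t) ?m \<in> fiber E ?m"
      unfolding e(2) by (intro subspace_sum[OF subspace_fiber] fc(1))
    have "\<nu> \<bullet> \<tau> ?m (laplacian A (g t) NT (N t) (f t) ?m) =
        (\<Sum>i\<in>Basis. \<nu> \<bullet> \<tau> ?m (form_connection A NT (N t) (\<lambda>p u. N t p u (f t)) ?m (e i) (e i)))"
      unfolding e(2) by (subst triv_sum[OF V m(2)]) (auto intro: fc(1) simp: inner_sum_right)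
    also have "\<dots> \<le> (\<Sum>i\<in>(Basis :: 'a set). C1 * gap t x * G\<^sup>2)"
    proof (rule sum_mono)
      fix i :: 'a assume i: "i \<in> Basis"
      let ?e = "differential A c ?m (e i)"
      have "\<nu> \<bullet> \<tau> ?m (form_connection A NT (N t) (\<lambda>p u. N t p u (f t)) ?m (e i) (e i))
          \<le> C1 * gap t x * (norm ?e)\<^sup>2"
        unfolding fc(2) by (rule C1(2)[OF touching \<kappa>'])
      also have "\<dots> \<le> C1 * gap t x * G\<^sup>2"
        using G(2)[OF t xK e(1)[OF i]] C1(1) gap_nonneg by (intro mult_left_mono power_mono) auto
      finally show "\<nu> \<bullet> \<tau> ?m (form_connection A NT (N t) (\<lambda>p u. N t p u (f t)) ?m (e i) (e i))
          \<le> C1 * gap t x * G\<^sup>2" .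
    qed
    finally have lap: "\<nu> \<bullet> \<tau> ?m (laplacian A (g t) NT (N t) (f t) ?m) \<le> DIM('a) * (C1 * G\<^sup>2) * gap t x"
      by (simp add: algebra_simps)
    have phi_fib: "\<phi> t ?m (f t ?m) \<in> fiber E ?m"
      using phi t f_fiber[OF t] by (auto simp: vertical_vector_field_def)
    have ph: "\<tau> ?m (\<phi> t ?m (f t ?m)) = ph t x (fh t x)"
      using triv_const_section(3)[OF V m(2) f_fiber[OF t]] by (simp add: ph_def fh_def rep_def)
    have w_eq: "fh t x - w = gap t x *\<^sub>R \<nu>"
      using \<nu>(2) by simp
    have "norm w \<le> norm (fh t x) + norm (fh t x - w)"
      using norm_triangle_ineq4[of "fh t x" "fh t x - w"] by simp
    also have "norm (fh t x - w) = gap t x"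
      unfolding w_eq using \<nu>(1) gap_nonneg by simp
    finally have "w \<in> cball 0 (F + B)" "fh t x \<in> cball 0 (F + B)"
      using F[OF t xK] B[OF t xK] gap_nonneg[of t x] by auto
    from L(2)[OF t xK this(2,1)]
    have "norm (ph t x (fh t x) - ph t x w) \<le> L * gap t x"
      unfolding w_eq using \<nu>(1) gap_nonneg by simp
    then have "\<nu> \<bullet> (ph t x (fh t x) - ph t x w) \<le> L * gap t x"
      using norm_cauchy_schwarz[of \<nu> "ph t x (fh t x) - ph t x w"] \<nu>(1) by simp
    moreover have "\<nu> \<bullet> ph t x w \<le> 0"
      by (rule reaction_normal[OF xd t w supp])
    ultimately have "\<nu> \<bullet> \<tau> ?m (\<phi> t ?m (f t ?m)) \<le> L * gap t x"
      by (simp add: ph inner_diff_right)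
    with lap show "\<nu> \<bullet> \<tau> ?m (laplacian A (g t) NT (N t) (f t) ?m + \<phi> t ?m (f t ?m)) \<le> C * gap t x"
      unfolding triv(3)[OF V m(2) lap_fib phi_fib] by (simp add: C_def inner_add_right algebra_simps)
  qed
qed

end

section \<open>The global argument\<close>

text \<open>The half-space supporting the fiber at \<open>w\<close> contains it at all times, as X
  is fixed. So \<open>\<nu> \<bullet> (fh t x - w)\<close> lies below the gap, hence below
  \<open>exp (C * (t - t0)) * gap t0 x\<close>, with equality at \<open>t0\<close>; comparing
  derivatives at \<open>t0\<close> from the past gives the growth.\<close>

lemma (in flow_box) growth_at_max:
  assumes x: "x \<in> dom" and t0: "0 < t0" "t0 \<le> \<epsilon>" and pos: "0 < gap t0 x"
    and max: "\<And>t. t \<in> {0..t0} \<Longrightarrow> gap t x \<le> exp (C * (t - t0)) * gap t0 x"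
  obtains \<nu> w where "norm \<nu> = 1" "fh t0 x = w + gap t0 x *\<^sub>R \<nu>" "w \<in> Xh x"
    "\<And>y. y \<in> Xh x \<Longrightarrow> \<nu> \<bullet> y \<le> \<nu> \<bullet> w"
    "C * gap t0 x \<le> \<nu> \<bullet> \<tau> (ci x) (laplacian A (g t0) NT (N t0) (f t0) (ci x) + \<phi> t0 (ci x) (f t0 (ci x)))"
proof -
  let ?\<delta> = "gap t0 x" and ?m = "ci x"
  note Xh = closed_Xh[OF x] Xh_nonempty[OF x] convex_Xh[OF x]
  obtain w where w: "w \<in> Xh x" "?\<delta> = dist (fh t0 x) w"
    using infdist_attains_inf[OF Xh(1,2)] unfolding gap_def by metis
  define \<nu> where "\<nu> = (1 / ?\<delta>) *\<^sub>R (fh t0 x - w)"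
  have \<nu>: "norm \<nu> = 1" "fh t0 x = w + ?\<delta> *\<^sub>R \<nu>"
    using pos w(2) by (auto simp: \<nu>_def dist_norm)
  have supp: "\<nu> \<bullet> y \<le> \<nu> \<bullet> w" if "y \<in> Xh x" for y
  proof -
    have "\<forall>z\<in>Xh x. dist (fh t0 x) w \<le> dist (fh t0 x) z"
      using w(2) infdist_le[of _ "Xh x" "fh t0 x"] by (simp add: gap_def)
    from any_closest_point_dot[OF Xh(3,1) w(1) that this]
    have "(fh t0 x - w) \<bullet> (y - w) \<le> 0" .
    then have "\<nu> \<bullet> (y - w) \<le> 0"
      using pos by (simp add: \<nu>_def mult_le_0_iff divide_le_0_iff)
    then show ?thesis
      by (simp add: inner_diff_right)
  qed
  have below: "\<nu> \<bullet> (fh t x - w) \<le> gap t x" for t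
  proof -
    obtain y where y: "y \<in> Xh x" "gap t x = dist (fh t x) y"
      using infdist_attains_inf[OF Xh(1,2)] unfolding gap_def by metis
    have "\<nu> \<bullet> (fh t x - w) \<le> \<nu> \<bullet> (fh t x - y)"
      using supp[OF y(1)] by (simp add: inner_diff_right)
    also have "\<dots> \<le> norm \<nu> * norm (fh t x - y)"
      by (rule norm_cauchy_schwarz)
    finally show ?thesis
      using \<nu>(1) y(2) by (simp add: dist_norm)
  qed
  let ?D = "\<tau> ?m (laplacian A (g t0) NT (N t0) (f t0) ?m + \<phi> t0 ?m (f t0 ?m))"
  have "t0 \<in> {0..\<epsilon>}"
    using t0 by simp
  from PDE[OF this, of ?m] have "((\<lambda>r. fh r x) has_vector_derivative ?D) (at t0 within {0..\<epsilon>})"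
    using V dom(2)[OF x] by (auto simp: has_fiber_derivative_def fh_def rep_def)
  \<comment> \<open>Time is reversed by \<open>s = t0 - t\<close>: \<open>t0\<close> may equal
    \<open>\<epsilon>\<close>, so only the past is available, while the one-sided test runs forward
    from 0.\<close>
  then have "((\<lambda>r. fh r x) has_vector_derivative ?D) (at (t0 - 0) within (\<lambda>s. t0 - s) ` {0..t0})"
    using t0 by (auto intro: has_vector_derivative_within_subset)
  moreover have "((\<lambda>s. t0 - s) has_vector_derivative - 1) (at 0 within {0..t0})"
    by (auto intro!: derivative_eq_intros)
  ultimately have "((\<lambda>s. fh (t0 - s) x) has_vector_derivative - ?D) (at 0 within {0..t0})"
    using vector_diff_chain_within[of "\<lambda>s. t0 - s" "- 1" 0 "{0..t0}" "\<lambda>r. fh r x" ?D] by (simp add: o_def)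
  then have "((\<lambda>s. fh (t0 - s) x - w) has_vector_derivative - ?D) (at 0 within {0..t0})"
    by (auto intro!: derivative_eq_intros)
  from bounded_linear.has_vector_derivative[OF bounded_linear_inner_right this]
  have "((\<lambda>s. \<nu> \<bullet> (fh (t0 - s) x - w)) has_real_derivative \<nu> \<bullet> (- ?D)) (at 0 within {0..t0})"
    by (simp add: has_real_derivative_iff_has_vector_derivative)
  then have "((\<lambda>s. \<nu> \<bullet> (fh (t0 - s) x - w) - exp (- (C * s)) * ?\<delta>) has_real_derivative
      \<nu> \<bullet> (- ?D) + C * ?\<delta>) (at 0 within {0..t0})"
    by (auto intro!: derivative_eq_intros)
  moreover have "\<nu> \<bullet> (fh (t0 - 0) x - w) - exp (- (C * 0)) * ?\<delta> = 0"
    using \<nu> by (simp add: dot_square_norm)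
  moreover have "\<nu> \<bullet> (fh (t0 - s) x - w) - exp (- (C * s)) * ?\<delta> \<le> 0" if "s \<in> {0..t0}" for s
    using below[of "t0 - s"] max[of "t0 - s"] that by simp
  ultimately have "\<nu> \<bullet> (- ?D) + C * ?\<delta> \<le> 0"
    by (rule one_sided_max_first[OF t0(1)])
  then have "C * ?\<delta> \<le> \<nu> \<bullet> ?D"
    by simp
  with \<nu> w(1) supp show ?thesis
    by (rule that)
qed

text \<open>The transition matrices are bounded on a compact part of the overlap. Applied to
  differences of vectors, this compares the distances measured in two trivializations.\<close>

lemma (in vec_bundle) triv_comparison:
  assumes V: "(V, \<tau>) \<in> trivs E" and V': "(V', \<tau>') \<in> trivs E" and P: "compact P" "P \<subseteq> V \<inter> V'"
  obtains C where "0 \<le> C" "\<And>p v. p \<in> P \<Longrightarrow> v \<in> fiber E p \<Longrightarrow> norm (\<tau>' p v) \<le> C * norm (\<tau> p v)"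
proof -
  let ?c = "const_section E \<tau>"
  have "\<exists>B. \<forall>p\<in>P. norm (\<tau>' p (?c b p)) \<le> B" for b
  proof -
    have "smooth_fun A (V' \<inter> V) (\<lambda>p. \<tau>' p (?c b p))"
      using smooth_section_const_section[OF V] V' unfolding smooth_section_iff by blast
    then have "continuous_on (V' \<inter> V) (\<lambda>p. \<tau>' p (?c b p))"
      by (rule smooth_fun_continuous) (rule open_Int[OF triv(1)[OF V'] triv(1)[OF V]])
    then have "continuous_on P (\<lambda>p. \<tau>' p (?c b p))"
      by (rule continuous_on_subset) (use P(2) in auto)
    then have "bounded ((\<lambda>p. \<tau>' p (?c b p)) ` P)"
      using P(1) by (intro compact_imp_bounded compact_continuous_image)
    then show ?thesis
      by (auto simp: bounded_iff)
  qed
  then obtain B where B: "\<And>b p. p \<in> P \<Longrightarrow> norm (\<tau>' p (?c b p)) \<le> B b"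
    by metis
  define C where "C = (\<Sum>b\<in>Basis. \<bar>B b\<bar>)"
  show ?thesis
  proof (rule that[of C])
    show "0 \<le> C"
      by (simp add: C_def sum_nonneg)
    fix p v assume p: "p \<in> P" and v: "v \<in> fiber E p"
    have pV: "p \<in> V" "p \<in> V'"
      using p P(2) by auto
    let ?w = "\<tau> p v"
    have fib: "?c b p \<in> fiber E p" for b
      by (rule triv_const_section[OF V pV(1)])
    have "\<tau>' p v = \<tau>' p (\<Sum>b\<in>Basis. (?w \<bullet> b) *\<^sub>R ?c b p)"
      using const_section_sum[OF V pV(1), of ?w] triv_const_section(3)[OF V pV(1) v] by simp
    also have "\<dots> = (\<Sum>b\<in>Basis. (?w \<bullet> b) *\<^sub>R \<tau>' p (?c b p))"
      using fib by (simp add: triv_sum[OF V' pV(2)] triv(4)[OF V' pV(2)] subspace_scale[OF subspace_fiber])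
    also have "norm \<dots> \<le> (\<Sum>b\<in>Basis. \<bar>B b\<bar> * norm ?w)"
    proof (rule sum_norm_le)
      fix b :: 'f assume "b \<in> Basis"
      then have "\<bar>?w \<bullet> b\<bar> * norm (\<tau>' p (?c b p)) \<le> norm ?w * \<bar>B b\<bar>"
        using B[OF p, of b] by (intro mult_mono Basis_le_norm) auto
      then show "norm ((?w \<bullet> b) *\<^sub>R \<tau>' p (?c b p)) \<le> \<bar>B b\<bar> * norm ?w"
        by (simp add: mult.commute)
    qed
    finally show "norm (\<tau>' p v) \<le> C * norm ?w"
      by (simp add: C_def sum_distrib_right)
  qed
qed

lemma (in flow) compact_chart_ball:
  assumes "(U, c) \<in> A" "cball x R \<subseteq> c ` (U \<inter> V)"
  shows "compact (inv_into U c ` cball x R)" "inv_into U c ` cball x R \<subseteq> U \<inter> V"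
proof -
  show "inv_into U c ` cball x R \<subseteq> U \<inter> V"
    using assms chart(5)[OF assms(1)] by fastforce
  have "continuous_on (cball x R) (inv_into U c)"
    by (rule continuous_on_subset[OF chart(4)[OF assms(1)]]) (use assms(2) in auto)
  then show "compact (inv_into U c ` cball x R)"
    by (intro compact_continuous_image compact_cball)
qed

lemma (in flow) stays_in_X:
  assumes compact: "compact (UNIV :: 'm set)"
  shows "\<forall>m. \<forall>t\<in>{0..\<epsilon>}. (m, f t m) \<in> X"
proof (rule ccontr)
  assume "\<not> ?thesis"
  then obtain m1 t1 where viol: "t1 \<in> {0..\<epsilon>}" "(m1, f t1 m1) \<notin> X"
    by blast
  have "\<exists>U c V \<tau> R. (U, c) \<in> A \<and> (V, \<tau>) \<in> trivs E \<and> m \<in> U \<and> m \<in> V \<and> 0 < R \<and>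
      cball (c m) R \<subseteq> c ` (U \<inter> V)" for m
  proof -
    obtain U c where U: "(U, c) \<in> A" "m \<in> U"
      using chart_at by blast
    have "m \<in> (\<Union>(V, \<tau>)\<in>trivs E. V)"
      using vector_bundle by (simp add: vector_bundle_def)
    then obtain V \<tau> where V: "(V, \<tau>) \<in> trivs E" "m \<in> V"
      by auto
    have "open (c ` (U \<inter> V))" "c m \<in> c ` (U \<inter> V)"
      using open_chart_image[OF U(1) triv(1)[OF V(1)]] U V by auto
    then obtain R where "0 < R" "cball (c m) R \<subseteq> c ` (U \<inter> V)"
      using open_contains_cball by blast
    with U V show ?thesis
      by blast
  qed
  then obtain U c V \<tau> R where box: "\<And>m. (U m, c m) \<in> A" "\<And>m. (V m, \<tau> m) \<in> trivs E"
    "\<And>m. m \<in> U m" "\<And>m. m \<in> V m" "\<And>m. 0 < R m" "\<And>m. cball (c m m) (R m) \<subseteq> c m ` (U m \<inter> V m)"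
    by metis
  \<comment> \<open>A box is set up around every point \<open>m\<close> at once; compactness selects
    finitely many of them afterwards.\<close>
  interpret B: flow_box A E \<epsilon> N g NT \<phi> X f "U m" "c m" "V m" "\<tau> m" for m
    using box by unfold_locales
  define x where "x m = c m m" for m
  define K where "K m = cball (x m) (R m)" for m
  have K: "cball (x m) (R m) \<subseteq> B.dom m" for m
    using box(6) by (simp add: x_def B.dom_def)
  define \<rho> where "\<rho> m y = (R m)\<^sup>2 - (norm (y - x m))\<^sup>2" for m y
  have \<rho>_nonneg: "0 \<le> \<rho> m y" if "y \<in> K m" for m y
    using that power_mono[of "norm (y - x m)" "R m" 2] by (simp add: K_def \<rho>_def dist_norm norm_minus_commute)
  \<comment> \<open>The inner half balls, not the full balls, are used for the cover: on them the
    weight is at least \<open>3 / 4 * (R m)\<^sup>2\<close>.\<close>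
  define W where "W m = {p \<in> U m \<inter> V m. norm (c m p - x m) < R m / 2}" for m
  have W_open: "open (W m)" for m
  proof -
    have "W m = (U m \<inter> V m) \<inter> (\<lambda>p. norm (c m p - x m)) -` {..<R m / 2}"
      by (auto simp: W_def)
    moreover have "continuous_on (U m \<inter> V m) (\<lambda>p. norm (c m p - x m))"
      by (intro continuous_intros continuous_on_subset[OF chart(3)[OF box(1)]]) auto
    ultimately show ?thesis
      using B.open_UV by (simp add: continuous_open_preimage)
  qed
  have W_mem: "m \<in> W m" for m
    using box(3-5) by (simp add: W_def x_def)
  obtain D where D: "finite D" "UNIV \<subseteq> (\<Union>m\<in>D. W m)"
  proof (rule compactE_image[OF compact, of UNIV W])
    show "UNIV \<subseteq> (\<Union>m\<in>UNIV. W m)"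
      using W_mem by blast
  qed (use W_open in auto)
  then have D_ne: "D \<noteq> {}"
    by auto
  have W: "c i p \<in> K i" "c i p \<in> B.dom i" "B.ci i (c i p) = p" "3 / 4 * (R i)\<^sup>2 \<le> \<rho> i (c i p)"
    if "p \<in> W i" for i p
  proof -
    have n: "norm (c i p - x i) \<le> R i / 2"
      using that by (simp add: W_def)
    then show "c i p \<in> K i"
      using box(5)[of i] by (simp add: K_def dist_norm norm_minus_commute)
    then show "c i p \<in> B.dom i"
      using K[of i] by (auto simp: K_def)
    show "B.ci i (c i p) = p"
      using that chart(5)[OF box(1)] by (simp add: W_def)
    show "3 / 4 * (R i)\<^sup>2 \<le> \<rho> i (c i p)"
      using power_mono[OF n, of 2] by (simp add: \<rho>_def power_divide)
  qed
  have "\<exists>C\<ge>0. \<forall>p \<in> B.ci i ` K i \<inter> B.ci j ` K j. \<forall>v\<in>fiber E p. norm (\<tau> j p v) \<le> C * norm (\<tau> i p v)" for i j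
  proof -
    note Ki = compact_chart_ball[OF box(1) box(6), folded x_def, folded K_def]
    have "compact (B.ci i ` K i \<inter> B.ci j ` K j)"
      by (rule compact_Int[OF Ki(1) Ki(1)])
    moreover have "B.ci i ` K i \<inter> B.ci j ` K j \<subseteq> V i \<inter> V j"
      using Ki(2)[of i] Ki(2)[of j] by blast
    ultimately show ?thesis
      by (rule triv_comparison[OF box(2) box(2)]) blast
  qed
  then obtain Q where Q: "\<And>i j. 0 \<le> Q i j"
    "\<And>i j p v. p \<in> B.ci i ` K i \<Longrightarrow> p \<in> B.ci j ` K j \<Longrightarrow> v \<in> fiber E p \<Longrightarrow>
      norm (\<tau> j p v) \<le> Q i j * norm (\<tau> i p v)"
    by (metis IntI)
  \<comment> \<open>The nearest point in box \<open>i\<close> stands for a vector \<open>v\<close>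
    of X over the same point. Read in the trivialization of box \<open>j\<close>, this vector
    competes for the gap there.\<close>
  have gap_compare: "B.gap j t y \<le> Q i j * B.gap i t (c i (B.ci j y))"
    if t: "t \<in> {0..\<epsilon>}" and y: "y \<in> K j" and i: "B.ci j y \<in> W i" for i j t y
  proof -
    let ?p = "B.ci j y"
    have yd: "y \<in> B.dom j"
      using y K[of j] by (auto simp: K_def)
    note Wi = W[OF i]
    have p: "?p \<in> B.ci i ` K i" "?p \<in> B.ci j ` K j"
      using image_eqI[of ?p "B.ci i" "c i ?p" "K i"] Wi(1,3) y by auto
    obtain w where w: "w \<in> B.Xh i (c i ?p)" "B.gap i t (c i ?p) = dist (B.fh i t (c i ?p)) w"
      using infdist_attains_inf[OF B.closed_Xh[OF Wi(2)] B.Xh_nonempty[OF Wi(2)]] unfolding B.gap_def by metis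
    define v where "v = const_section E (\<tau> i) w ?p"
    have pi: "?p \<in> V i"
      using i by (simp add: W_def)
    note cs = triv_const_section(1,2)[OF box(2) pi, of w, folded v_def]
    have "(?p, v) \<in> X"
      using w(1) by (simp add: B.Xh_def Wi(3) v_def)
    then have "\<tau> j ?p v \<in> B.Xh j y"
      using B.triv_mem_Xh[OF yd] cs(1) by simp
    then have "B.gap j t y \<le> dist (B.fh j t y) (\<tau> j ?p v)"
      unfolding B.gap_def by (rule infdist_le)
    also have "\<dots> = norm (\<tau> j ?p (f t ?p - v))"
      by (simp add: B.fh_def B.rep_def dist_norm triv_diff[OF box(2) B.dom(2)[OF yd] B.f_fiber[OF t] cs(1)])
    also have "\<dots> \<le> Q i j * norm (\<tau> i ?p (f t ?p - v))"
      by (intro Q(2) p subspace_diff[OF subspace_fiber] B.f_fiber[OF t] cs(1))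
    also have "norm (\<tau> i ?p (f t ?p - v)) = B.gap i t (c i ?p)"
      by (simp add: w(2) B.fh_def B.rep_def dist_norm Wi(3) triv_diff[OF box(2) pi B.f_fiber[OF t] cs(1)] cs(2))
    finally show ?thesis .
  qed
  define r where "r = Min ((\<lambda>i. 3 / 4 * (R i)\<^sup>2) ` D)"
  have r: "0 < r" "\<And>i. i \<in> D \<Longrightarrow> r \<le> 3 / 4 * (R i)\<^sup>2"
  proof -
    have "0 < 3 / 4 * (R i)\<^sup>2" for i
      using box(5)[of i] by simp
    then show "0 < r"
      unfolding r_def using D(1) D_ne by (subst Min_gr_iff) auto
    show "r \<le> 3 / 4 * (R i)\<^sup>2" if "i \<in> D" for i
      unfolding r_def using D(1) that by (intro Min_le) auto
  qed
  define q where "q = 1 + (\<Sum>i\<in>D. \<Sum>j\<in>D. Q i j)"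
  have q: "0 < q" "Q i j \<le> q" if "i \<in> D" "j \<in> D" for i j
  proof -
    have "0 \<le> (\<Sum>i\<in>D. \<Sum>j\<in>D. Q i j)"
      by (intro sum_nonneg Q(1))
    then show "0 < q"
      by (simp add: q_def)
    have "Q i j \<le> (\<Sum>j\<in>D. Q i j)"
      using that D(1) Q(1) by (intro member_le_sum) auto
    also have "\<dots> \<le> (\<Sum>i\<in>D. \<Sum>j\<in>D. Q i j)"
      using that D(1) Q(1) by (intro member_le_sum[of i D "\<lambda>i. \<Sum>j\<in>D. Q i j"]) (auto intro: sum_nonneg)
    finally show "Q i j \<le> q"
      by (simp add: q_def)
  qed
  have "0 < q"
    using q(1) D_ne by blast
  \<comment> \<open>\<open>r\<close> bounds the weights of the selected boxes below on their inner
    halves, and \<open>q\<close> is a common comparison factor for the gaps, kept positive by its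
    summand 1. Their quotient will be the lower bound for the weight at the maximum.\<close>
  define \<kappa> where "\<kappa> = r / q"
  have \<kappa>: "0 < \<kappa>"
    using r(1) \<open>0 < q\<close> by (simp add: \<kappa>_def)
  have "\<exists>C\<ge>0. \<forall>t y \<nu> w. B.touching m (x m) (R m) t y \<nu> w \<longrightarrow> \<kappa> \<le> \<rho> m y \<longrightarrow>
      \<nu> \<bullet> \<tau> m (B.ci m y) (laplacian A (g t) NT (N t) (f t) (B.ci m y) + \<phi> t (B.ci m y) (f t (B.ci m y)))
        \<le> C * B.gap m t y" for m
    by (rule B.evolution_estimate[OF K[of m] \<kappa> box(5)[of m]]) (unfold \<rho>_def, blast)
  then obtain C where C: "\<And>m. 0 \<le> C m"
    "\<And>m t y \<nu> w. B.touching m (x m) (R m) t y \<nu> w \<Longrightarrow> \<kappa> \<le> \<rho> m y \<Longrightarrow>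
      \<nu> \<bullet> \<tau> m (B.ci m y) (laplacian A (g t) NT (N t) (f t) (B.ci m y) + \<phi> t (B.ci m y) (f t (B.ci m y)))
        \<le> C m * B.gap m t y"
    by metis
  \<comment> \<open>Strictly larger than every constant of the selected boxes; strictness yields the
    final contradiction.\<close>
  define C0 where "C0 = 1 + (\<Sum>m\<in>D. C m)"
  have C0: "C m < C0" if "m \<in> D" for m
    using member_le_sum[of m D C] that D(1) C(1) by (simp add: C0_def)
  \<comment> \<open>Grouped as a nonnegative continuous weight times the upper semicontinuous gap,
    so that the product is upper semicontinuous.\<close>
  define \<Phi> where "\<Phi> m z = (exp (- (C0 * fst z)) * \<rho> m (snd z)) * B.gap m (fst z) (snd z)" for m z
  have "\<exists>z. z \<in> {0..\<epsilon>} \<times> K m \<and> (\<forall>z'\<in>{0..\<epsilon>} \<times> K m. \<Phi> m z' \<le> \<Phi> m z)" for m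
  proof -
    have 1: "compact ({0..\<epsilon>} \<times> K m)"
      by (auto simp: K_def intro: compact_Times)
    have 2: "{0..\<epsilon>} \<times> K m \<noteq> {}"
      using eps box(5)[of m] by (auto simp: K_def)
    have 3: "\<forall>\<^sub>F z' in at z within {0..\<epsilon>} \<times> K m. \<Phi> m z' < b"
      if z: "z \<in> {0..\<epsilon>} \<times> K m" and b: "\<Phi> m z < b" for z b
      unfolding \<Phi>_def
    proof (rule usc_mult)
      show "continuous_on ({0..\<epsilon>} \<times> K m) (\<lambda>z. exp (- (C0 * fst z)) * \<rho> m (snd z))"
        unfolding \<rho>_def by (intro continuous_intros)
      show "0 \<le> exp (- (C0 * fst z)) * \<rho> m (snd z)" if "z \<in> {0..\<epsilon>} \<times> K m" for z
        using that \<rho>_nonneg by auto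
      show "\<forall>\<^sub>F z' in at z within {0..\<epsilon>} \<times> K m. B.gap m (fst z') (snd z') < b"
        if "B.gap m (fst z) (snd z) < b" for b
        using B.gap_usc[OF K[of m], of "fst z" "snd z" b] z that by (auto simp: K_def)
    qed (use z b in \<open>auto simp: \<Phi>_def\<close>)
    show ?thesis
      by (rule usc_attains_max[OF 1 2 3]) blast+
  qed
  then obtain z where z: "\<And>m. z m \<in> {0..\<epsilon>} \<times> K m" "\<And>m z'. z' \<in> {0..\<epsilon>} \<times> K m \<Longrightarrow> \<Phi> m z' \<le> \<Phi> m (z m)"
    by metis
  have fin: "finite ((\<lambda>m. \<Phi> m (z m)) ` D)" "(\<lambda>m. \<Phi> m (z m)) ` D \<noteq> {}"
    using D(1) D_ne by auto
  obtain j where j: "j \<in> D" "\<Phi> j (z j) = Max ((\<lambda>m. \<Phi> m (z m)) ` D)"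
    using Max_in[OF fin] by auto
  have max: "\<Phi> i z' \<le> \<Phi> j (z j)" if "i \<in> D" "z' \<in> {0..\<epsilon>} \<times> K i" for i z'
    using z(2)[OF that(2)] Max_ge[OF fin(1), of "\<Phi> i (z i)"] that(1) j(2) by auto
  define t0 y0 where "t0 = fst (z j)" and "y0 = snd (z j)"
  have ty: "t0 \<in> {0..\<epsilon>}" "y0 \<in> K j" "z j = (t0, y0)"
    using z(1)[of j] by (auto simp: t0_def y0_def mem_Times_iff)
  have y0d: "y0 \<in> B.dom j"
    using ty(2) K[of j] by (auto simp: K_def)
  have "0 < \<Phi> j (z j)"
  proof -
    obtain i where i: "i \<in> D" "m1 \<in> W i"
      using D(2) by auto
    note Wi = W[OF i(2)]
    have "B.gap i t1 (c i m1) \<noteq> 0"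
      using B.gap_eq_0_iff[OF Wi(2) viol(1)] viol(2) Wi(3) by simp
    then have "0 < B.gap i t1 (c i m1)"
      using B.gap_nonneg[of i t1 "c i m1"] by simp
    moreover have "0 < \<rho> i (c i m1)"
      using less_le_trans[OF _ Wi(4)] box(5)[of i] by simp
    ultimately have "0 < \<Phi> i (t1, c i m1)"
      by (simp add: \<Phi>_def)
    also have "\<dots> \<le> \<Phi> j (z j)"
      using max[OF i(1)] viol(1) Wi(1) by simp
    finally show ?thesis .
  qed
  then have pos: "0 < \<rho> j y0" "0 < B.gap j t0 y0"
    using \<rho>_nonneg[OF ty(2)] B.gap_nonneg[of j t0 y0] by (auto simp: \<Phi>_def ty(3) zero_less_mult_iff)
  \<comment> \<open>The initial condition makes the gap vanish at time 0; hence there is a past on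
    which to test maximality in time.\<close>
  have t0: "0 < t0"
  proof (rule ccontr)
    assume "\<not> 0 < t0"
    then have "t0 = 0"
      using ty(1) by simp
    then show False
      using B.gap_eq_0_iff[OF y0d, of 0] init eps pos(2) by simp
  qed
  \<comment> \<open>The point also lies in the inner half of a selected ball \<open>i\<close>. Its
    value of \<open>\<Phi>\<close> there does not exceed the maximum, while the gap in box
    \<open>j\<close> is at most \<open>q\<close> times the gap in box \<open>i\<close>; cancelling
    the positive gap leaves \<open>r \<le> \<rho> j y0 * q\<close>.\<close>
  have \<rho>_ge: "\<kappa> \<le> \<rho> j y0"
  proof -
    let ?p = "B.ci j y0"
    obtain i where i: "i \<in> D" "?p \<in> W i"
      using D(2) by auto
    note Wi = W[OF i(2)]
    let ?g = "B.gap i t0 (c i ?p)"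
    have le: "B.gap j t0 y0 \<le> q * ?g"
      using gap_compare[OF ty(1,2) i(2)] mult_right_mono[OF q(2)[OF i(1) j(1)] B.gap_nonneg] by (rule order_trans)
    with pos(2) have "0 < q * ?g"
      by linarith
    then have g: "0 < ?g"
      using \<open>0 < q\<close> by (simp add: zero_less_mult_iff)
    have "\<Phi> i (t0, c i ?p) \<le> \<Phi> j (z j)"
      using max[OF i(1)] ty(1) Wi(1) by simp
    then have "\<rho> i (c i ?p) * ?g \<le> \<rho> j y0 * B.gap j t0 y0"
      by (simp add: \<Phi>_def ty(3) mult.assoc)
    also have "\<dots> \<le> \<rho> j y0 * (q * ?g)"
      using le pos(1) by (intro mult_left_mono) auto
    finally have "\<rho> i (c i ?p) * ?g \<le> (\<rho> j y0 * q) * ?g"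
      by (simp add: mult.assoc)
    then have "\<rho> i (c i ?p) \<le> \<rho> j y0 * q"
      using g by simp
    then have "r \<le> \<rho> j y0 * q"
      using r(2)[OF i(1)] Wi(4) by linarith
    then show ?thesis
      using \<open>0 < q\<close> by (simp add: \<kappa>_def field_simps)
  qed
  \<comment> \<open>The weight vanishes on the bounding sphere, so the maximum is interior and lines
    through it can be followed both ways.\<close>
  have y0_in: "norm (y0 - x j) < R j"
  proof (rule ccontr)
    assume "\<not> norm (y0 - x j) < R j"
    then have "(R j)\<^sup>2 \<le> (norm (y0 - x j))\<^sup>2"
      using box(5)[of j] by (intro power_mono) auto
    with pos(1) show False
      by (simp add: \<rho>_def)
  qed
  have space: "\<forall>y\<in>K j. \<rho> j y * B.gap j t0 y \<le> \<rho> j y0 * B.gap j t0 y0"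
  proof
    fix y assume "y \<in> K j"
    then have "\<Phi> j (t0, y) \<le> \<Phi> j (z j)"
      using z(2)[of "(t0, y)" j] ty(1) by simp
    then show "\<rho> j y * B.gap j t0 y \<le> \<rho> j y0 * B.gap j t0 y0"
      by (simp add: \<Phi>_def ty(3) mult.assoc)
  qed
  have time: "B.gap j t y0 \<le> exp (C0 * (t - t0)) * B.gap j t0 y0" if t: "t \<in> {0..t0}" for t
  proof -
    have "\<Phi> j (t, y0) \<le> \<Phi> j (z j)"
      using z(2)[of "(t, y0)" j] ty(1,2) t by simp
    then have "\<rho> j y0 * (exp (- (C0 * t)) * B.gap j t y0) \<le> \<rho> j y0 * (exp (- (C0 * t0)) * B.gap j t0 y0)"
      by (simp add: \<Phi>_def ty(3) mult_ac)
    then have "exp (- (C0 * t)) * B.gap j t y0 \<le> exp (- (C0 * t0)) * B.gap j t0 y0"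
      using pos(1) by simp
    then have "exp (C0 * t) * (exp (- (C0 * t)) * B.gap j t y0) \<le> exp (C0 * t) * (exp (- (C0 * t0)) * B.gap j t0 y0)"
      by (rule mult_left_mono) simp
    then show ?thesis
      by (simp add: mult.assoc[symmetric] exp_add[symmetric] right_diff_distrib)
  qed
  have "t0 \<le> \<epsilon>"
    using ty(1) by simp
  show False
  proof (rule B.growth_at_max[OF y0d t0 \<open>t0 \<le> \<epsilon>\<close> pos(2) time])
    fix \<nu> w
    assume \<nu>: "norm \<nu> = 1" "B.fh j t0 y0 = w + B.gap j t0 y0 *\<^sub>R \<nu>" "w \<in> B.Xh j y0"
      "\<And>y. y \<in> B.Xh j y0 \<Longrightarrow> \<nu> \<bullet> y \<le> \<nu> \<bullet> w"
      and growth: "C0 * B.gap j t0 y0 \<le> \<nu> \<bullet> \<tau> j (B.ci j y0)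
        (laplacian A (g t0) NT (N t0) (f t0) (B.ci j y0) + \<phi> t0 (B.ci j y0) (f t0 (B.ci j y0)))"
    have "B.touching j (x j) (R j) t0 y0 \<nu> w"
      using ty(1) y0_in space \<nu> by (simp add: B.touching_def K_def \<rho>_def)
    \<comment> \<open>The maximum grows at least at the rate \<open>C0\<close> times the gap, while
      the evolution allows at most \<open>C j\<close> times the gap, and the gap is
      positive.\<close>
    from order_trans[OF growth C(2)[OF this \<rho>_ge]]
    show False
      using C0[OF j(1)] pos(2) by simp
  qed
qed

theorem theorem2p1:
  fixes A :: "('m::{t2_space,second_countable_topology}, 'a::euclidean_space) chart set"
    and E :: "('m, 'v::real_vector, 'f::euclidean_space) vbundle"
    and g :: "real \<Rightarrow> 'm \<Rightarrow> 'a \<Rightarrow> 'a \<Rightarrow> real"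
    and h :: "real \<Rightarrow> 'm \<Rightarrow> 'v \<Rightarrow> 'v \<Rightarrow> real"
    and N :: "real \<Rightarrow> 'm \<Rightarrow> 'a \<Rightarrow> ('m \<Rightarrow> 'v) \<Rightarrow> 'v"
    and NT :: "'m \<Rightarrow> 'a \<Rightarrow> ('m \<Rightarrow> 'a) \<Rightarrow> 'a"
    and \<phi> :: "real \<Rightarrow> 'm \<Rightarrow> 'v \<Rightarrow> 'v"
    and X :: "('m \<times> 'v) set"
    and f :: "real \<Rightarrow> 'm \<Rightarrow> 'v"
    and \<epsilon> :: real
  assumes eps: "0 < \<epsilon>"
    and M: "closed_manifold A"
    and g: "riemannian_metric A {0..\<epsilon>} g"
    and E: "vector_bundle A E"
    and h: "bundle_metric A E {0..\<epsilon>} h"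
    and N: "connection A E {0..\<epsilon>} N"
    and NT: "connection A (tangent_bundle A) UNIV (\<lambda>_. NT)"
    and phi: "vertical_vector_field A E {0..\<epsilon>} \<phi>"
    and X: "X \<subseteq> total_space E"
    and P1: "closedin (total_topology E) X"
    and P2: "\<And>m. convex {v. (m, v) \<in> X}"
    and P3: "\<And>t. t \<in> {0..\<epsilon>} \<Longrightarrow> parallel_transport_invariant A E (N t) X"
    and ODE: "\<And>m t\<^sub>0 t\<^sub>1 c. 0 \<le> t\<^sub>0 \<Longrightarrow> t\<^sub>0 < t\<^sub>1 \<Longrightarrow> t\<^sub>1 \<le> \<epsilon> \<Longrightarrow>
      (\<And>t. t \<in> {t\<^sub>0..t\<^sub>1} \<Longrightarrow> c t \<in> fiber E m) \<Longrightarrow>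
      (\<And>t. t \<in> {t\<^sub>0..t\<^sub>1} \<Longrightarrow>
        has_fiber_derivative E m c (\<phi> t m (c t)) (at t within {t\<^sub>0..t\<^sub>1})) \<Longrightarrow>
      (m, c t\<^sub>0) \<in> X \<Longrightarrow> (\<And>t. t \<in> {t\<^sub>0..t\<^sub>1} \<Longrightarrow> (m, c t) \<in> X)"
    and f_smooth: "smooth_section_family A E {0..\<epsilon>} UNIV f"
    and PDE: "\<And>m t. t \<in> {0..\<epsilon>} \<Longrightarrow>
      has_fiber_derivative E m (\<lambda>r. f r m)
        (laplacian A (g t) NT (N t) (f t) m + \<phi> t m (f t m)) (at t within {0..\<epsilon>})"
    and init: "\<And>m. (m, f 0 m) \<in> X"
  shows "\<forall>m. \<forall>t\<in>{0..\<epsilon>}. (m, f t m) \<in> X"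
proof -
  have atlas: "smooth_atlas A" and compact: "compact (UNIV :: 'm set)"
    using M by (auto simp: closed_manifold_def)
  interpret flow A E \<epsilon> N g NT \<phi> X f
  proof unfold_locales
    show "(m, c t) \<in> X" if "0 \<le> t\<^sub>0" "t\<^sub>0 < t\<^sub>1" "t\<^sub>1 \<le> \<epsilon>"
      "\<And>t. t \<in> {t\<^sub>0..t\<^sub>1} \<Longrightarrow> c t \<in> fiber E m"
      "\<And>t. t \<in> {t\<^sub>0..t\<^sub>1} \<Longrightarrow> has_fiber_derivative E m c (\<phi> t m (c t)) (at t within {t\<^sub>0..t\<^sub>1})"
      "(m, c t\<^sub>0) \<in> X" "t \<in> {t\<^sub>0..t\<^sub>1}" for m t\<^sub>0 t\<^sub>1 c t
      by (rule ODE[OF that])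
  qed (rule atlas E N eps g NT phi X P1 P2 P3 f_smooth PDE init; assumption?)+
  show ?thesis
    by (rule stays_in_X[OF compact])
qed

end
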